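(* Let $V\subseteq\mathcal V$ be finite and nonempty, $\boldsymbol d_V\in\mathbb R^{n_V}$, let $\{V_k\}_{k=1}^K$ be a partition of $V$ into nonempty disjoint sets, and let $V_k\subseteq W_k\subseteq V$ for $k=1,\dots,K$. Assume: (i) for every nonempty $U\subseteq V$, with $\mathbb D_U:=\{\boldsymbol d_U-\boldsymbol H_{-U}\boldsymbol z_{-U}:\boldsymbol z_{-U}\in\mathbb R^{n_{-U}}\}$, one has $\boldsymbol Q_U\succeq0$, and for every $\boldsymbol d\in\mathbb D_U$ the problem $P_U(\boldsymbol d)$ has a primal-dual solution at which the second-order sufficient condition (SOSC) and the linear independence constraint qualification (LICQ) hold; (ii) $\omega:=\min_{1\le k\le K}\Delta_V(V_k,N_V(W_k))-1\ge1$; (iii) $\underline\sigma:=\inf_{U\subseteq\mathcal V}\underline\sigma_U>0$ and $\overline\sigma:=\sup_{U\subseteq\mathcal V}\overline\sigma_U<\infty$. Let $\boldsymbol z_V^{(0)}\in\mathbb R^{n_V}$ and let $\{\boldsymbol z_V^{(\ell)}\}_{\ell\ge0}$ be generated by the overlapping Schwarz iteration $$\boldsymbol z_{V_k}^{(\ell+1)}=T_{V_k\leftarrow W_k}\,\boldsymbol z_{W_k}^*\!\left(\boldsymbol d_{W_k}-\boldsymbol H_{-W_k}\boldsymbol z^{(\ell)}_{-W_k}\right),\qquad k=1,\dots,K,\ \ell=0,1,\dots$$ Then, with $\boldsymbol z_V^\dagger:=\boldsymbol z_V^*(\boldsymbol d_V)$, for every $\ell\ge0$, $$\Vert\boldsymbol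 z_V^{(\ell)}-\boldsymbol z_V^\dagger\Vert_{V,\infty}\le\left(\alpha_V(\omega)\right)^\ell\Vert\boldsymbol z_V^{(0)}-\boldsymbol z_V^\dagger\Vert_{V,\infty},$$ where $\alpha_V(\omega):=R_V\,\Gamma\,\rho^{\lceil(\omega-1)/2\rceil}$, $\Gamma:=\overline\sigma/\underline\sigma^2$, $\rho:=(\overline\sigma^2-\underline\sigma^2)/(\overline\sigma^2+\underline\sigma^2)$, and $R_V:=\max_{U\subseteq V}\Vert\boldsymbol H_{-U}\Vert_{U,-U,1}$.
   Context: Graph and data. $\mathcal G(\mathcal V,\mathcal E)$ is an undirected, possibly infinite graph with totally ordered (integer-labelled) node set $\mathcal V$. For $X\subseteq U\subseteq\mathcal V$, $N_U(X):=\{j\in U\setminus X:\exists i\in X,\ \{i,j\}\in\mathcal E\}$. For each node $i$ there are integers $r_i\ge1$, $m_i^{\mathcal E},m_i^{\mathcal I}\ge0$, $m_i:=m_i^{\mathcal E}+m_i^{\mathcal I}$, $n_i:=r_i+m_i$. The fixed data are real matrices $Q_{i,j}\in\mathbb R^{r_i\times r_j}$ with $Q_{i,j}=Q_{j,i}^\top$, $A^{\mathcal E}_{i,j}\in\mathbb R^{m^{\mathcal E}_i\times r_j}$, $A^{\mathcal I}_{i,j}\in\mathbb R^{m^{\mathcal I}_i\times r_j}$, all equal to zero if $i\ne j$ and $\{i,j\}\notin\mathcal E$. $A_{i,j}$ is $A^{\mathcal E}_{i,j}$ stacked over $A^{\mathcal I}_{i,j}$, and $H_{i,j}:=\begin{bmatrix}Q_{i,j}&A_{j,i}^\top\\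 A_{i,j}&0\end{bmatrix}\in\mathbb R^{n_i\times n_j}$. Problem. For a finite nonempty $U\subseteq\mathcal V$ put $n_U:=\sum_{i\in U}n_i$, and let $\boldsymbol Q_U,\boldsymbol A_U,\boldsymbol A_U^{\mathcal E},\boldsymbol A_U^{\mathcal I},\boldsymbol H_U$ be the block matrices with blocks $Q_{i,j},A_{i,j},A_{i,j}^{\mathcal E},A_{i,j}^{\mathcal I},H_{i,j}$, $i,j\in U$ (nodes in increasing order). Write $\boldsymbol z_U=\{z_i\}_{i\in U}$ with $z_i=(x_i,\lambda_i)$, $\lambda_i=(\lambda_i^{\mathcal E},\lambda_i^{\mathcal I})$, and $\boldsymbol d_U=\{d_i\}_{i\in U}$ with $d_i=(f_i,g_i)$, $g_i=(g_i^{\mathcal E},g_i^{\mathcal I})$, so $\boldsymbol z_U,\boldsymbol d_U\in\mathbb R^{n_U}$; $\boldsymbol x_U,\boldsymbol\lambda_U,\boldsymbol f_U$, etc. collect the corresponding parts over $i\in U$. The quadratic program $P_U(\boldsymbol d_U)$ is: minimize $\frac12\boldsymbol x_U^\top\boldsymbol Q_U\boldsymbol x_U-\boldsymbol f_U^\top\boldsymbol x_U$ over $\boldsymbol x_U$ subject to $\boldsymbol A^{\mathcal E}_U\boldsymbol x_U=\boldsymbol g^{\mathcal E}_U$ (multiplier $\boldsymbol\lambda_U^{\mathcal E}$) and $\boldsymbol A^{\mathcal I}_U\boldsymbol x_U\ge\boldsymbol g^{\mathcal I}_U$ (multiplier $\boldsymbol\lambda_U^{\mathcal I}$). A primal-dual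 solution is a vector $\boldsymbol z_U$ satisfying the KKT conditions $\boldsymbol Q_U\boldsymbol x_U+\boldsymbol A_U^\top\boldsymbol\lambda_U=\boldsymbol f_U$, $\boldsymbol A_U^{\mathcal E}\boldsymbol x_U=\boldsymbol g_U^{\mathcal E}$, $\boldsymbol A_U^{\mathcal I}\boldsymbol x_U\ge\boldsymbol g_U^{\mathcal I}$, $\boldsymbol\lambda_U^{\mathcal I}\le0$, $\mathrm{diag}(\boldsymbol\lambda_U^{\mathcal I})(\boldsymbol A_U^{\mathcal I}\boldsymbol x_U-\boldsymbol g_U^{\mathcal I})=0$. LICQ: the rows of $\boldsymbol A_U$ of the active constraints (all equalities, and inequalities holding with equality) are linearly independent. SOSC: $w^\top\boldsymbol Q_Uw>0$ for every nonzero $w$ in the critical cone at the primal-dual solution. Under assumption (i), the primal-dual solution of $P_U(\boldsymbol d)$ is unique for each $\boldsymbol d\in\mathbb D_U$, $U\subseteq V$; it is denoted $\boldsymbol z_U^*(\boldsymbol d)$. Complementary quantities. For $U\subseteq V$: $\boldsymbol H_{-U}:=\{H_{i,j}\}_{i\in U,\,j\in N_V(U)}$, $\boldsymbol z_{-U}:=\{z_j\}_{j\in N_V(U)}$, $n_{-U}:=\sum_{j\in N_V(U)}n_j$; $\boldsymbol d_U,\boldsymbol z_U$ denote restrictions of $\boldsymbol d_V,\boldsymbol z_V$ to the blocks in $U$. $T_{U_1\leftarrow U_2}$ (for $U_1\subseteq U_2$) extracts from $\boldsymbol z_{U_2}$ the blocks $\{z_i\}_{i\in U_1}$. Bases. $M[B,B]$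 and $v[B]$ denote the submatrix/subvector with indices in $B$. A nonempty $B\subseteq\{1,\dots,n_U\}$ is a basis if $\boldsymbol H_U[B,B]$ is nonsingular; its basic solution for $P_U(\boldsymbol d)$ is the vector $\boldsymbol z\in\mathbb R^{n_U}$ with $\boldsymbol H_U[B,B]\,\boldsymbol z[B]=\boldsymbol d[B]$ and zero components outside $B$. $B$ is optimal for $P_U(\boldsymbol d)$ if it is a basis and its basic solution is a primal-dual solution of $P_U(\boldsymbol d)$. To each finite nonempty $U\subseteq\mathcal V$ is associated a convex set $\mathbb D_U\subseteq\mathbb R^{n_U}$, which for $U\subseteq V$ is the set in assumption (i) (for other $U$ it is any given set). $\mathbb B_U$ is the set of all $B$ optimal for $P_U(\boldsymbol d)$ for some $\boldsymbol d\in\mathbb D_U$. $\underline\sigma_U:=\min_{B\in\mathbb B_U}\sigma_{\min}(\boldsymbol H_U[B,B])$, $\overline\sigma_U:=\max_{B\in\mathbb B_U}\sigma_{\max}(\boldsymbol H_U[B,B])$, with $\sigma_{\min},\sigma_{\max}$ the extreme singular values; the infimum and supremum in (iii) are over finite nonempty $U\subseteq\mathcal V$ with $\mathbb B_U\neq\emptyset$. Norms and distances. $\Vert\cdot\Vert$ is the Euclidean norm or the induced matrix 2-norm. $\Vert\boldsymbol z_V\Vert_{V,\infty}:=\max_{i\in V}\Vert z_i\Vert$. $\Vert\boldsymbol H_{-U}\Vert_{U,-U,1}:=\sum_{i\in U}\sum_{j\in N_V(U)}\Vert H_{i,j}\Vert$. $\Delta_V(u,u')$ is the graph distance in the subgraph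 of $\mathcal G$ induced by $V$ ($+\infty$ if not connected), and $\Delta_V(X,Y):=\min_{u\in X,u'\in Y}\Delta_V(u,u')$ ($+\infty$ if $Y=\emptyset$). Conventions: $\rho^\infty:=0$, $0^0:=1$. *)

theory Defs
  imports
    "HOL-Library.Extended_Nat"
    "HOL-Library.Disjoint_Sets"
    "Jordan_Normal_Form.DL_Rank_Submatrix"
    "Jordan_Normal_Form.Spectral_Radius"
begin

section \<open>Norms and singular values of real vectors and matrices\<close>

definition vnorm :: "real vec \<Rightarrow> real" where
  "vnorm v = sqrt (v \<bullet> v)"

text \<open>Induced 2-norm.\<close>

definition mnorm :: "real mat \<Rightarrow> real" where
  "mnorm M = (SUP v\<in>{v \<in> carrier_vec (dim_col M). vnorm v \<le> 1}. vnorm (M *\<^sub>v v))"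

text \<open>Only applied to square matrices of positive size, for which these are all \<open>n\<close> singular values.\<close>

definition singular_values :: "real mat \<Rightarrow> real set" where
  "singular_values M = sqrt ` spectrum (transpose_mat M * M)"

definition sigma_min :: "real mat \<Rightarrow> real" where
  "sigma_min M = Min (singular_values M)"

definition sigma_max :: "real mat \<Rightarrow> real" where
  "sigma_max M = Max (singular_values M)"

definition pos_semidef :: "real mat \<Rightarrow> bool" where
  "pos_semidef M \<longleftrightarrow> square_mat M \<and> transpose_mat M = M \<and>
     (\<forall>w\<in>carrier_vec (dim_row M). 0 \<le> w \<bullet> (M *\<^sub>v w))"

definition convex_vecs :: "real vec set \<Rightarrow> bool" where
  "convex_vecs S \<longleftrightarrow> (\<forall>x\<in>S. \<forall>y\<in>S. \<forall>t. 0 \<le> t \<and> t \<le> 1 \<longrightarrow> (1 - t) \<cdot>\<^sub>v x + t \<cdot>\<^sub>v y \<in> S)"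

text \<open>Subvector with indices in \<open>B\<close>, enumerated exactly as in \<^const>\<open>submatrix\<close>.\<close>

definition subvec :: "'a vec \<Rightarrow> nat set \<Rightarrow> 'a vec" where
  "subvec v B = vec (card {i. i < dim_vec v \<and> i \<in> B}) (\<lambda>k. v $ pick B k)"


section \<open>Block vectors and block matrices over a finite set of nodes\<close>

text \<open>
  \<open>p i\<close> is the length of block \<open>i\<close>. Position \<open>a\<close> of a block vector over \<open>U\<close> belongs to
  component \<open>s\<close> of block \<open>i\<close>, where \<open>(i, s)\<close> is entry \<open>a\<close> of \<open>block_index p U\<close>.
\<close>

definition block_index :: "(int \<Rightarrow> nat) \<Rightarrow> int set \<Rightarrow> (int \<times> nat) list" where
  "block_index p U = concat (map (\<lambda>i. map (Pair i) [0..<p i]) (sorted_list_of_set U))"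

definition block_dim :: "(int \<Rightarrow> nat) \<Rightarrow> int set \<Rightarrow> nat" where
  "block_dim p U = (\<Sum>i\<in>U. p i)"

definition block_vec :: "(int \<Rightarrow> nat) \<Rightarrow> int set \<Rightarrow> (int \<Rightarrow> 'a vec) \<Rightarrow> 'a vec" where
  "block_vec p U v = vec (block_dim p U) (\<lambda>a. case block_index p U ! a of (i, s) \<Rightarrow> v i $ s)"

definition block_mat ::
  "(int \<Rightarrow> nat) \<Rightarrow> int set \<Rightarrow> (int \<Rightarrow> nat) \<Rightarrow> int set \<Rightarrow> (int \<Rightarrow> int \<Rightarrow> 'a mat) \<Rightarrow> 'a mat" where
  "block_mat p U q W M = mat (block_dim p U) (block_dim q W)
     (\<lambda>(a, b). case (block_index p U ! a, block_index q W ! b) of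
        ((i, s), (j, t)) \<Rightarrow> M i j $$ (s, t))"

text \<open>Block \<open>i\<close> of a block vector over \<open>U\<close>; it starts after the blocks of the smaller nodes.\<close>

definition block :: "(int \<Rightarrow> nat) \<Rightarrow> int set \<Rightarrow> 'a vec \<Rightarrow> int \<Rightarrow> 'a vec" where
  "block p U v i = vec (p i) (\<lambda>s. v $ (block_dim p {j \<in> U. j < i} + s))"

lemma length_block_index: "finite U \<Longrightarrow> length (block_index p U) = block_dim p U"
  by (simp add: block_index_def block_dim_def length_concat comp_def
      sum_list_distinct_conv_sum_set)

lemma block_index_nth:
  assumes "finite U" "i \<in> U" "s < p i"
  shows "block_index p U ! (block_dim p {j \<in> U. j < i} + s) = (i, s)"
    and "block_dim p {j \<in> U. j < i} + s < block_dim p U"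
proof -
  let ?f = "\<lambda>i. map (Pair i) [0..<p i]"
  let ?L = "{j \<in> U. j < i}" and ?R = "{j \<in> U. i < j}"
  have fin: "finite ?L" "finite ?R" using assms(1) by auto
  have "sorted_list_of_set U = sorted_list_of_set ?L @ i # sorted_list_of_set ?R"
  proof (rule sorted_distinct_set_unique)
    show "sorted (sorted_list_of_set ?L @ i # sorted_list_of_set ?R)"
      using fin by (auto simp: sorted_append)
    show "distinct (sorted_list_of_set ?L @ i # sorted_list_of_set ?R)"
      using fin by auto
    show "set (sorted_list_of_set U) = set (sorted_list_of_set ?L @ i # sorted_list_of_set ?R)"
      using fin assms by auto
  qed (use assms in auto)
  hence eq: "block_index p U = block_index p ?L @ ?f i @ block_index p ?R"
    by (simp add: block_index_def)
  show "block_index p U ! (block_dim p ?L + s) = (i, s)"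
    unfolding eq using length_block_index[OF fin(1), of p] assms(3) by (simp add: nth_append)
  show "block_dim p ?L + s < block_dim p U"
    using length_block_index[OF assms(1), of p] length_block_index[OF fin(1), of p] assms(3)
    by (simp add: eq)
qed

lemma block_block_vec:
  assumes "finite U" "i \<in> U" "v i \<in> carrier_vec (p i)"
  shows "block p U (block_vec p U v) i = v i"
  using assms block_index_nth[OF assms(1,2)]
  by (intro eq_vecI) (auto simp: block_def block_vec_def)


section \<open>Graph-structured quadratic programs\<close>

record graph_qp =
  nodes :: "int set"
  edges :: "int set set"
  rdim :: "int \<Rightarrow> nat"
  mEdim :: "int \<Rightarrow> nat"
  mIdim :: "int \<Rightarrow> nat"
  Qblk :: "int \<Rightarrow> int \<Rightarrow> real mat"
  AEblk :: "int \<Rightarrow> int \<Rightarrow> real mat"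
  AIblk :: "int \<Rightarrow> int \<Rightarrow> real mat"

definition valid_graph_qp :: "graph_qp \<Rightarrow> bool" where
  "valid_graph_qp G \<longleftrightarrow>
     edges G \<subseteq> {{i, j} | i j. i \<in> nodes G \<and> j \<in> nodes G} \<and>
     (\<forall>i\<in>nodes G. rdim G i \<ge> 1) \<and>
     (\<forall>i\<in>nodes G. \<forall>j\<in>nodes G.
        Qblk G i j \<in> carrier_mat (rdim G i) (rdim G j) \<and>
        Qblk G i j = transpose_mat (Qblk G j i) \<and>
        AEblk G i j \<in> carrier_mat (mEdim G i) (rdim G j) \<and>
        AIblk G i j \<in> carrier_mat (mIdim G i) (rdim G j) \<and>
        (i \<noteq> j \<and> {i, j} \<notin> edges G \<longrightarrow>
           Qblk G i j = 0\<^sub>m (rdim G i) (rdim G j) \<and>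
           AEblk G i j = 0\<^sub>m (mEdim G i) (rdim G j) \<and>
           AIblk G i j = 0\<^sub>m (mIdim G i) (rdim G j)))"

definition mdim :: "graph_qp \<Rightarrow> int \<Rightarrow> nat" where
  "mdim G i = mEdim G i + mIdim G i"

definition ndim :: "graph_qp \<Rightarrow> int \<Rightarrow> nat" where
  "ndim G i = rdim G i + mdim G i"

definition Ablk :: "graph_qp \<Rightarrow> int \<Rightarrow> int \<Rightarrow> real mat" where
  "Ablk G i j = AEblk G i j @\<^sub>r AIblk G i j"

definition Hblk :: "graph_qp \<Rightarrow> int \<Rightarrow> int \<Rightarrow> real mat" where
  "Hblk G i j = four_block_mat (Qblk G i j) (transpose_mat (Ablk G j i))
                               (Ablk G i j) (0\<^sub>m (mdim G i) (mdim G j))"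

definition Qmat :: "graph_qp \<Rightarrow> int set \<Rightarrow> real mat" where
  "Qmat G U = block_mat (rdim G) U (rdim G) U (Qblk G)"

definition Amat :: "graph_qp \<Rightarrow> int set \<Rightarrow> real mat" where
  "Amat G U = block_mat (mdim G) U (rdim G) U (Ablk G)"

definition AEmat :: "graph_qp \<Rightarrow> int set \<Rightarrow> real mat" where
  "AEmat G U = block_mat (mEdim G) U (rdim G) U (AEblk G)"

definition AImat :: "graph_qp \<Rightarrow> int set \<Rightarrow> real mat" where
  "AImat G U = block_mat (mIdim G) U (rdim G) U (AIblk G)"

definition Hmat :: "graph_qp \<Rightarrow> int set \<Rightarrow> real mat" where
  "Hmat G U = block_mat (ndim G) U (ndim G) U (Hblk G)"

definition nU :: "graph_qp \<Rightarrow> int set \<Rightarrow> nat" where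
  "nU G U = block_dim (ndim G) U"

text \<open>
  Parts of a vector in \<open>\<real>\<^bsup>n_U\<^esup>\<close>: for \<open>z_U\<close> these are the primal variables and the multipliers,
  and for \<open>d_U\<close> they are \<open>f_U\<close>, \<open>g_U\<close> and the two parts of \<open>g_U\<close>.
\<close>

definition x_part :: "graph_qp \<Rightarrow> int set \<Rightarrow> real vec \<Rightarrow> real vec" where
  "x_part G U z = block_vec (rdim G) U (\<lambda>i. vec_first (block (ndim G) U z i) (rdim G i))"

definition l_part :: "graph_qp \<Rightarrow> int set \<Rightarrow> real vec \<Rightarrow> real vec" where
  "l_part G U z = block_vec (mdim G) U (\<lambda>i. vec_last (block (ndim G) U z i) (mdim G i))"

definition lE_part :: "graph_qp \<Rightarrow> int set \<Rightarrow> real vec \<Rightarrow> real vec" where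
  "lE_part G U z = block_vec (mEdim G) U
     (\<lambda>i. vec_first (vec_last (block (ndim G) U z i) (mdim G i)) (mEdim G i))"

definition lI_part :: "graph_qp \<Rightarrow> int set \<Rightarrow> real vec \<Rightarrow> real vec" where
  "lI_part G U z = block_vec (mIdim G) U
     (\<lambda>i. vec_last (vec_last (block (ndim G) U z i) (mdim G i)) (mIdim G i))"


section \<open>Primal-dual solutions and constraint qualifications\<close>

definition pd_solution :: "graph_qp \<Rightarrow> int set \<Rightarrow> real vec \<Rightarrow> real vec \<Rightarrow> bool" where
  "pd_solution G U d z \<longleftrightarrow>
     z \<in> carrier_vec (nU G U) \<and>
     Qmat G U *\<^sub>v x_part G U z + transpose_mat (Amat G U) *\<^sub>v l_part G U z = x_part G U d \<and>
     AEmat G U *\<^sub>v x_part G U z = lE_part G U d \<and>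
     AImat G U *\<^sub>v x_part G U z \<ge> lI_part G U d \<and>
     lI_part G U z \<le> 0\<^sub>v (block_dim (mIdim G) U) \<and>
     mat_diag (block_dim (mIdim G) U) (\<lambda>a. lI_part G U z $ a) *\<^sub>v
       (AImat G U *\<^sub>v x_part G U z - lI_part G U d) = 0\<^sub>v (block_dim (mIdim G) U)"

text \<open>
  Row indices of \<open>A_U\<close> that are active at \<open>z\<close>; within the rows of node \<open>i\<close>, the equality
  constraints are those with local index below \<open>mEdim G i\<close>.
\<close>

definition active_rows :: "graph_qp \<Rightarrow> int set \<Rightarrow> real vec \<Rightarrow> real vec \<Rightarrow> nat set" where
  "active_rows G U d z = {a. a < block_dim (mdim G) U \<and>
     (case block_index (mdim G) U ! a of (i, s) \<Rightarrow>
        s < mEdim G i \<or> (Amat G U *\<^sub>v x_part G U z) $ a = l_part G U d $ a)}"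

definition LICQ :: "graph_qp \<Rightarrow> int set \<Rightarrow> real vec \<Rightarrow> real vec \<Rightarrow> bool" where
  "LICQ G U d z \<longleftrightarrow>
     (let L = rows (submatrix (Amat G U) (active_rows G U d z) UNIV) in
        distinct L \<and>
        \<not> module.lin_dep class_ring (module_vec TYPE(real) (block_dim (rdim G) U)) (set L))"

definition critical_cone :: "graph_qp \<Rightarrow> int set \<Rightarrow> real vec \<Rightarrow> real vec \<Rightarrow> real vec set" where
  "critical_cone G U d z = {w \<in> carrier_vec (block_dim (rdim G) U).
     AEmat G U *\<^sub>v w = 0\<^sub>v (block_dim (mEdim G) U) \<and>
     (\<forall>a < block_dim (mIdim G) U. (AImat G U *\<^sub>v x_part G U z) $ a = lI_part G U d $ a \<longrightarrow>
        (if lI_part G U z $ a < 0 then (AImat G U *\<^sub>v w) $ a = 0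
         else (AImat G U *\<^sub>v w) $ a \<ge> 0))}"

definition SOSC :: "graph_qp \<Rightarrow> int set \<Rightarrow> real vec \<Rightarrow> real vec \<Rightarrow> bool" where
  "SOSC G U d z \<longleftrightarrow>
     (\<forall>w\<in>critical_cone G U d z. w \<noteq> 0\<^sub>v (block_dim (rdim G) U) \<longrightarrow> w \<bullet> (Qmat G U *\<^sub>v w) > 0)"

text \<open>Meaningful only if the primal-dual solution exists and is unique.\<close>

definition zstar :: "graph_qp \<Rightarrow> int set \<Rightarrow> real vec \<Rightarrow> real vec" where
  "zstar G U d = (THE z. pd_solution G U d z)"


section \<open>Bases\<close>

text \<open>Components are numbered from \<open>0\<close> rather than from \<open>1\<close>.\<close>

definition is_basis :: "graph_qp \<Rightarrow> int set \<Rightarrow> nat set \<Rightarrow> bool" where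
  "is_basis G U B \<longleftrightarrow> B \<noteq> {} \<and> B \<subseteq> {0..<nU G U} \<and> invertible_mat (submatrix (Hmat G U) B B)"

definition basic_solution :: "graph_qp \<Rightarrow> int set \<Rightarrow> real vec \<Rightarrow> nat set \<Rightarrow> real vec" where
  "basic_solution G U d B = (THE z. z \<in> carrier_vec (nU G U) \<and>
     submatrix (Hmat G U) B B *\<^sub>v subvec z B = subvec d B \<and>
     (\<forall>a < nU G U. a \<notin> B \<longrightarrow> z $ a = 0))"

definition optimal_basis :: "graph_qp \<Rightarrow> int set \<Rightarrow> real vec \<Rightarrow> nat set \<Rightarrow> bool" where
  "optimal_basis G U d B \<longleftrightarrow> is_basis G U B \<and> pd_solution G U d (basic_solution G U d B)"

definition bases :: "graph_qp \<Rightarrow> (int set \<Rightarrow> real vec set) \<Rightarrow> int set \<Rightarrow> nat set set" where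
  "bases G D U = {B. \<exists>d\<in>D U. optimal_basis G U d B}"

definition sigma_low :: "graph_qp \<Rightarrow> (int set \<Rightarrow> real vec set) \<Rightarrow> int set \<Rightarrow> real" where
  "sigma_low G D U = (MIN B\<in>bases G D U. sigma_min (submatrix (Hmat G U) B B))"

definition sigma_high :: "graph_qp \<Rightarrow> (int set \<Rightarrow> real vec set) \<Rightarrow> int set \<Rightarrow> real" where
  "sigma_high G D U = (MAX B\<in>bases G D U. sigma_max (submatrix (Hmat G U) B B))"

definition based_sets :: "graph_qp \<Rightarrow> (int set \<Rightarrow> real vec set) \<Rightarrow> int set set" where
  "based_sets G D = {U. U \<subseteq> nodes G \<and> finite U \<and> U \<noteq> {} \<and> bases G D U \<noteq> {}}"

text \<open>
  The supremum of a set of reals that is not bounded above is unspecified, so that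
  finiteness of \<open>sigma_sup\<close> has to be expressed by \<^const>\<open>bdd_above\<close>.
\<close>

definition sigma_inf :: "graph_qp \<Rightarrow> (int set \<Rightarrow> real vec set) \<Rightarrow> real" where
  "sigma_inf G D = (INF U\<in>based_sets G D. sigma_low G D U)"

definition sigma_sup :: "graph_qp \<Rightarrow> (int set \<Rightarrow> real vec set) \<Rightarrow> real" where
  "sigma_sup G D = (SUP U\<in>based_sets G D. sigma_high G D U)"


section \<open>Neighbourhoods, distances and complementary quantities\<close>

definition nbh :: "graph_qp \<Rightarrow> int set \<Rightarrow> int set \<Rightarrow> int set" where
  "nbh G U X = {j \<in> U - X. \<exists>i\<in>X. {i, j} \<in> edges G}"

definition adj :: "graph_qp \<Rightarrow> int set \<Rightarrow> (int \<times> int) set" where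
  "adj G V = {(i, j). i \<in> V \<and> j \<in> V \<and> {i, j} \<in> edges G}"

definition gdist :: "graph_qp \<Rightarrow> int set \<Rightarrow> int \<Rightarrow> int \<Rightarrow> enat" where
  "gdist G V u u' = (INF k\<in>{k. (u, u') \<in> adj G V ^^ k}. enat k)"

definition gdist_set :: "graph_qp \<Rightarrow> int set \<Rightarrow> int set \<Rightarrow> int set \<Rightarrow> enat" where
  "gdist_set G V X Y = (INF u\<in>X. INF u'\<in>Y. gdist G V u u')"

definition block_extract :: "graph_qp \<Rightarrow> int set \<Rightarrow> int set \<Rightarrow> real vec \<Rightarrow> real vec" where
  "block_extract G U1 U2 z = block_vec (ndim G) U1 (block (ndim G) U2 z)"

definition Hcompl :: "graph_qp \<Rightarrow> int set \<Rightarrow> int set \<Rightarrow> real mat" where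
  "Hcompl G V U = block_mat (ndim G) U (ndim G) (nbh G V U) (Hblk G)"

definition Hcompl_norm1 :: "graph_qp \<Rightarrow> int set \<Rightarrow> int set \<Rightarrow> real" where
  "Hcompl_norm1 G V U = (\<Sum>i\<in>U. \<Sum>j\<in>nbh G V U. mnorm (Hblk G i j))"

definition norm_inf :: "graph_qp \<Rightarrow> int set \<Rightarrow> real vec \<Rightarrow> real" where
  "norm_inf G V z = (MAX i\<in>V. vnorm (block (ndim G) V z i))"

definition data_set :: "graph_qp \<Rightarrow> int set \<Rightarrow> real vec \<Rightarrow> int set \<Rightarrow> real vec set" where
  "data_set G V dV U =
     {block_extract G U V dV - Hcompl G V U *\<^sub>v y | y. y \<in> carrier_vec (nU G (nbh G V U))}"


section \<open>The convergence rate\<close>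

definition overlap ::
  "graph_qp \<Rightarrow> int set \<Rightarrow> nat \<Rightarrow> (nat \<Rightarrow> int set) \<Rightarrow> (nat \<Rightarrow> int set) \<Rightarrow> enat" where
  "overlap G V K P W = (MIN k\<in>{1..K}. gdist_set G V (P k) (nbh G V (W k))) - 1"

definition ceil_half :: "enat \<Rightarrow> enat" where
  "ceil_half e = (case e of enat k \<Rightarrow> enat (nat \<lceil>real k / 2\<rceil>) | \<infinity> \<Rightarrow> \<infinity>)"

definition enat_power :: "real \<Rightarrow> enat \<Rightarrow> real" where
  "enat_power x e = (case e of enat k \<Rightarrow> x ^ k | \<infinity> \<Rightarrow> 0)"

definition Gamma_const :: "graph_qp \<Rightarrow> (int set \<Rightarrow> real vec set) \<Rightarrow> real" where
  "Gamma_const G D = sigma_sup G D / (sigma_inf G D)\<^sup>2"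

definition rho_const :: "graph_qp \<Rightarrow> (int set \<Rightarrow> real vec set) \<Rightarrow> real" where
  "rho_const G D = ((sigma_sup G D)\<^sup>2 - (sigma_inf G D)\<^sup>2) / ((sigma_sup G D)\<^sup>2 + (sigma_inf G D)\<^sup>2)"

definition R_const :: "graph_qp \<Rightarrow> int set \<Rightarrow> real" where
  "R_const G V = (MAX U\<in>Pow V. Hcompl_norm1 G V U)"

definition alpha ::
  "graph_qp \<Rightarrow> (int set \<Rightarrow> real vec set) \<Rightarrow> int set \<Rightarrow> enat \<Rightarrow> real" where
  "alpha G D V \<omega> =
     R_const G V * Gamma_const G D * enat_power (rho_const G D) (ceil_half (\<omega> - 1))"

end

theory Submission
  imports Defs "HOL-Analysis.L2_Norm"
begin

text \<open>
  Each KKT system is a mixed complementarity system for the symmetric kernel \<open>H\<close>, and by SOSC and LICQ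
  the primal variables together with the active rows form an optimal basis. Along a segment of data
  the solution is therefore continuous and piecewise affine, its slope on each piece solving
  \<open>H[B,B] z = e\<close> for one of finitely many bases \<open>B\<close>. With \<open>c = 2 / (\<sigma>\<^sub>m\<^sub>a\<^sub>x\<^sup>2 + \<sigma>\<^sub>m\<^sub>i\<^sub>n\<^sup>2)\<close> and
  \<open>T = I - c H\<^sup>2\<close> such a \<open>z\<close> satisfies \<open>z = c H e + T z\<close>, where \<open>T\<close> has norm at most \<open>\<rho>\<close> and enlarges
  supports by two graph steps; hence \<open>z = T\<^sup>n z\<close> on every block that is too far from the support of \<open>e\<close>,
  and \<open>z\<close> decays there like \<open>\<rho>\<^sup>n\<close>. Finally the solution on \<open>V\<close> restricts to a fixed point of each
  subdomain update, so that one Schwarz step contracts the error by the decay across the overlap.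
\<close>

section \<open>Norms of symmetric real matrices\<close>


text \<open>\<open>H\<close> is in general indefinite, so relaxation with \<open>H\<close> itself
  need not contract; its square is positive definite on a basis. The price is two graph steps per
  application of \<open>T\<close>, hence the halved exponent. The count runs as follows: a change of
  the boundary values on \<open>N_V(W_k)\<close> alters the data at distance 1 from it,
  \<open>c H e\<close> lives within distance 2, and \<open>T\<^sup>m\<close> adds
  \<open>2 m\<close>; thus \<open>z = T\<^sup>n z\<close> holds on blocks at distance greater than
  \<open>2 n\<close>. The nodes of \<open>V_k\<close> have distance at least \<omega> + 1, and the
  ceiling of (\<omega> - 1) / 2 is the largest \<open>n\<close> with \<open>2 n\<close> below
  \<omega> + 1. Strict complementarity is not assumed, so the solution has kinks where the basis
  changes, possibly with several bases optimal at one point. The path is therefore covered by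
  finitely many closed sets of parameters, one for each basis, instead of being differentiated.
  Convexity of the data sets keeps the segment where solutions are regular.\<close>

lemma of_real_eigenvalue_symmetric:
  fixes M :: "real mat" and \<mu> :: complex
  assumes M: "M \<in> carrier_mat n n" and sym: "transpose_mat M = M"
    and ev: "eigenvalue (map_mat of_real M) \<mu>"
  shows "\<exists>x. \<mu> = of_real x \<and> eigenvalue M x"
proof -
  let ?C = "map_mat complex_of_real M"
  have C: "?C \<in> carrier_mat n n" using M by simp
  from ev obtain v where v: "v \<in> carrier_vec n" "v \<noteq> 0\<^sub>v n" "?C *\<^sub>v v = \<mu> \<cdot>\<^sub>v v"
    using C unfolding eigenvalue_def eigenvector_def by auto
  have symij: "M $$ (i,j) = M $$ (j,i)" if "i < n" "j < n" for i j
    using sym M that by (metis carrier_matD index_transpose_mat(1))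
  have comp: "(\<Sum>j<n. of_real (M $$ (i,j)) * v $ j) = \<mu> * v $ i" if "i < n" for i
  proof -
    have "(?C *\<^sub>v v) $ i = (\<Sum>j<n. of_real (M $$ (i,j)) * v $ j)"
      using M v(1) that by (simp add: scalar_prod_def lessThan_atLeast0)
    thus ?thesis using v that by simp
  qed
  \<comment> \<open>The Hermitian form of \<open>M\<close> at \<open>v\<close> is evaluated twice:
    the eigenvalue equation makes it \<open>\<mu>\<close> times a positive number, symmetry makes it
    real.\<close>
  define q where "q = (\<Sum>i<n. \<Sum>j<n. cnj (v $ i) * (of_real (M $$ (i,j)) * v $ j))"
  have q: "q = \<mu> * of_real (\<Sum>i<n. (cmod (v $ i))\<^sup>2)"
  proof -
    have "q = (\<Sum>i<n. cnj (v $ i) * (\<mu> * v $ i))"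
      unfolding q_def by (intro sum.cong refl) (simp add: comp flip: sum_distrib_left)
    also have "\<dots> = (\<Sum>i<n. \<mu> * of_real ((cmod (v $ i))\<^sup>2))"
      by (intro sum.cong refl) (simp add: complex_norm_square mult_ac flip: of_real_power)
    finally show ?thesis by (simp add: sum_distrib_left)
  qed
  have "cnj q = (\<Sum>i<n. \<Sum>j<n. cnj (v $ j) * (of_real (M $$ (i,j)) * v $ i))"
    unfolding q_def by (simp add: mult_ac)
  also have "\<dots> = (\<Sum>j<n. \<Sum>i<n. cnj (v $ j) * (of_real (M $$ (i,j)) * v $ i))"
    by (rule sum.swap)
  also have "\<dots> = q" unfolding q_def by (intro sum.cong refl) (simp add: symij)
  finally have cq: "cnj q = q" .
  have pos: "(\<Sum>i<n. (cmod (v $ i))\<^sup>2) \<noteq> 0"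
  proof
    assume "(\<Sum>i<n. (cmod (v $ i))\<^sup>2) = 0"
    hence "\<forall>i<n. v $ i = 0" by (subst (asm) sum_nonneg_eq_0_iff) auto
    hence "v = 0\<^sub>v n" using v(1) by (intro eq_vecI) auto
    thus False using v(2) by simp
  qed
  have "cnj \<mu> = \<mu>" using cq pos unfolding q
    by (metis complex_cnj_mult complex_cnj_complex_of_real mult_right_cancel of_real_eq_0_iff)
  then obtain x where x: "\<mu> = of_real x"
    by (metis Reals_cnj_iff Reals_cases)
  \<comment> \<open>A real root of the characteristic polynomial yields a real eigenvector, so
    \<open>v\<close> is not split into real and imaginary parts.\<close>
  have "poly (char_poly ?C) (of_real x) = 0"
    using ev x eigenvalue_root_char_poly[OF C] by simp
  hence "poly (char_poly M) x = 0"
    unfolding of_real_hom.char_poly_hom[OF M] by simp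
  thus ?thesis using x eigenvalue_root_char_poly[OF M] by auto
qed

lemma symmetric_real_has_eigenvalue:
  fixes M :: "real mat"
  assumes M: "M \<in> carrier_mat n n" and sym: "transpose_mat M = M" and n: "n > 0"
  shows "spectrum M \<noteq> {}"
proof -
  have "map_mat complex_of_real M \<in> carrier_mat n n" using M by simp
  from spectrum_non_empty[OF this n] of_real_eigenvalue_symmetric[OF M sym]
  show ?thesis unfolding spectrum_def by auto
qed

text \<open>Log-convexity says that the ratios \<open>a (Suc k) / a k\<close> do not decrease. If
  the first one, \<open>q\<close>, exceeded 1, the sequence would grow at least like
  \<open>q ^ k\<close> and leave every bound.\<close>

lemma bounded_log_convex_nonincreasing:
  fixes a :: "nat \<Rightarrow> real"
  assumes nonneg: "\<And>k. 0 \<le> a k" and bound: "\<And>k. a k \<le> C"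
    and lc: "\<And>k. (a (Suc k))\<^sup>2 \<le> a k * a (Suc (Suc k))"
  shows "a 1 \<le> a 0"
proof (rule ccontr)
  assume "\<not> a 1 \<le> a 0"
  hence lt: "a 0 < a 1" by simp
  have a0: "a 0 > 0"
  proof (rule ccontr)
    assume "\<not> a 0 > 0"
    hence "a 0 = 0" using nonneg[of 0] by linarith
    thus False using lc[of 0] lt by simp
  qed
  define q where "q = a 1 / a 0"
  have q: "q > 1" using lt a0 by (simp add: q_def)
  have step: "a (Suc k) \<ge> q * a k \<and> a k > 0" for k
  proof (induction k)
    case 0
    show ?case using a0 by (simp add: q_def)
  next
    case (Suc k)
    have "0 < q * a k" using Suc q by simp
    hence pos: "a (Suc k) > 0" using Suc by linarith
    have "a k * (q * a (Suc k)) \<le> a (Suc k) * a (Suc k)"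
      using Suc pos by (simp add: mult.left_commute mult.commute mult_left_mono)
    also have "\<dots> \<le> a k * a (Suc (Suc k))" using lc[of k] by (simp add: power2_eq_square)
    finally have "q * a (Suc k) \<le> a (Suc (Suc k))" using Suc by (simp add: mult_le_cancel_left)
    thus ?case using pos by simp
  qed
  have grow: "a k \<ge> q ^ k * a 0" for k
  proof (induction k)
    case (Suc k)
    have "q ^ Suc k * a 0 \<le> q * a k" using Suc q by simp
    thus ?case using step[of k] by simp
  qed simp
  obtain k where "q ^ k > C / a 0" using real_arch_pow[OF q] by blast
  hence "q ^ k * a 0 > C" using a0 by (simp add: field_simps)
  thus False using grow[of k] bound[of k] by linarith
qed

lemma vnorm_nonneg [simp]: "0 \<le> vnorm v"
  by (simp add: vnorm_def scalar_prod_def sum_nonneg)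

lemma vnorm_eq_L2_set: "vnorm v = L2_set (\<lambda>i. v $ i) {..<dim_vec v}"
  by (simp add: vnorm_def L2_set_def scalar_prod_def power2_eq_square lessThan_atLeast0)

lemma vnorm_square: "(vnorm v)\<^sup>2 = v \<bullet> v"
  by (simp add: vnorm_def scalar_prod_def sum_nonneg)

lemma scalar_prod_le_vnorm:
  assumes "dim_vec v = dim_vec w"
  shows "v \<bullet> w \<le> vnorm v * vnorm w"
proof -
  have "v \<bullet> w \<le> (\<Sum>i<dim_vec v. \<bar>v $ i\<bar> * \<bar>w $ i\<bar>)"
    unfolding scalar_prod_def lessThan_atLeast0 assms
    by (intro sum_mono) (metis abs_ge_self abs_mult)
  also have "\<dots> \<le> vnorm v * vnorm w"
    unfolding vnorm_eq_L2_set assms by (rule L2_set_mult_ineq)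
  finally show ?thesis .
qed

lemma vnorm_smult: "vnorm (c \<cdot>\<^sub>v v) = \<bar>c\<bar> * vnorm v"
  by (simp add: vnorm_def real_sqrt_mult flip: power2_eq_square mult.assoc)

text \<open>
  The powers of a matrix of spectral radius below 1 are bounded, whereas symmetry makes
  \<open>k \<mapsto> \<parallel>T\<^sup>k v\<parallel>\<close> log-convex; so this sequence cannot increase at its first step.
\<close>

lemma symmetric_contraction:
  fixes T :: "real mat"
  assumes T: "T \<in> carrier_mat n n" and sym: "transpose_mat T = T"
    and ev: "\<And>x. eigenvalue T x \<Longrightarrow> \<bar>x\<bar> < 1" and v: "v \<in> carrier_vec n" and n: "n > 0"
  shows "vnorm (T *\<^sub>v v) \<le> vnorm v"
proof -
  let ?C = "map_mat complex_of_real T"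
  have C: "?C \<in> carrier_mat n n" using T by simp
  have "spectral_radius ?C < 1"
  proof -
    from spectral_radius_mem_max(1)[OF C n] obtain \<mu> where
      "eigenvalue ?C \<mu>" "spectral_radius ?C = cmod \<mu>" unfolding spectrum_def by auto
    thus ?thesis using of_real_eigenvalue_symmetric[OF T sym] ev by fastforce
  qed
  from spectral_radius_jnf_norm_bound_less_1_upper_triangular[OF C this]
  obtain c where c: "\<And>k. norm_bound (?C ^\<^sub>m k) c" by auto
  have pc: "T ^\<^sub>m k \<in> carrier_mat n n" for k using T by (rule pow_carrier_mat)
  \<comment> \<open>The bound on the complex powers is transferred entrywise, since the embedding of
    the reals commutes with matrix powers; \<open>c\<close> does not depend on
    \<open>k\<close>.\<close>
  have entry: "\<bar>(T ^\<^sub>m k) $$ (i,j)\<bar> \<le> c" if "i < n" "j < n" for i j k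
  proof -
    have "?C ^\<^sub>m k = map_mat of_real (T ^\<^sub>m k)" using of_real_hom.mat_hom_pow[OF T] by metis
    hence "cmod (of_real ((T ^\<^sub>m k) $$ (i,j))) \<le> c"
      using c[of k, unfolded norm_bound_def, rule_format, of i j] that T
        \<open>?C ^\<^sub>m k = map_mat of_real (T ^\<^sub>m k)\<close> by (simp del: map_carrier_mat)
    thus ?thesis by simp
  qed
  define a where "a k = vnorm (T ^\<^sub>m k *\<^sub>v v)" for k
  have "a 1 \<le> a 0"
  proof (rule bounded_log_convex_nonincreasing)
    fix k
    show "0 \<le> a k" by (simp add: a_def)
    show "a k \<le> (\<Sum>i<n. \<Sum>j<n. c * \<bar>v $ j\<bar>)"
    proof -
      have "a k \<le> (\<Sum>i<n. \<bar>(T ^\<^sub>m k *\<^sub>v v) $ i\<bar>)"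
        unfolding a_def vnorm_eq_L2_set 
        dim_mult_mat_vec pc[of k, THEN carrier_matD(1)] by (rule L2_set_le_sum_abs)
      also have "\<dots> \<le> (\<Sum>i<n. \<Sum>j<n. c * \<bar>v $ j\<bar>)"
      proof (rule sum_mono)
        fix i assume "i \<in> {..<n}"
        hence i: "i < n" by simp
        have "(T ^\<^sub>m k *\<^sub>v v) $ i = row (T ^\<^sub>m k) i \<bullet> v" using i pc[of k, THEN carrier_matD(1)] by (simp only: index_mult_mat_vec)
        also have "\<dots> = (\<Sum>j<n. (T ^\<^sub>m k) $$ (i,j) * v $ j)"
          unfolding scalar_prod_def using v i pc[of k, THEN carrier_matD(1)] pc[of k, THEN carrier_matD(2)]
          by (intro sum.cong) (auto simp: row_def)
        finally have "\<bar>(T ^\<^sub>m k *\<^sub>v v) $ i\<bar> = \<bar>\<Sum>j<n. (T ^\<^sub>m k) $$ (i,j) * v $ j\<bar>" by simp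
        also have "\<dots> \<le> (\<Sum>j<n. \<bar>(T ^\<^sub>m k) $$ (i,j) * v $ j\<bar>)" by (rule sum_abs)
        also have "\<dots> \<le> (\<Sum>j<n. c * \<bar>v $ j\<bar>)"
          unfolding abs_mult using entry[OF i] by (intro sum_mono mult_right_mono) auto
        finally show "\<bar>(T ^\<^sub>m k *\<^sub>v v) $ i\<bar> \<le> (\<Sum>j<n. c * \<bar>v $ j\<bar>)" .
      qed
      finally show ?thesis .
    qed
    define w where "w = T ^\<^sub>m k *\<^sub>v v"
    have w: "w \<in> carrier_vec n" using pc[of k] v by (simp add: w_def)
    have Suc_mult: "T ^\<^sub>m Suc m *\<^sub>v v = T *\<^sub>v (T ^\<^sub>m m *\<^sub>v v)" for m
    proof -
      have "T ^\<^sub>m Suc m = T * T ^\<^sub>m m"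
      proof (induction m)
        case 0 thus ?case using T by simp
      next
        case (Suc m)
        have "T ^\<^sub>m Suc (Suc m) = (T * T ^\<^sub>m m) * T" using Suc by simp
        also have "\<dots> = T * (T ^\<^sub>m m * T)" by (rule assoc_mult_mat[OF T pc T])
        finally show ?case by simp
      qed
      thus ?thesis using assoc_mult_mat_vec[OF T pc v] by simp
    qed
    \<comment> \<open>Log-convexity is Cauchy-Schwarz after one factor \<open>T\<close> has been
      moved across the scalar product by symmetry.\<close>
    have "(a (Suc k))\<^sup>2 = (T *\<^sub>v w) \<bullet> (T *\<^sub>v w)" unfolding a_def Suc_mult vnorm_square w_def ..
    also have "\<dots> = (transpose_mat T *\<^sub>v (T *\<^sub>v w)) \<bullet> w"
      by (rule transpose_vec_mult_scalar[symmetric, OF T w]) (use T w in auto)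
    also have "\<dots> = w \<bullet> (T *\<^sub>v (T *\<^sub>v w))"
      unfolding sym by (rule comm_scalar_prod[of _ n]) (use T w in auto)
    also have "\<dots> \<le> vnorm w * vnorm (T *\<^sub>v (T *\<^sub>v w))"
      using T w by (intro scalar_prod_le_vnorm) auto
    finally show "(a (Suc k))\<^sup>2 \<le> a k * a (Suc (Suc k))"
      unfolding a_def Suc_mult w_def .
  qed
  thus ?thesis using T v by (simp add: a_def)
qed

lemma smult_mat_mult_vec:
  fixes M :: "real mat"
  assumes "M \<in> carrier_mat m n" "v \<in> carrier_vec n"
  shows "(c \<cdot>\<^sub>m M) *\<^sub>v v = c \<cdot>\<^sub>v (M *\<^sub>v v)"
  using assms by (intro eq_vecI) (auto simp: scalar_prod_def sum_distrib_left mult_ac)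

text \<open>Division by any \<open>r' > r\<close> brings all eigenvalues strictly between -1 and 1,
  where the contraction result applies; then \<open>r'\<close> decreases to \<open>r\<close>. The
  detour takes care of eigenvalues of modulus exactly \<open>r\<close> and of
  \<open>r = 0\<close>.\<close>

lemma symmetric_norm_bound:
  fixes M :: "real mat"
  assumes M: "M \<in> carrier_mat n n" and sym: "transpose_mat M = M"
    and ev: "\<And>x. eigenvalue M x \<Longrightarrow> \<bar>x\<bar> \<le> r" and v: "v \<in> carrier_vec n" and r: "r \<ge> 0"
    and n: "n > 0"
  shows "vnorm (M *\<^sub>v v) \<le> r * vnorm v"
proof -
  have *: "vnorm (M *\<^sub>v v) \<le> r' * vnorm v" if r': "r' > r" for r'
  proof -
    let ?T = "(1 / r') \<cdot>\<^sub>m M"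
    have pos: "r' > 0" using r r' by simp
    have "vnorm (?T *\<^sub>v v) \<le> vnorm v"
    proof (rule symmetric_contraction[OF _ _ _ v n])
      show "transpose_mat ?T = ?T" using sym M
        by (intro eq_matI) (auto, metis carrier_matD index_transpose_mat(1))
      fix x assume "eigenvalue ?T x"
      then obtain u where u: "u \<in> carrier_vec n" "u \<noteq> 0\<^sub>v n" "?T *\<^sub>v u = x \<cdot>\<^sub>v u"
        using M unfolding eigenvalue_def eigenvector_def by auto
      have "(1 / r') \<cdot>\<^sub>v (M *\<^sub>v u) = x \<cdot>\<^sub>v u" using u M by (simp add: smult_mat_mult_vec)
      hence "r' \<cdot>\<^sub>v ((1 / r') \<cdot>\<^sub>v (M *\<^sub>v u)) = (r' * x) \<cdot>\<^sub>v u" by (simp add: smult_smult_assoc)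
      hence "M *\<^sub>v u = (r' * x) \<cdot>\<^sub>v u" using pos by (simp add: smult_smult_assoc)
      hence "eigenvalue M (r' * x)" using u M unfolding eigenvalue_def eigenvector_def by auto
      from ev[OF this] have "r' * \<bar>x\<bar> \<le> r" using pos by (simp add: abs_mult)
      hence "r' * \<bar>x\<bar> < r' * 1" using r' by linarith
      thus "\<bar>x\<bar> < 1" using pos by (metis mult_less_cancel_left_pos)
    qed (use M in auto)
    moreover have "?T *\<^sub>v v = (1 / r') \<cdot>\<^sub>v (M *\<^sub>v v)" using M v by (rule smult_mat_mult_vec)
    ultimately show ?thesis using pos by (simp add: vnorm_smult pos_divide_le_eq mult.commute)
  qed
  \<comment> \<open>The increment is scaled by \<open>vnorm v + 1\<close> because
    \<open>vnorm v\<close> may be zero.\<close>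
  have "vnorm (M *\<^sub>v v) \<le> r * vnorm v + e" if e: "e > 0" for e
  proof -
    have pos: "vnorm v + 1 > 0" using vnorm_nonneg[of v] by linarith
    hence "e / (vnorm v + 1) > 0" using e by (rule divide_pos_pos[rotated])
    hence "vnorm (M *\<^sub>v v) \<le> (r + e / (vnorm v + 1)) * vnorm v" by (intro *) linarith
    also have "\<dots> = r * vnorm v + e * (vnorm v / (vnorm v + 1))" by (simp add: distrib_right)
    also have "e * (vnorm v / (vnorm v + 1)) \<le> e * 1"
      using pos e by (intro mult_left_mono) (simp_all add: divide_le_eq_1_pos)
    finally show ?thesis by simp
  qed
  thus ?thesis by (rule field_le_epsilon)
qed


section \<open>Singular values and spectral bounds\<close>

lemma singular_values_finite_nonempty:
  fixes M :: "real mat"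
  assumes M: "M \<in> carrier_mat n n" and n: "n > 0"
  shows "finite (singular_values M)" "singular_values M \<noteq> {}"
proof -
  have C: "transpose_mat M * M \<in> carrier_mat n n" using M by simp
  have "transpose_mat (transpose_mat M * M) = transpose_mat M * M"
    using M by (metis transpose_mult transpose_carrier_mat transpose_transpose)
  from symmetric_real_has_eigenvalue[OF C this n] card_finite_spectrum(1)[OF C]
  show "finite (singular_values M)" "singular_values M \<noteq> {}" by (auto simp: singular_values_def)
qed

text \<open>Pairing with the eigenvector gives
  \<open>x * (u \<bullet> u) = (M u) \<bullet> (M u)\<close>. This makes the square root in
  \<open>singular_values\<close> reversible: a Gram eigenvalue is the square of its singular
  value.\<close>

lemma eigenvalue_gram_nonneg:
  fixes M :: "real mat"
  assumes M: "M \<in> carrier_mat n n" and ev: "eigenvalue (transpose_mat M * M) x"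
  shows "0 \<le> x"
proof -
  from ev obtain u where u: "u \<in> carrier_vec n" "u \<noteq> 0\<^sub>v n" "(transpose_mat M * M) *\<^sub>v u = x \<cdot>\<^sub>v u"
    using M unfolding eigenvalue_def eigenvector_def by auto
  have Mu: "M *\<^sub>v u \<in> carrier_vec n" using M u by simp
  have "x * (u \<bullet> u) = (x \<cdot>\<^sub>v u) \<bullet> u" using u by simp
  also have "\<dots> = (transpose_mat M *\<^sub>v (M *\<^sub>v u)) \<bullet> u"
    using u(3) M u(1) by (simp add: assoc_mult_mat_vec[of _ n n _ n])
  also have "\<dots> = (M *\<^sub>v u) \<bullet> (M *\<^sub>v u)"
    by (rule transpose_vec_mult_scalar[OF M u(1) Mu])
  finally have eq: "x * (u \<bullet> u) = (M *\<^sub>v u) \<bullet> (M *\<^sub>v u)" .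
  have nn: "0 \<le> w \<bullet> w" for w :: "real vec" by (simp add: scalar_prod_def sum_nonneg)
  have "u \<bullet> u \<noteq> 0"
  proof
    assume "u \<bullet> u = 0"
    hence "(\<Sum>i = 0..<n. u $ i * u $ i) = 0" using u by (simp add: scalar_prod_def)
    hence "\<forall>i\<in>{0..<n}. u $ i * u $ i = 0" by (subst (asm) sum_nonneg_eq_0_iff) auto
    hence "u = 0\<^sub>v n" using u(1) by (intro eq_vecI) auto
    thus False using u by simp
  qed
  hence "0 < u \<bullet> u" using nn[of u] by linarith
  thus ?thesis using nn[of "M *\<^sub>v u"] unfolding eq[symmetric] by (simp add: zero_le_mult_iff)
qed

lemma sigma_min_nonneg:
  fixes M :: "real mat"
  assumes M: "M \<in> carrier_mat n n" and n: "n > 0"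
  shows "0 \<le> sigma_min M"
  unfolding sigma_min_def using singular_values_finite_nonempty[OF M n] eigenvalue_gram_nonneg[OF M]
  by (auto simp: singular_values_def spectrum_def)

lemma sigma_min_le_max:
  fixes M :: "real mat"
  assumes M: "M \<in> carrier_mat n n" and n: "n > 0"
  shows "sigma_min M \<le> sigma_max M"
  unfolding sigma_min_def sigma_max_def using singular_values_finite_nonempty[OF M n]
  by (meson Max_ge Min_in)

lemma eigenvalue_gram_bounds:
  fixes M :: "real mat"
  assumes M: "M \<in> carrier_mat n n" and n: "n > 0"
    and lo: "0 < lo" "lo \<le> sigma_min M" and hi: "sigma_max M \<le> hi"
    and ev: "eigenvalue (transpose_mat M * M) x"
  shows "lo\<^sup>2 \<le> x" "x \<le> hi\<^sup>2"
proof -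
  have x: "sqrt x \<in> singular_values M" using ev by (auto simp: singular_values_def spectrum_def)
  note fin = singular_values_finite_nonempty[OF M n]
  have x0: "0 \<le> x" by (rule eigenvalue_gram_nonneg[OF M ev])
  have "lo \<le> sqrt x" using lo(2) Min_le[OF fin(1) x] by (simp add: sigma_min_def)
  hence "lo\<^sup>2 \<le> (sqrt x)\<^sup>2" using lo(1) by (intro power_mono) auto
  thus "lo\<^sup>2 \<le> x" using x0 by simp
  have "sqrt x \<le> hi" using hi Max_ge[OF fin(1) x] by (simp add: sigma_max_def)
  hence "(sqrt x)\<^sup>2 \<le> hi\<^sup>2" using x0 by (intro power_mono) auto
  thus "x \<le> hi\<^sup>2" using x0 by simp
qed

text \<open>By symmetry the square of an eigenvalue of \<open>M\<close> is an eigenvalue of the Gram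
  matrix, which bounds its modulus by \<open>hi\<close>.\<close>

lemma symmetric_norm_bound_sigma_max:
  fixes M :: "real mat"
  assumes M: "M \<in> carrier_mat n n" and n: "n > 0" and sym: "transpose_mat M = M"
    and lo: "0 < lo" "lo \<le> sigma_min M" and hi: "sigma_max M \<le> hi"
    and v: "v \<in> carrier_vec n"
  shows "vnorm (M *\<^sub>v v) \<le> hi * vnorm v"
proof (rule symmetric_norm_bound[OF M sym _ v _ n])
  show hi0: "0 \<le> hi" using sigma_min_le_max[OF M n] lo hi by linarith
  fix x assume "eigenvalue M x"
  then obtain u where u: "u \<in> carrier_vec n" "u \<noteq> 0\<^sub>v n" "M *\<^sub>v u = x \<cdot>\<^sub>v u"
    using M unfolding eigenvalue_def eigenvector_def by auto
  have "(transpose_mat M * M) *\<^sub>v u = M *\<^sub>v (M *\<^sub>v u)" using M u by (simp add: sym)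
  also have "\<dots> = x\<^sup>2 \<cdot>\<^sub>v u" using u M by (simp add: mult_mat_vec power2_eq_square smult_smult_assoc)
  finally have "eigenvalue (transpose_mat M * M) (x\<^sup>2)"
    using u M unfolding eigenvalue_def eigenvector_def by auto
  from eigenvalue_gram_bounds(2)[OF M n lo hi this] show "\<bar>x\<bar> \<le> hi"
    using hi0 by (metis abs_le_square_iff abs_of_nonneg)
qed

text \<open>For \<open>p = hi\<^sup>2\<close> and \<open>q = lo\<^sup>2\<close> the factor
  \<open>2 / (p + q)\<close> sends the two ends of the spectrum to points at the same distance from
  1, and that distance is \<rho>.\<close>

lemma relaxation_constants:
  fixes p q :: real
  assumes "p + q > 0"
  shows "2 / (p + q) * q = 1 - (p - q) / (p + q)" "2 / (p + q) * p = 1 + (p - q) / (p + q)"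
  using assms by (simp_all add: field_simps)

text \<open>
  For a spectrum of \<open>M\<^sup>2\<close> in \<open>[lo\<^sup>2, hi\<^sup>2]\<close>, the step size \<open>c = 2 / (hi\<^sup>2 + lo\<^sup>2)\<close> centres
  the spectrum of \<open>I - c M\<^sup>2\<close> at 0.
\<close>

lemma symmetric_relaxation_bound:
  fixes M :: "real mat"
  assumes M: "M \<in> carrier_mat n n" and n: "n > 0" and sym: "transpose_mat M = M"
    and lo: "0 < lo" "lo \<le> sigma_min M" and hi: "sigma_max M \<le> hi"
    and v: "v \<in> carrier_vec n"
  shows "vnorm (v - (2 / (hi\<^sup>2 + lo\<^sup>2)) \<cdot>\<^sub>v (M *\<^sub>v (M *\<^sub>v v)))
    \<le> (hi\<^sup>2 - lo\<^sup>2) / (hi\<^sup>2 + lo\<^sup>2) * vnorm v"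
proof -
  define c where "c = 2 / (hi\<^sup>2 + lo\<^sup>2)"
  have lohi: "lo \<le> hi" using sigma_min_le_max[OF M n] lo hi by linarith
  hence lohi2: "lo\<^sup>2 \<le> hi\<^sup>2" using lo by (intro power_mono) auto
  have s: "hi\<^sup>2 + lo\<^sup>2 > 0" using lo by (simp add: add_nonneg_pos)
  hence c: "c > 0" by (simp add: c_def)
  let ?T = "1\<^sub>m n - c \<cdot>\<^sub>m (M * M)"
  have T: "?T \<in> carrier_mat n n" using M by (intro minus_carrier_mat smult_carrier_mat mult_carrier_mat)
  have app: "?T *\<^sub>v u = u - c \<cdot>\<^sub>v (M *\<^sub>v (M *\<^sub>v u))" if "u \<in> carrier_vec n" for u
  proof -
    have "?T *\<^sub>v u = 1\<^sub>m n *\<^sub>v u - (c \<cdot>\<^sub>m (M * M)) *\<^sub>v u"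
      by (rule minus_mult_distrib_mat_vec) (use M that in auto)
    also have "(c \<cdot>\<^sub>m (M * M)) *\<^sub>v u = c \<cdot>\<^sub>v ((M * M) *\<^sub>v u)"
      by (rule smult_mat_mult_vec) (use M that in auto)
    finally show ?thesis using M that by simp
  qed
  have "vnorm (?T *\<^sub>v v) \<le> (hi\<^sup>2 - lo\<^sup>2) / (hi\<^sup>2 + lo\<^sup>2) * vnorm v"
  proof (rule symmetric_norm_bound[OF T _ _ v _ n])
    have "transpose_mat (M * M) = M * M" using transpose_mult[OF M M] sym by simp
    hence MM: "(M * M) $$ (i,j) = (M * M) $$ (j,i)" if "i < n" "j < n" for i j
      using M that by (metis carrier_matD index_mult_mat(2,3) index_transpose_mat(1))
    show "transpose_mat ?T = ?T"
    proof (rule eq_matI)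
      fix i j assume "i < dim_row ?T" "j < dim_col ?T"
      hence ij: "i < n" "j < n" using M by auto
      show "transpose_mat ?T $$ (i,j) = ?T $$ (i,j)"
        using ij M MM[OF ij] by (simp del: index_mult_mat(1))
    qed (use M in auto)
    show "0 \<le> (hi\<^sup>2 - lo\<^sup>2) / (hi\<^sup>2 + lo\<^sup>2)" using lohi2 s by simp
    fix x assume "eigenvalue ?T x"
    then obtain u where u: "u \<in> carrier_vec n" "u \<noteq> 0\<^sub>v n" "?T *\<^sub>v u = x \<cdot>\<^sub>v u"
      using T unfolding eigenvalue_def eigenvector_def by auto
    define w where "w = M *\<^sub>v (M *\<^sub>v u)"
    have w: "w \<in> carrier_vec n" using M u by (simp add: w_def)
    have uw: "u $ i - c * w $ i = x * u $ i" if "i < n" for i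
      using arg_cong[OF u(3), of "\<lambda>y. y $ i"] that u(1) w unfolding app[OF u(1)] w_def[symmetric] by simp
    \<comment> \<open>The eigenvalue equation of \<open>I - c M\<^sup>2\<close> is solved for
      \<open>M\<^sup>2 u\<close>; the interval for Gram eigenvalues then confines
      \<open>1 - x\<close> to \<open>[1 - \<rho>, 1 + \<rho>]\<close>.\<close>
    have "(transpose_mat M * M) *\<^sub>v u = ((1 - x) / c) \<cdot>\<^sub>v u"
    proof -
      have "(transpose_mat M * M) *\<^sub>v u = w" using M u by (simp add: sym w_def)
      also have "w = ((1 - x) / c) \<cdot>\<^sub>v u"
        using uw c w u(1) by (intro eq_vecI) (auto simp: field_simps)
      finally show ?thesis .
    qed
    hence ev: "eigenvalue (transpose_mat M * M) ((1 - x) / c)"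
      using u M unfolding eigenvalue_def eigenvector_def by auto
    have b: "c * lo\<^sup>2 \<le> 1 - x" "1 - x \<le> c * hi\<^sup>2"
      using eigenvalue_gram_bounds[OF M n lo hi ev] c by (simp_all add: field_simps)
    have "c * lo\<^sup>2 = 1 - (hi\<^sup>2 - lo\<^sup>2) / (hi\<^sup>2 + lo\<^sup>2)" "c * hi\<^sup>2 = 1 + (hi\<^sup>2 - lo\<^sup>2) / (hi\<^sup>2 + lo\<^sup>2)"
      using relaxation_constants[OF s] by (simp_all only: c_def)
    with b show "\<bar>x\<bar> \<le> (hi\<^sup>2 - lo\<^sup>2) / (hi\<^sup>2 + lo\<^sup>2)" by linarith
  qed
  thus ?thesis using app[OF v] by (simp only: c_def)
qed

section \<open>Kernels on finite index sets\<close>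

definition kernel_app :: "('i \<Rightarrow> 'i \<Rightarrow> real) \<Rightarrow> 'i set \<Rightarrow> ('i \<Rightarrow> real) \<Rightarrow> 'i \<Rightarrow> real" where
  "kernel_app h S v a = (\<Sum>b\<in>S. h a b * v b)"

lemma kernel_app_cong:
  "(\<And>b. b \<in> S \<Longrightarrow> u b = v b) \<Longrightarrow> kernel_app h S u a = kernel_app h S v a"
  by (simp add: kernel_app_def)

lemma kernel_app_diff:
  "kernel_app h S (\<lambda>b. u b - v b) a = kernel_app h S u a - kernel_app h S v a"
  by (simp add: kernel_app_def right_diff_distrib sum_subtractf)

lemma kernel_app_cmult:
  "kernel_app h S (\<lambda>b. c * v b) a = c * kernel_app h S v a"
  by (simp add: kernel_app_def sum_distrib_left mult_ac)

lemma kernel_app_add: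
  "kernel_app h S (\<lambda>b. u b + v b) a = kernel_app h S u a + kernel_app h S v a"
  by (simp add: kernel_app_def distrib_left sum.distrib)

lemma kernel_app_support:
  assumes "finite S" "B \<subseteq> S" "\<And>b. b \<in> S - B \<Longrightarrow> v b = 0"
  shows "kernel_app h S v a = kernel_app h B v a"
  unfolding kernel_app_def using assms by (intro sum.mono_neutral_right) auto

text \<open>Supports and graph reach are stated for index sets, singular values for matrices. The
  enumeration \<open>e\<close> of an index set carries spectral bounds from the one to the
  other.\<close>

definition kernel_mat :: "nat \<Rightarrow> (nat \<Rightarrow> 'i) \<Rightarrow> ('i \<Rightarrow> 'i \<Rightarrow> real) \<Rightarrow> real mat" where
  "kernel_mat n e h = mat n n (\<lambda>(i, j). h (e i) (e j))"

lemma kernel_mat_mult_vec: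
  assumes e: "bij_betw e {..<n} S"
  shows "kernel_mat n e h *\<^sub>v vec n (\<lambda>k. v (e k)) = vec n (\<lambda>k. kernel_app h S v (e k))"
proof (rule eq_vecI)
  fix i assume "i < dim_vec (vec n (\<lambda>k. kernel_app h S v (e k)))"
  hence i: "i < n" by simp
  have "(kernel_mat n e h *\<^sub>v vec n (\<lambda>k. v (e k))) $ i = (\<Sum>j<n. h (e i) (e j) * v (e j))"
    using i by (simp add: kernel_mat_def scalar_prod_def lessThan_atLeast0)
  also have "\<dots> = kernel_app h S v (e i)"
    unfolding kernel_app_def by (rule sum.reindex_bij_betw[OF e])
  finally show "(kernel_mat n e h *\<^sub>v vec n (\<lambda>k. v (e k))) $ i = vec n (\<lambda>k. kernel_app h S v (e k)) $ i"
    using i by simp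
qed (simp add: kernel_mat_def)

lemma vnorm_reindex:
  assumes e: "bij_betw e {..<n} S"
  shows "vnorm (vec n (\<lambda>k. v (e k))) = L2_set v S"
proof -
  have "(\<Sum>i<n. (v (e i))\<^sup>2) = (\<Sum>a\<in>S. (v a)\<^sup>2)" by (rule sum.reindex_bij_betw[OF e])
  thus ?thesis by (simp add: vnorm_eq_L2_set L2_set_def)
qed

lemma kernel_spectral_bounds:
  assumes e: "bij_betw e {..<n} S" and n: "n > 0"
    and sym: "\<And>a b. a \<in> S \<Longrightarrow> b \<in> S \<Longrightarrow> h a b = h b a"
    and lo: "0 < lo" "lo \<le> sigma_min (kernel_mat n e h)" and hi: "sigma_max (kernel_mat n e h) \<le> hi"
  shows "L2_set (kernel_app h S v) S \<le> hi * L2_set v S"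
    and "L2_set (\<lambda>a. v a - 2 / (hi\<^sup>2 + lo\<^sup>2) * kernel_app h S (kernel_app h S v) a) S
      \<le> (hi\<^sup>2 - lo\<^sup>2) / (hi\<^sup>2 + lo\<^sup>2) * L2_set v S"
    and "lo \<le> hi"
proof -
  let ?M = "kernel_mat n e h" and ?v = "vec n (\<lambda>k. v (e k))"
  have M: "?M \<in> carrier_mat n n" by (simp add: kernel_mat_def)
  have "e i \<in> S" if "i < n" for i using e that by (auto simp: bij_betw_def)
  hence s: "transpose_mat ?M = ?M" by (intro eq_matI) (auto simp: kernel_mat_def intro: sym)
  have v: "?v \<in> carrier_vec n" by simp
  show "L2_set (kernel_app h S v) S \<le> hi * L2_set v S"
    using symmetric_norm_bound_sigma_max[OF M n s lo hi v]
    unfolding kernel_mat_mult_vec[OF e] vnorm_reindex[OF e] .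
  have "?v - c \<cdot>\<^sub>v (?M *\<^sub>v (?M *\<^sub>v ?v)) = vec n (\<lambda>k. v (e k) - c * kernel_app h S (kernel_app h S v) (e k))" for c
    unfolding kernel_mat_mult_vec[OF e] by (intro eq_vecI) auto
  hence eq: "vnorm (?v - c \<cdot>\<^sub>v (?M *\<^sub>v (?M *\<^sub>v ?v))) = L2_set (\<lambda>a. v a - c * kernel_app h S (kernel_app h S v) a) S" for c
    using vnorm_reindex[OF e, of "\<lambda>a. v a - c * kernel_app h S (kernel_app h S v) a"] by simp
  show "L2_set (\<lambda>a. v a - 2 / (hi\<^sup>2 + lo\<^sup>2) * kernel_app h S (kernel_app h S v) a) S
      \<le> (hi\<^sup>2 - lo\<^sup>2) / (hi\<^sup>2 + lo\<^sup>2) * L2_set v S"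
    using symmetric_relaxation_bound[OF M n s lo hi v] unfolding eq vnorm_reindex[OF e] .
  show "lo \<le> hi" using sigma_min_le_max[OF M n] lo hi by linarith
qed

text \<open>
  With \<open>T = I - c H\<^sup>2\<close>, a solution of \<open>H z = e\<close> satisfies \<open>z = c H e + T z\<close>, so that \<open>z\<close> and
  \<open>T\<^sup>k z\<close> agree outside the reach \<open>L (2 k - 1)\<close> of the support \<open>L 0\<close> of \<open>e\<close>.
\<close>

lemma kernel_solution_decay:
  fixes h :: "'i \<Rightarrow> 'i \<Rightarrow> real" and L :: "nat \<Rightarrow> 'i set"
  assumes fin: "finite B" and lo: "0 < lo" "lo \<le> hi"
    and op: "\<And>v. L2_set (kernel_app h B v) B \<le> hi * L2_set v B"
    and op2: "\<And>v. L2_set (\<lambda>a. v a - 2 / (hi\<^sup>2 + lo\<^sup>2) * kernel_app h B (kernel_app h B v) a) B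
      \<le> (hi\<^sup>2 - lo\<^sup>2) / (hi\<^sup>2 + lo\<^sup>2) * L2_set v B"
    and sol: "\<And>a. a \<in> B \<Longrightarrow> kernel_app h B z a = e a"
    and supp: "\<And>a. a \<in> B \<Longrightarrow> a \<notin> L 0 \<Longrightarrow> e a = 0"
    and mono: "\<And>m. L m \<subseteq> L (Suc m)"
    and reach: "\<And>m a b. a \<in> B \<Longrightarrow> b \<in> B \<Longrightarrow> b \<in> L m \<Longrightarrow> h a b \<noteq> 0 \<Longrightarrow> a \<in> L (Suc m)"
    and I: "I \<subseteq> B" "\<And>k a. k < K \<Longrightarrow> a \<in> I \<Longrightarrow> a \<notin> L (2 * k + 1)"
  shows "L2_set z I \<le> hi / lo\<^sup>2 * ((hi\<^sup>2 - lo\<^sup>2) / (hi\<^sup>2 + lo\<^sup>2)) ^ K * L2_set e B"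
proof -
  define c where "c = 2 / (hi\<^sup>2 + lo\<^sup>2)"
  define \<rho> where "\<rho> = (hi\<^sup>2 - lo\<^sup>2) / (hi\<^sup>2 + lo\<^sup>2)"
  define T where "T = (\<lambda>v a. v a - c * kernel_app h B (kernel_app h B v) a)"
  define r where "r = (\<lambda>a. c * kernel_app h B e a)"
  have s: "hi\<^sup>2 + lo\<^sup>2 > 0" using lo by (simp add: add_nonneg_pos)
  have c: "c > 0" using s by (simp add: c_def)
  have "lo\<^sup>2 \<le> hi\<^sup>2" using lo by (intro power_mono) auto
  hence \<rho>: "0 \<le> \<rho>" using s by (simp add: \<rho>_def)
  have \<rho>1: "1 - \<rho> = c * lo\<^sup>2" using relaxation_constants(1)[OF s] by (simp add: \<rho>_def c_def)
  have Tnorm: "L2_set (T v) B \<le> \<rho> * L2_set v B" for v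
    using op2[of v] by (simp add: T_def c_def \<rho>_def)
  have Tcong: "T u a = T v a" if "\<And>b. b \<in> B \<Longrightarrow> u b = v b" "a \<in> B" for u v a
  proof -
    have "kernel_app h B u = kernel_app h B v" by (intro ext kernel_app_cong that(1))
    thus ?thesis using that by (simp add: T_def)
  qed
  \<comment> \<open>The equation \<open>H z = e\<close> is known on \<open>B\<close> only; as values
    of \<open>T\<close> on \<open>B\<close> depend only on the argument there, identities on
    \<open>B\<close> may be substituted inside its powers.\<close>
  have Tpcong: "(T ^^ m) u a = (T ^^ m) v a" if "\<And>b. b \<in> B \<Longrightarrow> u b = v b" "a \<in> B" for m u v a
    using that(2)
  proof (induction m arbitrary: a)
    case (Suc m) thus ?case by (auto intro: Tcong)
  qed (use that in auto)
  have Tdiff: "T (\<lambda>a. u a - v a) = (\<lambda>a. T u a - T v a)" for u v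
    unfolding T_def by (rule ext) (simp add: kernel_app_diff[abs_def] algebra_simps)
  have Tpdiff: "(T ^^ m) (\<lambda>a. u a - v a) = (\<lambda>a. (T ^^ m) u a - (T ^^ m) v a)" for m u v
    by (induction m) (simp_all add: Tdiff)
  have Tz: "T z a = z a - r a" if "a \<in> B" for a
    unfolding T_def r_def using kernel_app_cong[of B "kernel_app h B z" e h a] sol by simp
  have app_supp: "kernel_app h B v a = 0"
    if "\<And>b. b \<in> B \<Longrightarrow> b \<notin> L m \<Longrightarrow> v b = 0" "a \<in> B" "a \<notin> L (Suc m)" for v a m
    unfolding kernel_app_def using that reach by (intro sum.neutral) force
  \<comment> \<open>Each factor \<open>T\<close> contains \<open>h\<close> twice and moves the
    support two levels outward; the initial \<open>+ 1\<close> comes from the factor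
    \<open>H\<close> in \<open>r = c H e\<close>.\<close>
  have Tr: "(T ^^ m) r a = 0" if "a \<in> B" "a \<notin> L (2 * m + 1)" for m a
    using that
  proof (induction m arbitrary: a)
    case 0
    thus ?case using app_supp[of 0 e a] supp by (simp add: r_def)
  next
    case (Suc m)
    let ?w = "(T ^^ m) r"
    have n: "a \<notin> L (Suc (Suc (2 * m + 1)))" using Suc.prems by simp
    hence "?w a = 0" using Suc mono by blast
    moreover have "kernel_app h B ?w b = 0" if "b \<in> B" "b \<notin> L (Suc (2 * m + 1))" for b
      using that Suc.IH by (intro app_supp[of "2 * m + 1" ?w b]) auto
    hence "kernel_app h B (kernel_app h B ?w) a = 0"
      by (rule app_supp[OF _ Suc.prems(1) n])
    ultimately show ?case by (simp add: T_def)
  qed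
  \<comment> \<open>Since \<open>T z = z - r\<close> on \<open>B\<close>, one more power changes the
    value by \<open>T\<^sup>m r\<close> only, and this has not reached \<open>I\<close> as long as
    \<open>m < K\<close>.\<close>
  have agree: "(T ^^ m) z a = z a" if "a \<in> I" "m \<le> K" for a m
    using that
  proof (induction m)
    case (Suc m)
    have aB: "a \<in> B" using Suc.prems I by auto
    have "(T ^^ Suc m) z a = (T ^^ m) (T z) a" by (simp only: funpow_Suc_right o_apply)
    also have "\<dots> = (T ^^ m) (\<lambda>b. z b - r b) a" using Tz aB by (intro Tpcong) auto
    also have "\<dots> = (T ^^ m) z a - (T ^^ m) r a" by (simp add: Tpdiff)
    also have "(T ^^ m) r a = 0" using Suc.prems I(2)[of m a] aB by (intro Tr) auto
    finally show ?case using Suc by simp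
  qed simp
  have pw: "L2_set ((T ^^ m) z) B \<le> \<rho> ^ m * L2_set z B" for m
  proof (induction m)
    case (Suc m)
    have "L2_set ((T ^^ Suc m) z) B \<le> \<rho> * L2_set ((T ^^ m) z) B" using Tnorm by simp
    also have "\<dots> \<le> \<rho> * (\<rho> ^ m * L2_set z B)" using Suc \<rho> by (intro mult_left_mono)
    finally show ?case by simp
  qed simp
  \<comment> \<open>Norms in \<open>z = r + T z\<close> give \<open>(1 - \<rho>)
    \<parallel>z\<parallel> \<le> c hi \<parallel>e\<parallel>\<close>; with
    \<open>1 - \<rho> = c lo\<^sup>2\<close> the step size cancels and
    \<open>hi / lo\<^sup>2\<close> remains, the source of \<Gamma>.\<close>
  have zB: "L2_set z B \<le> hi / lo\<^sup>2 * L2_set e B"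
  proof -
    have "L2_set z B = L2_set (\<lambda>a. r a + T z a) B" using Tz by (intro L2_set_cong) auto
    also have "\<dots> \<le> L2_set r B + L2_set (T z) B" by (rule L2_set_triangle_ineq)
    also have "L2_set r B = c * L2_set (kernel_app h B e) B"
      unfolding r_def using c by (simp add: L2_set_right_distrib)
    also have "\<dots> \<le> c * (hi * L2_set e B)" using c op by (intro mult_left_mono) auto
    finally have "(1 - \<rho>) * L2_set z B \<le> c * (hi * L2_set e B)" using Tnorm[of z] by (simp add: algebra_simps)
    hence "c * (lo\<^sup>2 * L2_set z B) \<le> c * (hi * L2_set e B)" unfolding \<rho>1 by (simp add: mult.assoc)
    hence "lo\<^sup>2 * L2_set z B \<le> hi * L2_set e B" using c by (simp add: mult_le_cancel_left)
    thus ?thesis using lo by (simp add: pos_le_divide_eq mult.commute)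
  qed
  have "L2_set z I = L2_set ((T ^^ K) z) I" using agree by (intro L2_set_cong) auto
  also have "\<dots> \<le> L2_set ((T ^^ K) z) B"
    unfolding L2_set_def using I fin by (intro real_sqrt_le_mono sum_mono2) auto
  also have "\<dots> \<le> \<rho> ^ K * L2_set z B" by (rule pw)
  also have "\<dots> \<le> \<rho> ^ K * (hi / lo\<^sup>2 * L2_set e B)" using zB \<rho> by (intro mult_left_mono) auto
  finally show ?thesis by (simp add: \<rho>_def mult_ac)
qed


section \<open>Piecewise affine paths\<close>

text \<open>Induction on the number of sets. From \<open>a\<close> one jumps inside a set
  \<open>T\<close> containing it to its last point \<open>t\<close>, possibly across gaps of
  \<open>T\<close>; past \<open>t\<close> the set never recurs, so the others cover the remaining
  interval. Closedness makes the last point exist and puts \<open>t\<close> itself into one of the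
  others.\<close>

lemma finite_closed_cover_lipschitz:
  fixes \<delta> :: "real \<Rightarrow> real \<Rightarrow> real"
  assumes "finite F" "\<And>T. T \<in> F \<Longrightarrow> closed T" "{a..b} \<subseteq> \<Union>F" "a \<le> b"
    and "\<And>T s t. T \<in> F \<Longrightarrow> s \<in> T \<Longrightarrow> t \<in> T \<Longrightarrow> s \<le> t \<Longrightarrow> \<delta> s t \<le> C * (t - s)"
    and tri: "\<And>s t u. \<delta> s u \<le> \<delta> s t + \<delta> t u"
  shows "\<delta> a b \<le> C * (b - a)"
  using assms(1-5)
proof (induction "card F" arbitrary: F a)
  case 0
  thus ?case by auto
next
  case (Suc n)
  from Suc.prems have "a \<in> \<Union>F" by auto
  then obtain T where T: "T \<in> F" "a \<in> T" by auto
  have clT: "closed T" using Suc.prems T by auto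
  have "compact (T \<inter> {a..b})" using compact_Int_closed[OF compact_Icc clT] by (simp add: Int_commute)
  moreover have "T \<inter> {a..b} \<noteq> {}" using T Suc.prems by auto
  ultimately obtain t where tT: "t \<in> T \<inter> {a..b}" and tmax: "\<And>s. s \<in> T \<inter> {a..b} \<Longrightarrow> s \<le> t"
    using compact_attains_sup[of "T \<inter> {a..b}"] by blast
  have first: "\<delta> a t \<le> C * (t - a)" using Suc.prems(5)[OF T(1,2)] tT by auto
  show ?case
  proof (cases "t = b")
    case True
    thus ?thesis using first by simp
  next
    case False
    hence tb: "t < b" using tT by auto
    have cl: "closed (\<Union>(F - {T}))" using Suc.prems by (intro closed_Union) auto
    have right: "s \<in> \<Union>(F - {T})" if s: "t < s" "s \<le> b" for s
    proof -
      have "s \<notin> T" using tmax[of s] s tT by auto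
      moreover have "s \<in> \<Union>F" using s tT by (auto intro: subsetD[OF Suc.prems(3)] simp del: Union_iff)
      ultimately show ?thesis by auto
    qed
    \<comment> \<open>If \<open>t\<close> were missed, so would be a right neighbourhood of it,
      although the points just beyond \<open>t\<close> lie in the remaining sets.\<close>
    have "t \<in> \<Union>(F - {T})"
    proof (rule ccontr)
      assume "t \<notin> \<Union>(F - {T})"
      hence "t \<in> - \<Union>(F - {T})" by simp
      from open_right[OF open_Compl[OF cl] this tb]
      obtain u where u: "u > t" "{t..<u} \<subseteq> - \<Union>(F - {T})" by blast
      obtain s where "t < s" "s < min u b" using dense[of t "min u b"] u tb by auto
      moreover from this have "s \<in> - \<Union>(F - {T})" by (intro subsetD[OF u(2)]) simp
      ultimately show False using right[of s] by simp
    qed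
    moreover have "{t..b} = insert t {t<..b}" using tb by auto
    ultimately have sub: "{t..b} \<subseteq> \<Union>(F - {T})" using right by (metis greaterThanAtMost_iff insert_subset subsetI)
    have "n = card (F - {T})" using Suc.hyps(2) T(1) Suc.prems(1) by simp
    hence "\<delta> t b \<le> C * (b - t)"
    proof (rule Suc.hyps(1)[OF _ _ _ sub])
      show "finite (F - {T})" "t \<le> b" using Suc.prems(1) tb by auto
    next
      fix T' assume "T' \<in> F - {T}"
      hence T': "T' \<in> F" by simp
      show "closed T'" by (rule Suc.prems(2)[OF T'])
      fix s u assume "s \<in> T'" "u \<in> T'" "s \<le> u"
      thus "\<delta> s u \<le> C * (u - s)" by (rule Suc.prems(5)[OF T'])
    qed
    thus ?thesis using first tri[of a b t] by (simp add: algebra_simps)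
  qed
qed

section \<open>Mixed complementarity systems\<close>

text \<open>The KKT conditions on one index set. When the multiplier block of the kernel is zero,
  the row of a multiplier evaluates its constraint at the primal variables: on \<open>J\<close> the
  row minus \<open>d a\<close> is the slack and \<open>z a\<close> the multiplier.\<close>

definition mcp_solution ::
  "('i \<Rightarrow> 'i \<Rightarrow> real) \<Rightarrow> 'i set \<Rightarrow> 'i set \<Rightarrow> ('i \<Rightarrow> real) \<Rightarrow> ('i \<Rightarrow> real) \<Rightarrow> bool" where
  "mcp_solution h S J d z \<longleftrightarrow>
     (\<forall>a\<in>S - J. kernel_app h S z a = d a) \<and>
     (\<forall>a\<in>J. kernel_app h S z a \<ge> d a \<and> z a \<le> 0 \<and> z a * (kernel_app h S z a - d a) = 0)"

lemma mcp_solution_cong: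
  assumes "\<And>a. a \<in> S \<Longrightarrow> d a = d' a" "\<And>a. a \<in> S \<Longrightarrow> z a = z' a" "J \<subseteq> S"
  shows "mcp_solution h S J d z \<longleftrightarrow> mcp_solution h S J d' z'"
proof -
  have "kernel_app h S z = kernel_app h S z'" using assms by (intro ext kernel_app_cong) auto
  thus ?thesis unfolding mcp_solution_def using assms by (auto simp: subset_iff)
qed

text \<open>Along a line of data and candidates every condition is a weak inequality or an equation
  between polynomials in \<open>t\<close>. Such sets are the pieces of the cover of the unit
  interval.\<close>

lemma closed_mcp_segment:
  assumes "finite J" "finite S"
  shows "closed {t::real. mcp_solution h S J (\<lambda>a. d a + t * e a) (\<lambda>a. u a + t * v a)}"
proof -
  have lin: "kernel_app h S (\<lambda>a. u a + t * v a) a = kernel_app h S u a + t * kernel_app h S v a" for t a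
    by (simp add: kernel_app_add kernel_app_cmult)
  have "{t. mcp_solution h S J (\<lambda>a. d a + t * e a) (\<lambda>a. u a + t * v a)} =
    (\<Inter>a\<in>S - J. {t. kernel_app h S u a + t * kernel_app h S v a = d a + t * e a}) \<inter>
    (\<Inter>a\<in>J. {t. kernel_app h S u a + t * kernel_app h S v a \<ge> d a + t * e a} \<inter> {t. u a + t * v a \<le> 0} \<inter>
       {t. (u a + t * v a) * (kernel_app h S u a + t * kernel_app h S v a - (d a + t * e a)) = 0})"
    unfolding mcp_solution_def lin by auto
  thus ?thesis
    by (auto intro!: closed_Int closed_INT closed_Collect_disj closed_Collect_le closed_Collect_eq continuous_intros)
qed

text \<open>Each basis \<open>B\<close> contributes one affine branch \<open>y B\<close>. Where it
  solves the system, uniqueness identifies it with \<open>z\<close>; some branch is a solution at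
  every parameter, and slopes bounded by \<open>C\<close> on all pieces bound the change over the
  whole segment. Continuity of \<open>z\<close> comes out of the closed cover.\<close>

lemma mcp_path_lipschitz:
  fixes z :: "real \<Rightarrow> 'i \<Rightarrow> real"
  assumes fin: "finite S" "J \<subseteq> S" "finite \<B>" and I: "I \<subseteq> S"
    and unique: "\<And>t y. 0 \<le> t \<Longrightarrow> t \<le> 1 \<Longrightarrow> mcp_solution h S J (\<lambda>a. d a + t * e a) y \<Longrightarrow>
      \<forall>a\<in>S. y a = z t a"
    and basis: "\<And>t. 0 \<le> t \<Longrightarrow> t \<le> 1 \<Longrightarrow> \<exists>B\<in>\<B>. (\<forall>a\<in>S - B. z t a = 0) \<and>
      (\<forall>a\<in>B. kernel_app h B (z t) a = d a + t * e a) \<and> mcp_solution h S J (\<lambda>a. d a + t * e a) (z t)"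
    and sub: "\<And>B. B \<in> \<B> \<Longrightarrow> B \<subseteq> S"
    and inj: "\<And>B w. B \<in> \<B> \<Longrightarrow> (\<And>a. a \<in> B \<Longrightarrow> kernel_app h B w a = 0) \<Longrightarrow> \<forall>a\<in>B. w a = 0"
    and surj: "\<And>B g. B \<in> \<B> \<Longrightarrow> \<exists>w. \<forall>a\<in>B. kernel_app h B w a = g a"
    and bound: "\<And>B w. B \<in> \<B> \<Longrightarrow> (\<And>a. a \<in> B \<Longrightarrow> kernel_app h B w a = e a) \<Longrightarrow> L2_set w (I \<inter> B) \<le> C"
  shows "L2_set (\<lambda>a. z 1 a - z 0 a) I \<le> C"
proof -
  have finI: "finite I" using I fin finite_subset by auto
  \<comment> \<open>Solutions on \<open>B\<close> are extended by zero, so that a branch can be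
    tested against the complementarity system on all of \<open>S\<close>.\<close>
  have "\<exists>w. (\<forall>a. a \<notin> B \<longrightarrow> w a = 0) \<and> (\<forall>a\<in>B. kernel_app h B w a = g a)" if B: "B \<in> \<B>" for B g
  proof -
    obtain w where w: "\<forall>a\<in>B. kernel_app h B w a = g a" using surj[OF B] by auto
    have "kernel_app h B (\<lambda>a. if a \<in> B then w a else 0) a = kernel_app h B w a" for a
      by (rule kernel_app_cong) simp
    thus ?thesis using w by (intro exI[of _ "\<lambda>a. if a \<in> B then w a else 0"]) auto
  qed
  hence "\<exists>u. \<forall>B\<in>\<B>. \<forall>g. (\<forall>a. a \<notin> B \<longrightarrow> u B g a = 0) \<and> (\<forall>a\<in>B. kernel_app h B (u B g) a = g a)"
    by metis
  then obtain sol where sol: "\<And>B g a. B \<in> \<B> \<Longrightarrow> a \<notin> B \<Longrightarrow> sol B g a = 0"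
    "\<And>B g a. B \<in> \<B> \<Longrightarrow> a \<in> B \<Longrightarrow> kernel_app h B (sol B g) a = g a" by metis
  define y where "y B t a = sol B d a + t * sol B e a" for B t a
  define T where "T B = {t. mcp_solution h S J (\<lambda>a. d a + t * e a) (y B t)} \<inter> {0..1}" for B
  define \<delta> where "\<delta> s t = L2_set (\<lambda>a. z t a - z s a) I" for s t
  have eq: "z t a = y B t a" if "t \<in> T B" "a \<in> S" for B t a
    using unique[of t "y B t"] that by (auto simp: T_def)
  have "\<delta> 0 1 \<le> C * (1 - 0)"
  proof (rule finite_closed_cover_lipschitz[where F = "T ` \<B>"])
    show "finite (T ` \<B>)" using fin by simp
    fix T' assume "T' \<in> T ` \<B>"
    then obtain B where B: "B \<in> \<B>" "T' = T B" by auto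
    have "finite J" using fin finite_subset by auto
    thus "closed T'" unfolding B T_def y_def
      using closed_mcp_segment[of J S h d e "sol B d" "sol B e"] fin by (intro closed_Int) auto
    fix s t assume st: "s \<in> T'" "t \<in> T'" "s \<le> t"
    have "\<delta> s t = L2_set (\<lambda>a. (t - s) * sol B e a) I"
      unfolding \<delta>_def using st B I by (intro L2_set_cong) (auto simp: eq y_def algebra_simps)
    also have "\<dots> = (t - s) * L2_set (sol B e) I" using st by (simp add: L2_set_right_distrib)
    also have "L2_set (sol B e) I = L2_set (sol B e) (I \<inter> B)"
      unfolding L2_set_def using finI sol(1)[OF B(1)] by (intro arg_cong[of _ _ sqrt] sum.mono_neutral_right) auto
    also have "(t - s) * L2_set (sol B e) (I \<inter> B) \<le> (t - s) * C"
      using st bound[OF B(1), of "sol B e"] sol(2)[OF B(1)] by (intro mult_left_mono) auto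
    finally show "\<delta> s t \<le> C * (t - s)" by (simp add: mult.commute)
  next
    show "{0..1} \<subseteq> \<Union>(T ` \<B>)"
    proof
      fix t :: real assume t: "t \<in> {0..1}"
      from basis[of t] t obtain B where B: "B \<in> \<B>" "\<forall>a\<in>S - B. z t a = 0"
        "\<forall>a\<in>B. kernel_app h B (z t) a = d a + t * e a" "mcp_solution h S J (\<lambda>a. d a + t * e a) (z t)" by auto
      \<comment> \<open>Both sides solve the square system on \<open>B\<close> with the data at
        \<open>t\<close>, so injectivity makes them agree.\<close>
      have "\<forall>a\<in>B. z t a - y B t a = 0"
      proof (rule inj[OF B(1)])
        fix a assume a: "a \<in> B"
        show "kernel_app h B (\<lambda>a. z t a - y B t a) a = 0"
          using a B sol(2)[OF B(1) a] unfolding y_def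
          by (simp add: kernel_app_diff kernel_app_add kernel_app_cmult)
      qed
      hence "z t a = y B t a" if "a \<in> S" for a
        using that B sol(1)[OF B(1)] by (cases "a \<in> B") (auto simp: y_def)
      hence "t \<in> T B" using B t fin(2) mcp_solution_cong[of S _ _ "z t" "y B t" J h] by (auto simp: T_def)
      thus "t \<in> \<Union>(T ` \<B>)" using B by auto
    qed
  next
    fix s t u :: real
    have "\<delta> s u = L2_set (\<lambda>a. (z t a - z s a) + (z u a - z t a)) I" by (simp add: \<delta>_def)
    also have "\<dots> \<le> \<delta> s t + \<delta> t u" unfolding \<delta>_def by (rule L2_set_triangle_ineq)
    finally show "\<delta> s u \<le> \<delta> s t + \<delta> t u" .
  qed simp
  thus ?thesis by (simp add: \<delta>_def)
qed

section \<open>Regular solutions of quadratic programs\<close>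

text \<open>\<open>X\<close> indexes primal variables, \<open>M\<close> multipliers and
  \<open>J\<close> the multipliers of inequalities; \<open>h\<close> is the symmetric KKT matrix
  with blocks \<open>Q\<close>, \<open>A^T\<close>, \<open>A\<close> and zero. For a multiplier
  index \<open>a\<close>, \<open>kernel_app h X z a\<close> is the value of its constraint
  row.\<close>

locale saddle_kernel =
  fixes h :: "'i \<Rightarrow> 'i \<Rightarrow> real" and X M J :: "'i set"
  assumes finite_X: "finite X" and finite_M: "finite M" and disj: "X \<inter> M = {}" and J_sub: "J \<subseteq> M"
    and sym: "\<And>a b. a \<in> X \<union> M \<Longrightarrow> b \<in> X \<union> M \<Longrightarrow> h a b = h b a"
    and multipliers: "\<And>a b. a \<in> M \<Longrightarrow> b \<in> M \<Longrightarrow> h a b = 0"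
begin

abbreviation "S \<equiv> X \<union> M"

definition active :: "('i \<Rightarrow> real) \<Rightarrow> ('i \<Rightarrow> real) \<Rightarrow> 'i set" where
  "active d z = (M - J) \<union> {a \<in> J. kernel_app h X z a = d a}"

definition licq :: "('i \<Rightarrow> real) \<Rightarrow> ('i \<Rightarrow> real) \<Rightarrow> bool" where
  "licq d z \<longleftrightarrow> (\<forall>\<mu>. (\<forall>b\<in>X. (\<Sum>a\<in>active d z. \<mu> a * h a b) = 0) \<longrightarrow> (\<forall>a\<in>active d z. \<mu> a = 0))"

definition quad :: "('i \<Rightarrow> real) \<Rightarrow> real" where
  "quad w = (\<Sum>a\<in>X. w a * kernel_app h X w a)"

definition sosc :: "('i \<Rightarrow> real) \<Rightarrow> ('i \<Rightarrow> real) \<Rightarrow> bool" where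
  "sosc d z \<longleftrightarrow> (\<forall>w. (\<forall>a\<in>M - J. kernel_app h X w a = 0) \<longrightarrow>
     (\<forall>a\<in>J. kernel_app h X z a = d a \<longrightarrow>
        (if z a < 0 then kernel_app h X w a = 0 else kernel_app h X w a \<ge> 0)) \<longrightarrow>
     (\<exists>a\<in>X. w a \<noteq> 0) \<longrightarrow> quad w > 0)"

lemma active_sub: "active d z \<subseteq> M"
  using J_sub by (auto simp: active_def)

lemma kernel_app_M:
  assumes "a \<in> M" "B \<subseteq> M"
  shows "kernel_app h (X \<union> B) w a = kernel_app h X w a"
proof -
  have "finite B" using assms finite_M finite_subset by auto
  thus ?thesis unfolding kernel_app_def
    using assms disj multipliers finite_X by (subst sum.union_disjoint) (auto intro!: sum.neutral)
qed

text \<open>Pairing the stationarity rows with the primal part of \<open>w\<close> gives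
  \<open>x^T Q x + \<lambda>^T A x = 0\<close>; symmetry of \<open>h\<close> turns the coupling term
  into constraint rows.\<close>

lemma quad_identity:
  assumes B: "B \<subseteq> M" and w: "\<And>a. a \<in> X \<Longrightarrow> kernel_app h (X \<union> B) w a = 0"
  shows "quad w + (\<Sum>b\<in>B. w b * kernel_app h X w b) = 0"
proof -
  have finB: "finite B" using B finite_M finite_subset by auto
  have split: "kernel_app h (X \<union> B) w a = kernel_app h X w a + kernel_app h B w a" for a
    unfolding kernel_app_def using finB finite_X disj B by (intro sum.union_disjoint) auto
  have "0 = (\<Sum>a\<in>X. w a * kernel_app h (X \<union> B) w a)" using w by simp
  also have "\<dots> = quad w + (\<Sum>a\<in>X. w a * kernel_app h B w a)"
    unfolding split quad_def by (simp add: distrib_left sum.distrib)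
  also have "(\<Sum>a\<in>X. w a * kernel_app h B w a) = (\<Sum>a\<in>X. \<Sum>b\<in>B. w b * (h b a * w a))"
    unfolding kernel_app_def sum_distrib_left
    using B by (intro sum.cong refl) (auto simp: sym[of _ "_::'i"] mult_ac)
  also have "\<dots> = (\<Sum>b\<in>B. w b * kernel_app h X w b)"
    unfolding kernel_app_def sum_distrib_left by (rule sum.swap)
  finally show ?thesis by simp
qed

lemma kernel_app_X_multipliers:
  assumes "B \<subseteq> M" "a \<in> X" "\<And>b. b \<in> X \<Longrightarrow> w b = 0"
  shows "kernel_app h (X \<union> B) w a = (\<Sum>b\<in>B. w b * h b a)"
proof -
  have "finite B" using assms finite_M finite_subset by auto
  hence "kernel_app h (X \<union> B) w a = (\<Sum>b\<in>B. h a b * w b)"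
    unfolding kernel_app_def using finite_X disj assms by (subst sum.union_disjoint) auto
  also have "\<dots> = (\<Sum>b\<in>B. w b * h b a)" using assms sym by (intro sum.cong) auto
  finally show ?thesis .
qed

text \<open>A null vector has vanishing active rows, so the identity gives
  \<open>quad w = 0\<close>. Its primal part lies in the critical cone and vanishes by the
  second-order condition; what is left is a vanishing combination of active rows.\<close>

lemma active_basis_injective:
  assumes sosc: "sosc d z" and licq: "licq d z"
    and w: "\<And>a. a \<in> X \<union> active d z \<Longrightarrow> kernel_app h (X \<union> active d z) w a = 0"
    and a: "a \<in> X \<union> active d z"
  shows "w a = 0"
proof -
  let ?A = "active d z"
  have A: "?A \<subseteq> M" by (rule active_sub)
  have wA: "kernel_app h X w b = 0" if "b \<in> ?A" for b
    using w[of b] kernel_app_M[of b ?A w] that A by auto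
  have "quad w = 0" using quad_identity[OF A, of w] w wA by simp
  have X0: "w b = 0" if "b \<in> X" for b
  proof (rule ccontr)
    assume "w b \<noteq> 0"
    hence "quad w > 0" using sosc that wA unfolding sosc_def active_def by force
    thus False using \<open>quad w = 0\<close> by simp
  qed
  hence "(\<Sum>b\<in>?A. w b * h b c) = 0" if "c \<in> X" for c
    using kernel_app_X_multipliers[OF A that, of w] w[of c] that by simp
  hence "\<forall>b\<in>?A. w b = 0" using licq unfolding licq_def by blast
  thus ?thesis using a X0 by auto
qed

text \<open>For the difference of two solutions, complementarity makes the multiplier term of
  \<open>quad_identity\<close> nonnegative. As \<open>quad\<close> is nonnegative too, both vanish;
  this puts the difference into the critical cone at \<open>z\<close> and kills its primal part.
  Then the slacks coincide, inactive multipliers vanish on both sides, and independence of the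
  active rows settles the rest.\<close>

lemma mcp_solution_unique:
  assumes psd: "\<And>w. quad w \<ge> 0"
    and sol: "mcp_solution h S J d z" and sosc: "sosc d z" and licq: "licq d z"
    and sol': "mcp_solution h S J d z'" and a: "a \<in> S"
  shows "z' a = z a"
proof -
  define w where "w = (\<lambda>a. z' a - z a)"
  have diff: "kernel_app h B w a = kernel_app h B z' a - kernel_app h B z a" for B a
    unfolding w_def by (rule kernel_app_diff)
  have kM: "kernel_app h S y b = kernel_app h X y b" if "b \<in> M" for b y
    using kernel_app_M[OF that order_refl] .
  define s where "s b = kernel_app h X z b - d b" for b
  define s' where "s' b = kernel_app h X z' b - d b" for b
  have eqX: "kernel_app h S w b = 0" if "b \<in> X" for b
  proof -
    have "b \<in> S - J" using that disj J_sub by auto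
    thus ?thesis using sol sol' unfolding diff mcp_solution_def by simp
  qed
  have eqE: "kernel_app h X w b = 0" if "b \<in> M - J" for b
  proof -
    have "b \<in> S - J" "b \<in> M" using that by auto
    thus ?thesis using sol sol' kM[of b z] kM[of b z'] unfolding diff mcp_solution_def by simp
  qed
  have J: "s b \<ge> 0" "s' b \<ge> 0" "z b \<le> 0" "z' b \<le> 0" "z b * s b = 0" "z' b * s' b = 0"
    "kernel_app h X w b = s' b - s b" if "b \<in> J" for b
    using sol sol' that kM[of b z] kM[of b z'] subsetD[OF J_sub that] unfolding diff mcp_solution_def s_def s'_def by auto
  have compl: "w b * kernel_app h X w b = (- z' b) * s b + (- z b) * s' b" if "b \<in> J" for b
  proof -
    have wb: "w b = z' b - z b" by (simp add: w_def)
    have exp: "(z' b - z b) * (s' b - s b) = z' b * s' b + (- z' b) * s b + (- z b) * s' b + z b * s b"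
      by (simp add: algebra_simps)
    show ?thesis unfolding J(7)[OF that] wb exp J(5,6)[OF that] by simp
  qed
  have nn: "(- z' b) * s b \<ge> 0" "(- z b) * s' b \<ge> 0" if "b \<in> J" for b
    using J[OF that] by (auto intro!: mult_nonneg_nonneg simp del: mult_minus_left)
  have finJ: "finite J" using J_sub finite_M finite_subset by auto
  have sumJ: "(\<Sum>b\<in>M. w b * kernel_app h X w b) = (\<Sum>b\<in>J. w b * kernel_app h X w b)"
    using finite_M J_sub eqE by (intro sum.mono_neutral_right) auto
  have id: "quad w + (\<Sum>b\<in>J. w b * kernel_app h X w b) = 0"
    using quad_identity[of M w] eqX sumJ by simp
  have nnJ: "w b * kernel_app h X w b \<ge> 0" if "b \<in> J" for b
    using compl[OF that] nn[OF that] by linarith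
  have "(\<Sum>b\<in>J. w b * kernel_app h X w b) \<ge> 0" using nnJ by (rule sum_nonneg)
  hence q0: "quad w = 0" and sum0: "(\<Sum>b\<in>J. w b * kernel_app h X w b) = 0"
    using psd[of w] id by linarith+
  \<comment> \<open>A vanishing sum of nonnegative terms: where \<open>z b < 0\<close> the slack of
    the other solution is zero as well, which is the equality demanded by the critical cone.\<close>
  have comp: "z b * s' b = 0" if "b \<in> J" for b
  proof -
    have "w b * kernel_app h X w b = 0"
      using sum_nonneg_0[OF finJ nnJ sum0 that] .
    thus ?thesis using nn[OF that] compl[OF that] by simp
  qed
  have X0: "w b = 0" if "b \<in> X" for b
  proof (rule ccontr)
    assume "w b \<noteq> 0"
    moreover have "if z b < 0 then kernel_app h X w b = 0 else kernel_app h X w b \<ge> 0"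
      if "b \<in> J" "kernel_app h X z b = d b" for b
      using comp[OF that(1)] J[OF that(1)] that(2) by (auto simp: s_def)
    ultimately have "quad w > 0" using sosc eqE that unfolding sosc_def by blast
    thus False using q0 by simp
  qed
  have wJ: "kernel_app h X w b = 0" for b using X0 by (simp add: kernel_app_def)
  have off: "w b = 0" if "b \<in> M - active d z" for b
  proof -
    have b: "b \<in> J" "s b \<noteq> 0" using that by (auto simp: active_def s_def)
    hence "s' b = s b" using J(7) wJ by simp
    thus ?thesis using J(5,6)[OF b(1)] b(2) by (simp add: w_def)
  qed
  have "(\<Sum>b\<in>active d z. w b * h b c) = 0" if c: "c \<in> X" for c
  proof -
    have "(\<Sum>b\<in>active d z. w b * h b c) = (\<Sum>b\<in>M. w b * h b c)"
      using off finite_M active_sub by (intro sum.mono_neutral_left) auto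
    also have "\<dots> = kernel_app h S w c" by (rule kernel_app_X_multipliers[symmetric]) (use c X0 in auto)
    finally show ?thesis using eqX c by simp
  qed
  hence "\<forall>b\<in>active d z. w b = 0" using licq unfolding licq_def by blast
  hence "w a = 0" using a X0 off by auto
  thus ?thesis by (simp add: w_def)
qed

text \<open>Complementarity removes the multipliers of inactive rows, so \<open>z\<close> solves the
  square system on the primal and active indices.\<close>

lemma mcp_solution_active_basis:
  assumes sol: "mcp_solution h S J d z"
  shows "\<forall>a\<in>S - (X \<union> active d z). z a = 0"
    and "\<forall>a\<in>X \<union> active d z. kernel_app h S z a = d a"
  using sol kernel_app_M[OF _ order_refl, of _ z] J_sub disj
  by (auto simp: mcp_solution_def active_def)

end


section \<open>Block vectors as functions on index pairs\<close>

definition idx :: "(int \<Rightarrow> nat) \<Rightarrow> int set \<Rightarrow> (int \<times> nat) set" where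
  "idx p U = (SIGMA i:U. {..<p i})"

text \<open>A pair \<open>(i, s)\<close> names the same component in every block vector whose node
  set contains \<open>i\<close>. Restriction to a subdomain and comparison across subdomains then
  need no offset arithmetic.\<close>

definition bfun :: "(int \<Rightarrow> nat) \<Rightarrow> int set \<Rightarrow> real vec \<Rightarrow> int \<times> nat \<Rightarrow> real" where
  "bfun p U v = (\<lambda>(i, s). block p U v i $ s)"

lemma mem_idx [simp]: "(i, s) \<in> idx p U \<longleftrightarrow> i \<in> U \<and> s < p i"
  by (auto simp: idx_def)

lemma finite_idx [simp]: "finite U \<Longrightarrow> finite (idx p U)"
  by (simp add: idx_def)

lemma bij_betw_block_index:
  assumes "finite U"
  shows "bij_betw (\<lambda>a. block_index p U ! a) {..<block_dim p U} (idx p U)"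
proof -
  have set: "set (block_index p U) = idx p U"
    using assms by (auto simp: block_index_def idx_def)
  have "card (idx p U) = block_dim p U"
    using assms by (simp add: idx_def block_dim_def)
  hence "distinct (block_index p U)"
    unfolding set[symmetric] length_block_index[OF assms, symmetric] by (rule card_distinct)
  thus ?thesis using bij_betw_nth[of "block_index p U" "{..<block_dim p U}" "idx p U"]
    by (simp add: set length_block_index[OF assms])
qed

text \<open>Two numberings meet here: the list \<open>block_index\<close> and the offsets used by
  \<open>block\<close>. Injectivity of the list forces position \<open>a\<close> to be the offset of
  its block plus the local index.\<close>

lemma bfun_block_index:
  assumes U: "finite U" and a: "a < block_dim p U"
  shows "bfun p U v (block_index p U ! a) = v $ a"
proof -
  obtain i s where bi: "block_index p U ! a = (i, s)" by fastforce
  note bij = bij_betw_block_index[OF U, of p]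
  have "(i, s) \<in> idx p U" using bij_betw_apply[OF bij, of a] a bi by simp
  hence "i \<in> U" "s < p i" by auto
  note nth = block_index_nth[of U i s p, OF U this]
  have "a = block_dim p {j \<in> U. j < i} + s"
    by (rule inj_onD[OF bij_betw_imp_inj_on[OF bij]]) (use a nth bi in auto)
  thus ?thesis using \<open>s < p i\<close> unfolding bfun_def bi by (simp add: block_def)
qed

lemma bfun_all_iff:
  assumes "finite U"
  shows "(\<forall>a<block_dim p U. P (block_index p U ! a) (v $ a)) \<longleftrightarrow> (\<forall>b\<in>idx p U. P b (bfun p U v b))"
proof -
  have "idx p U = (\<lambda>a. block_index p U ! a) ` {..<block_dim p U}"
    using bij_betw_block_index[OF assms] by (simp add: bij_betw_def)
  thus ?thesis using bfun_block_index[OF assms, of _ p v] by auto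
qed

lemma bfun_vec:
  assumes U: "finite U" and b: "b \<in> idx p U"
  shows "bfun p U (vec (block_dim p U) (\<lambda>a. f (block_index p U ! a))) b = f b"
proof -
  obtain a where a: "a < block_dim p U" "block_index p U ! a = b"
    using b unfolding bij_betw_imp_surj_on[OF bij_betw_block_index[OF U, of p], symmetric] by auto
  show ?thesis using bfun_block_index[OF U a(1)] a by simp
qed

lemma bfun_block_vec:
  assumes "finite U" "i \<in> U" "s < p i"
  shows "bfun p U (block_vec p U f) (i, s) = f i $ s"
  using bfun_vec[OF assms(1), of "(i, s)" p "\<lambda>(i, s). f i $ s"] assms by (simp add: block_vec_def)

lemma bfun_eqI:
  assumes U: "finite U" and v: "v \<in> carrier_vec (block_dim p U)" "w \<in> carrier_vec (block_dim p U)"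
    and eq: "\<And>b. b \<in> idx p U \<Longrightarrow> bfun p U v b = bfun p U w b"
  shows "v = w"
proof (rule eq_vecI)
  fix a assume "a < dim_vec w"
  hence a: "a < block_dim p U" using v by simp
  hence "block_index p U ! a \<in> idx p U" using bij_betw_block_index[OF U] by (auto simp: bij_betw_def)
  thus "v $ a = w $ a" using eq[of "block_index p U ! a"] by (simp add: bfun_block_index[OF U a])
qed (use v in auto)

lemma bfun_eq_iff:
  assumes "finite U" "v \<in> carrier_vec (block_dim p U)" "w \<in> carrier_vec (block_dim p U)"
  shows "v = w \<longleftrightarrow> (\<forall>b\<in>idx p U. bfun p U v b = bfun p U w b)"
  using bfun_eqI[OF assms] by auto

lemma bfun_le_iff:
  assumes U: "finite U" and v: "v \<in> carrier_vec (block_dim p U)" "w \<in> carrier_vec (block_dim p U)"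
  shows "v \<le> w \<longleftrightarrow> (\<forall>b\<in>idx p U. bfun p U v b \<le> bfun p U w b)"
proof -
  have "v \<le> w \<longleftrightarrow> (\<forall>a<block_dim p U. bfun p U v (block_index p U ! a) \<le> w $ a)"
    using v bfun_block_index[OF U] by (auto simp: less_eq_vec_def)
  thus ?thesis using bfun_all_iff[OF U, of p "\<lambda>b y. bfun p U v b \<le> y" w] by simp
qed

lemma bfun_index:
  assumes U: "finite U" and b: "b \<in> idx p U"
  obtains a where "a < block_dim p U" "block_index p U ! a = b" "\<And>v. bfun p U v b = v $ a"
proof -
  obtain a where a: "a < block_dim p U" "block_index p U ! a = b"
    using b unfolding bij_betw_imp_surj_on[OF bij_betw_block_index[OF U, of p], symmetric] by auto
  thus ?thesis using that[OF a] bfun_block_index[OF U a(1)] by simp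
qed

lemma bfun_add:
  assumes "finite U" "b \<in> idx p U" "v \<in> carrier_vec (block_dim p U)" "w \<in> carrier_vec (block_dim p U)"
  shows "bfun p U (v + w) b = bfun p U v b + bfun p U w b"
proof -
  obtain a where "a < block_dim p U" "\<And>v. bfun p U v b = v $ a" using bfun_index[OF assms(1,2)] by blast
  thus ?thesis using assms by simp
qed

lemma bfun_diff:
  assumes "finite U" "b \<in> idx p U" "v \<in> carrier_vec (block_dim p U)" "w \<in> carrier_vec (block_dim p U)"
  shows "bfun p U (v - w) b = bfun p U v b - bfun p U w b"
proof -
  obtain a where "a < block_dim p U" "\<And>v. bfun p U v b = v $ a" using bfun_index[OF assms(1,2)] by blast
  thus ?thesis using assms by simp
qed

lemma bfun_zero:
  assumes "finite U" "b \<in> idx p U"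
  shows "bfun p U (0\<^sub>v (block_dim p U)) b = 0"
proof -
  obtain a where "a < block_dim p U" "\<And>v. bfun p U v b = v $ a" using bfun_index[OF assms(1,2)] by blast
  thus ?thesis by simp
qed

lemma scalar_prod_bfun:
  assumes "finite U" "v \<in> carrier_vec (block_dim p U)" "w \<in> carrier_vec (block_dim p U)"
  shows "v \<bullet> w = (\<Sum>b\<in>idx p U. bfun p U v b * bfun p U w b)"
proof -
  have "v \<bullet> w = (\<Sum>a<block_dim p U. bfun p U v (block_index p U ! a) * bfun p U w (block_index p U ! a))"
    using assms by (simp add: scalar_prod_def lessThan_atLeast0 bfun_block_index)
  also have "\<dots> = (\<Sum>b\<in>idx p U. bfun p U v b * bfun p U w b)"
    by (rule sum.reindex_bij_betw[OF bij_betw_block_index[OF assms(1)]])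
  finally show ?thesis .
qed

definition entry :: "(int \<Rightarrow> int \<Rightarrow> real mat) \<Rightarrow> int \<times> nat \<Rightarrow> int \<times> nat \<Rightarrow> real" where
  "entry M = (\<lambda>(i, s) (j, t). M i j $$ (s, t))"

lemma block_mat_carrier [simp]: "block_mat p U q W M \<in> carrier_mat (block_dim p U) (block_dim q W)"
  by (simp add: block_mat_def)

lemma dim_block_mat [simp]:
  "dim_row (block_mat p U q W M) = block_dim p U" "dim_col (block_mat p U q W M) = block_dim q W"
  by (simp_all add: block_mat_def)

lemma block_mat_index:
  assumes "a < block_dim p U" "b < block_dim q W"
  shows "block_mat p U q W M $$ (a, b) = entry M (block_index p U ! a) (block_index q W ! b)"
  using assms by (simp add: block_mat_def entry_def split: prod.splits)

lemma bfun_block_mat_mult: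
  assumes U: "finite U" and W: "finite W" and b: "b \<in> idx p U" and v: "v \<in> carrier_vec (block_dim q W)"
  shows "bfun p U (block_mat p U q W M *\<^sub>v v) b = kernel_app (entry M) (idx q W) (bfun q W v) b"
proof -
  obtain a where a: "a < block_dim p U" "block_index p U ! a = b" "\<And>v. bfun p U v b = v $ a"
    using bfun_index[OF U b] by blast
  have "(block_mat p U q W M *\<^sub>v v) $ a = (\<Sum>k<block_dim q W. block_mat p U q W M $$ (a, k) * v $ k)"
    using a(1) v
    by (simp add: scalar_prod_def lessThan_atLeast0)
  also have "\<dots> = (\<Sum>k<block_dim q W. entry M b (block_index q W ! k) * bfun q W v (block_index q W ! k))"
    using a W by (intro sum.cong refl) (simp add: block_mat_index bfun_block_index)
  also have "\<dots> = kernel_app (entry M) (idx q W) (bfun q W v) b"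
    unfolding kernel_app_def by (rule sum.reindex_bij_betw[OF bij_betw_block_index[OF W]])
  finally show ?thesis using a by simp
qed

lemma bfun_transpose_block_mat_mult:
  assumes U: "finite U" and W: "finite W" and b: "b \<in> idx q W" and v: "v \<in> carrier_vec (block_dim p U)"
  shows "bfun q W (transpose_mat (block_mat p U q W M) *\<^sub>v v) b =
    kernel_app (\<lambda>b a. entry M a b) (idx p U) (bfun p U v) b"
proof -
  obtain a where a: "a < block_dim q W" "block_index q W ! a = b" "\<And>v. bfun q W v b = v $ a"
    using bfun_index[OF W b] by blast
  have "(transpose_mat (block_mat p U q W M) *\<^sub>v v) $ a = (\<Sum>k<block_dim p U. block_mat p U q W M $$ (k, a) * v $ k)"
    using a(1) v
    by (simp add: scalar_prod_def lessThan_atLeast0)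
  also have "\<dots> = (\<Sum>k<block_dim p U. entry M (block_index p U ! k) b * bfun p U v (block_index p U ! k))"
    using a U by (intro sum.cong refl) (simp add: block_mat_index bfun_block_index)
  also have "\<dots> = kernel_app (\<lambda>b a. entry M a b) (idx p U) (bfun p U v) b"
    unfolding kernel_app_def by (rule sum.reindex_bij_betw[OF bij_betw_block_index[OF U]])
  finally show ?thesis using a by simp
qed

lemma vnorm_block: "vnorm (block p U v i) = L2_set (bfun p U v) ({i} \<times> {..<p i})"
proof -
  have "(\<Sum>s<p i. (block p U v i $ s)\<^sup>2) = (\<Sum>b\<in>{i} \<times> {..<p i}. (bfun p U v b)\<^sup>2)"
    unfolding bfun_def by (rule sum.reindex_bij_witness[of _ snd "Pair i"]) auto
  moreover have "dim_vec (block p U v i) = p i" by (simp add: block_def)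
  ultimately show ?thesis by (simp add: vnorm_eq_L2_set L2_set_def)
qed

lemma bfun_block_extract:
  assumes "finite U" "i \<in> U" "s < ndim G i"
  shows "bfun (ndim G) U (block_extract G U W v) (i, s) = bfun (ndim G) W v (i, s)"
  unfolding block_extract_def bfun_block_vec[of U i s "ndim G", OF assms] by (simp add: bfun_def)

lemma block_extract_carrier [simp]: "block_extract G U W v \<in> carrier_vec (nU G U)"
  by (simp add: block_extract_def block_vec_def nU_def)

section \<open>KKT systems as complementarity systems\<close>

definition hk :: "graph_qp \<Rightarrow> int \<times> nat \<Rightarrow> int \<times> nat \<Rightarrow> real" where
  "hk G = entry (Hblk G)"

definition primal_idx :: "graph_qp \<Rightarrow> int set \<Rightarrow> (int \<times> nat) set" where
  "primal_idx G U = idx (rdim G) U"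

text \<open>Vectors are ordered node by node, so primal variables and multipliers are interleaved.
  Sets of index pairs sort them apart without permuting \<open>H\<close>.\<close>

definition dual_idx :: "graph_qp \<Rightarrow> int set \<Rightarrow> (int \<times> nat) set" where
  "dual_idx G U = (SIGMA i:U. {rdim G i..<ndim G i})"

definition ineq_idx :: "graph_qp \<Rightarrow> int set \<Rightarrow> (int \<times> nat) set" where
  "ineq_idx G U = (SIGMA i:U. {rdim G i + mEdim G i..<ndim G i})"

abbreviation zf :: "graph_qp \<Rightarrow> int set \<Rightarrow> real vec \<Rightarrow> int \<times> nat \<Rightarrow> real" where
  "zf G U \<equiv> bfun (ndim G) U"

abbreviation all_idx :: "graph_qp \<Rightarrow> int set \<Rightarrow> (int \<times> nat) set" where
  "all_idx G U \<equiv> idx (ndim G) U"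

lemma all_idx_split: "all_idx G U = primal_idx G U \<union> dual_idx G U"
  by (force simp: idx_def primal_idx_def dual_idx_def ndim_def)

lemma dual_idx_shift: "bij_betw (\<lambda>(i, s). (i, rdim G i + s)) (idx (mdim G) U) (dual_idx G U)"
proof (rule bij_betwI[where g = "\<lambda>(i, s). (i, s - rdim G i)"])
qed (auto simp: dual_idx_def idx_def ndim_def)

lemma x_part_carrier [simp]: "x_part G U z \<in> carrier_vec (block_dim (rdim G) U)"
  by (simp add: x_part_def block_vec_def)

lemma l_part_carrier [simp]: "l_part G U z \<in> carrier_vec (block_dim (mdim G) U)"
  by (simp add: l_part_def block_vec_def)

lemma lE_part_carrier [simp]: "lE_part G U z \<in> carrier_vec (block_dim (mEdim G) U)"
  by (simp add: lE_part_def block_vec_def)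

lemma lI_part_carrier [simp]: "lI_part G U z \<in> carrier_vec (block_dim (mIdim G) U)"
  by (simp add: lI_part_def block_vec_def)

lemma bfun_x_part:
  assumes "finite U" "i \<in> U" "s < rdim G i"
  shows "bfun (rdim G) U (x_part G U z) (i, s) = zf G U z (i, s)"
  unfolding x_part_def bfun_block_vec[of U i s "rdim G", OF assms] using assms by (simp add: vec_first_def bfun_def)

lemma bfun_l_part:
  assumes "finite U" "i \<in> U" "s < mdim G i"
  shows "bfun (mdim G) U (l_part G U z) (i, s) = zf G U z (i, rdim G i + s)"
  unfolding l_part_def bfun_block_vec[of U i s "mdim G", OF assms] using assms
  by (simp add: vec_last_def bfun_def block_def ndim_def)

lemma bfun_lE_part:
  assumes "finite U" "i \<in> U" "s < mEdim G i"
  shows "bfun (mEdim G) U (lE_part G U z) (i, s) = zf G U z (i, rdim G i + s)"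
  unfolding lE_part_def bfun_block_vec[of U i s "mEdim G", OF assms] using assms
  by (simp add: vec_first_def vec_last_def bfun_def block_def ndim_def mdim_def)

lemma bfun_lI_part:
  assumes "finite U" "i \<in> U" "s < mIdim G i"
  shows "bfun (mIdim G) U (lI_part G U z) (i, s) = zf G U z (i, rdim G i + mEdim G i + s)"
  unfolding lI_part_def bfun_block_vec[of U i s "mIdim G", OF assms] using assms
  by (simp add: vec_last_def bfun_def block_def ndim_def mdim_def add_ac)

lemma valid_graph_qpD:
  assumes "valid_graph_qp G" "i \<in> nodes G" "j \<in> nodes G"
  shows "Qblk G i j \<in> carrier_mat (rdim G i) (rdim G j)" "Qblk G i j = transpose_mat (Qblk G j i)"
    "AEblk G i j \<in> carrier_mat (mEdim G i) (rdim G j)" "AIblk G i j \<in> carrier_mat (mIdim G i) (rdim G j)"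
    "1 \<le> rdim G i"
    "i \<noteq> j \<Longrightarrow> {i, j} \<notin> edges G \<Longrightarrow> Qblk G i j = 0\<^sub>m (rdim G i) (rdim G j) \<and>
      AEblk G i j = 0\<^sub>m (mEdim G i) (rdim G j) \<and> AIblk G i j = 0\<^sub>m (mIdim G i) (rdim G j)"
  using assms unfolding valid_graph_qp_def by blast+

lemma Ablk_index:
  assumes g: "valid_graph_qp G" and ij: "i \<in> nodes G" "j \<in> nodes G" and t: "t < rdim G j"
  shows "s < mEdim G i \<Longrightarrow> Ablk G i j $$ (s, t) = AEblk G i j $$ (s, t)"
    and "s < mIdim G i \<Longrightarrow> Ablk G i j $$ (mEdim G i + s, t) = AIblk G i j $$ (s, t)"
    and "Ablk G i j \<in> carrier_mat (mdim G i) (rdim G j)"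
proof -
  have c: "AEblk G i j \<in> carrier_mat (mEdim G i) (rdim G j)" "AIblk G i j \<in> carrier_mat (mIdim G i) (rdim G j)"
    using valid_graph_qpD[OF g ij] by blast+
  show "s < mEdim G i \<Longrightarrow> Ablk G i j $$ (s, t) = AEblk G i j $$ (s, t)"
    "s < mIdim G i \<Longrightarrow> Ablk G i j $$ (mEdim G i + s, t) = AIblk G i j $$ (s, t)"
    using c t by (auto simp: Ablk_def append_rows_def)
  show "Ablk G i j \<in> carrier_mat (mdim G i) (rdim G j)"
    unfolding Ablk_def mdim_def by (rule carrier_append_rows[OF c])
qed

lemma Ablk_carrier:
  assumes "valid_graph_qp G" "i \<in> nodes G" "j \<in> nodes G"
  shows "Ablk G i j \<in> carrier_mat (mdim G i) (rdim G j)"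
  using valid_graph_qpD(5)[OF assms(1,3,3)] by (intro Ablk_index(3)[OF assms, of 0]) simp

lemmas Qblk_carrier = valid_graph_qpD(1)

lemma Hblk_carrier:
  assumes "valid_graph_qp G" "i \<in> nodes G" "j \<in> nodes G"
  shows "Hblk G i j \<in> carrier_mat (ndim G i) (ndim G j)"
  unfolding Hblk_def ndim_def by (rule four_block_carrier_mat[OF Qblk_carrier[OF assms]]) simp

lemma hk_cases:
  assumes g: "valid_graph_qp G" and ij: "i \<in> nodes G" "j \<in> nodes G" and st: "s < ndim G i" "t < ndim G j"
  shows "hk G (i, s) (j, t) =
    (if s < rdim G i then if t < rdim G j then Qblk G i j $$ (s, t) else Ablk G j i $$ (t - rdim G j, s)
     else if t < rdim G j then Ablk G i j $$ (s - rdim G i, t) else 0)"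
proof -
  note c = Qblk_carrier[OF g ij] Ablk_carrier[OF g ij] Ablk_carrier[OF g ij(2,1)]
  have "hk G (i, s) (j, t) = Hblk G i j $$ (s, t)" by (simp add: hk_def entry_def)
  also have "\<dots> = (if s < rdim G i then if t < rdim G j then Qblk G i j $$ (s, t) else transpose_mat (Ablk G j i) $$ (s, t - rdim G j)
     else if t < rdim G j then Ablk G i j $$ (s - rdim G i, t) else 0\<^sub>m (mdim G i) (mdim G j) $$ (s - rdim G i, t - rdim G j))"
    unfolding Hblk_def using c st by (subst index_mat_four_block(1)) (auto simp: ndim_def)
  finally show ?thesis using c st by (auto simp: ndim_def)
qed

lemma hk_sym:
  assumes g: "valid_graph_qp G" and U: "U \<subseteq> nodes G" and ab: "a \<in> all_idx G U" "b \<in> all_idx G U"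
  shows "hk G a b = hk G b a"
proof -
  obtain i s j t where ab_eq: "a = (i, s)" "b = (j, t)" by fastforce
  have i: "i \<in> nodes G" "j \<in> nodes G" "s < ndim G i" "t < ndim G j" using ab U by (auto simp: ab_eq)
  have "Qblk G i j = transpose_mat (Qblk G j i)" by (rule valid_graph_qpD(2)[OF g i(1,2)])
  hence "Qblk G i j $$ (s, t) = Qblk G j i $$ (t, s)" if "s < rdim G i" "t < rdim G j"
    using that Qblk_carrier[OF g i(2,1)] by simp
  thus ?thesis unfolding ab_eq hk_cases[OF g i(1,2,3,4)] hk_cases[OF g i(2,1,4,3)]
    by (simp split: if_split)
qed

text \<open>This sparsity is why one application of \<open>H\<close> moves a support by at most one
  graph step. The data are used for both orders of the pair, as \<open>H_{i,j}\<close> contains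
  \<open>A_{i,j}\<close> as well as the transpose of \<open>A_{j,i}\<close>.\<close>

lemma hk_neighbours:
  assumes g: "valid_graph_qp G" and ij: "i \<in> nodes G" "j \<in> nodes G" "s < ndim G i" "t < ndim G j"
    and nz: "hk G (i, s) (j, t) \<noteq> 0"
  shows "i = j \<or> {i, j} \<in> edges G"
proof (rule ccontr)
  assume "\<not> ?thesis"
  hence n: "i \<noteq> j" "{i, j} \<notin> edges G" "{j, i} \<notin> edges G" by (auto simp: insert_commute)
  note zero = valid_graph_qpD(6)[OF g]
  note z = zero[OF ij(1,2) n(1,2)] zero[OF ij(2,1) n(1)[symmetric] n(3)]
  have A1: "Ablk G i j $$ (s', t') = 0" if "s' < mdim G i" "t' < rdim G j" for s' t'
    using that by (auto simp: Ablk_def z append_rows_def mdim_def)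
  have A2: "Ablk G j i $$ (s', t') = 0" if "s' < mdim G j" "t' < rdim G i" for s' t'
    using that by (auto simp: Ablk_def z append_rows_def mdim_def)
  have "hk G (i, s) (j, t) = 0"
    unfolding hk_cases[OF g ij] using ij(3,4) A1[of "s - rdim G i" t] A2[of "t - rdim G j" s]
    by (auto simp: ndim_def z)
  thus False using nz by simp
qed


text \<open>\<open>submatrix\<close> and \<open>subvec\<close> list the chosen positions by
  \<open>pick\<close>; as a bijection it provides the enumeration for
  \<open>kernel_mat\<close>.\<close>

lemma bij_betw_pick:
  assumes fin: "finite S"
  shows "bij_betw (pick S) {..<card S} S"
proof -
  have "card {a \<in> S. a < i} < card S" if "i \<in> S" for i
    using that fin by (intro psubset_card_mono) auto
  hence "pick S ` {..<card S} = S"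
    using pick_in_set[of _ S] pick_card_in_set[of _ S] by (auto simp: image_iff) (metis lessThan_iff)
  thus ?thesis unfolding bij_betw_def by (simp add: eq_card_imp_inj_on)
qed

section \<open>Translation of the quadratic program over one node set\<close>

locale qp_nodes =
  fixes G :: graph_qp and U :: "int set"
  assumes valid: "valid_graph_qp G" and U_nodes: "U \<subseteq> nodes G" and U_finite: "finite U"
begin

sublocale saddle_kernel "hk G" "primal_idx G U" "dual_idx G U" "ineq_idx G U"
proof
  show "finite (primal_idx G U)" "finite (dual_idx G U)"
    using U_finite by (auto simp: primal_idx_def dual_idx_def)
  show "primal_idx G U \<inter> dual_idx G U = {}" by (auto simp: primal_idx_def dual_idx_def)
  show "ineq_idx G U \<subseteq> dual_idx G U" by (auto simp: ineq_idx_def dual_idx_def)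
next
  fix a b assume "a \<in> primal_idx G U \<union> dual_idx G U" "b \<in> primal_idx G U \<union> dual_idx G U"
  thus "hk G a b = hk G b a" using hk_sym[OF valid U_nodes] all_idx_split by blast
next
  fix a b assume ab: "a \<in> dual_idx G U" "b \<in> dual_idx G U"
  obtain i s j t where "a = (i, s)" "b = (j, t)" by fastforce
  thus "hk G a b = 0" using ab U_nodes hk_cases[OF valid, of i j s t] by (auto simp: dual_idx_def)
qed

lemma node: "i \<in> U \<Longrightarrow> i \<in> nodes G"
  using U_nodes by auto

lemma kernel_primal_primal:
  assumes "i \<in> U" "s < rdim G i"
  shows "kernel_app (hk G) (primal_idx G U) w (i, s) = kernel_app (entry (Qblk G)) (idx (rdim G) U) w (i, s)"
  unfolding kernel_app_def primal_idx_def
proof (intro sum.cong refl)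
  fix b assume b: "b \<in> idx (rdim G) U"
  obtain j t where "b = (j, t)" by fastforce
  with b assms show "hk G (i, s) b * w b = entry (Qblk G) (i, s) b * w b"
    using hk_cases[OF valid node node, of i j s t] by (simp add: ndim_def entry_def)
qed

lemma kernel_dual_primal:
  assumes "i \<in> U" "s < mdim G i"
  shows "kernel_app (hk G) (primal_idx G U) w (i, rdim G i + s) = kernel_app (entry (Ablk G)) (idx (rdim G) U) w (i, s)"
  unfolding kernel_app_def primal_idx_def
proof (intro sum.cong refl)
  fix b assume b: "b \<in> idx (rdim G) U"
  obtain j t where "b = (j, t)" by fastforce
  with b assms show "hk G (i, rdim G i + s) b * w b = entry (Ablk G) (i, s) b * w b"
    using hk_cases[OF valid node node, of i j "rdim G i + s" t] by (simp add: ndim_def entry_def)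
qed

lemma kernel_eq_primal:
  assumes "i \<in> U" "s < mEdim G i"
  shows "kernel_app (hk G) (primal_idx G U) w (i, rdim G i + s) = kernel_app (entry (AEblk G)) (idx (rdim G) U) w (i, s)"
proof -
  have "s < mdim G i" using assms by (simp add: mdim_def)
  hence "kernel_app (hk G) (primal_idx G U) w (i, rdim G i + s) = kernel_app (entry (Ablk G)) (idx (rdim G) U) w (i, s)"
    by (rule kernel_dual_primal[OF assms(1)])
  also have "\<dots> = kernel_app (entry (AEblk G)) (idx (rdim G) U) w (i, s)"
    unfolding kernel_app_def
    using assms node Ablk_index(1)[OF valid node node] by (intro sum.cong refl) (auto simp: entry_def)
  finally show ?thesis .
qed

lemma kernel_ineq_primal:
  assumes "i \<in> U" "s < mIdim G i"
  shows "kernel_app (hk G) (primal_idx G U) w (i, rdim G i + mEdim G i + s) =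
    kernel_app (entry (AIblk G)) (idx (rdim G) U) w (i, s)"
proof -
  have "mEdim G i + s < mdim G i" using assms by (simp add: mdim_def)
  hence "kernel_app (hk G) (primal_idx G U) w (i, rdim G i + (mEdim G i + s)) =
      kernel_app (entry (Ablk G)) (idx (rdim G) U) w (i, mEdim G i + s)"
    by (rule kernel_dual_primal[OF assms(1)])
  also have "\<dots> = kernel_app (entry (AIblk G)) (idx (rdim G) U) w (i, s)"
    unfolding kernel_app_def
    using assms node Ablk_index(2)[OF valid node node] by (intro sum.cong refl) (auto simp: entry_def)
  finally show ?thesis by (simp add: add.assoc)
qed

text \<open>The upper right block of \<open>H\<close> is a transpose, hence the swapped arguments of
  \<open>entry\<close>; the multipliers of node \<open>j\<close> start at local index
  \<open>rdim G j\<close>.\<close>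

lemma kernel_primal_dual:
  assumes "i \<in> U" "s < rdim G i"
  shows "kernel_app (hk G) (dual_idx G U) z (i, s) =
    kernel_app (\<lambda>b a. entry (Ablk G) a b) (idx (mdim G) U) (\<lambda>(j, t). z (j, rdim G j + t)) (i, s)"
proof -
  have "kernel_app (hk G) (dual_idx G U) z (i, s) =
    (\<Sum>b\<in>idx (mdim G) U. (case b of (j, t) \<Rightarrow> hk G (i, s) (j, rdim G j + t) * z (j, rdim G j + t)))"
    unfolding kernel_app_def
    by (subst sum.reindex_bij_betw[OF dual_idx_shift, symmetric]) (simp add: case_prod_unfold)
  also have "\<dots> = (\<Sum>b\<in>idx (mdim G) U. entry (Ablk G) b (i, s) * (case b of (j, t) \<Rightarrow> z (j, rdim G j + t)))"
  proof (intro sum.cong refl)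
    fix b assume b: "b \<in> idx (mdim G) U"
    obtain j t where "b = (j, t)" by fastforce
    with b assms show "(case b of (j, t) \<Rightarrow> hk G (i, s) (j, rdim G j + t) * z (j, rdim G j + t)) =
        entry (Ablk G) b (i, s) * (case b of (j, t) \<Rightarrow> z (j, rdim G j + t))"
      using hk_cases[OF valid node node, of i j s "rdim G j + t"] by (simp add: ndim_def entry_def)
  qed
  finally show ?thesis by (simp add: kernel_app_def)
qed

lemma bfun_x_part': "b \<in> idx (rdim G) U \<Longrightarrow> bfun (rdim G) U (x_part G U z) b = zf G U z b"
  using bfun_x_part[OF U_finite] by (cases b) auto

lemma kernel_x_part: "kernel_app k (idx (rdim G) U) (bfun (rdim G) U (x_part G U z)) a = kernel_app k (idx (rdim G) U) (zf G U z) a"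
  by (rule kernel_app_cong) (rule bfun_x_part')

lemma Qmat_mult:
  assumes "i \<in> U" "s < rdim G i" "v \<in> carrier_vec (block_dim (rdim G) U)"
  shows "bfun (rdim G) U (Qmat G U *\<^sub>v v) (i, s) = kernel_app (hk G) (primal_idx G U) (bfun (rdim G) U v) (i, s)"
  unfolding Qmat_def using bfun_block_mat_mult[OF U_finite U_finite _ assms(3), of "(i, s)" "rdim G" "Qblk G"] assms
    kernel_primal_primal by simp

lemma Amat_mult:
  assumes "i \<in> U" "s < mdim G i" "v \<in> carrier_vec (block_dim (rdim G) U)"
  shows "bfun (mdim G) U (Amat G U *\<^sub>v v) (i, s) = kernel_app (hk G) (primal_idx G U) (bfun (rdim G) U v) (i, rdim G i + s)"
  unfolding Amat_def using bfun_block_mat_mult[OF U_finite U_finite _ assms(3), of "(i, s)" "mdim G" "Ablk G"] assms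
    kernel_dual_primal by simp

lemma AEmat_mult:
  assumes "i \<in> U" "s < mEdim G i" "v \<in> carrier_vec (block_dim (rdim G) U)"
  shows "bfun (mEdim G) U (AEmat G U *\<^sub>v v) (i, s) = kernel_app (hk G) (primal_idx G U) (bfun (rdim G) U v) (i, rdim G i + s)"
  unfolding AEmat_def using bfun_block_mat_mult[OF U_finite U_finite _ assms(3), of "(i, s)" "mEdim G" "AEblk G"] assms
    kernel_eq_primal by simp

lemma AImat_mult:
  assumes "i \<in> U" "s < mIdim G i" "v \<in> carrier_vec (block_dim (rdim G) U)"
  shows "bfun (mIdim G) U (AImat G U *\<^sub>v v) (i, s) =
    kernel_app (hk G) (primal_idx G U) (bfun (rdim G) U v) (i, rdim G i + mEdim G i + s)"
  unfolding AImat_def using bfun_block_mat_mult[OF U_finite U_finite _ assms(3), of "(i, s)" "mIdim G" "AIblk G"] assms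
    kernel_ineq_primal by simp

lemma mat_carriers:
  "Qmat G U \<in> carrier_mat (block_dim (rdim G) U) (block_dim (rdim G) U)"
  "Amat G U \<in> carrier_mat (block_dim (mdim G) U) (block_dim (rdim G) U)"
  "AEmat G U \<in> carrier_mat (block_dim (mEdim G) U) (block_dim (rdim G) U)"
  "AImat G U \<in> carrier_mat (block_dim (mIdim G) U) (block_dim (rdim G) U)"
  "Hmat G U \<in> carrier_mat (nU G U) (nU G U)"
  by (simp_all add: Qmat_def Amat_def AEmat_def AImat_def Hmat_def nU_def)

lemma kernel_x: "kernel_app (hk G) (primal_idx G U) (bfun (rdim G) U (x_part G U z)) a =
    kernel_app (hk G) (primal_idx G U) (zf G U z) a"
  unfolding primal_idx_def by (rule kernel_x_part)

lemma AImat_x_part: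
  assumes "i \<in> U" "s < mIdim G i"
  shows "bfun (mIdim G) U (AImat G U *\<^sub>v x_part G U z) (i, s) =
    kernel_app (hk G) (primal_idx G U) (zf G U z) (i, rdim G i + mEdim G i + s)"
  using AImat_mult[OF assms x_part_carrier] kernel_x by simp

lemma kernel_dual:
  "a \<in> dual_idx G U \<Longrightarrow> kernel_app (hk G) (all_idx G U) z a = kernel_app (hk G) (primal_idx G U) z a"
  unfolding all_idx_split by (rule kernel_app_M[OF _ order_refl])

lemma stationarity_iff:
  "Qmat G U *\<^sub>v x_part G U z + transpose_mat (Amat G U) *\<^sub>v l_part G U z = x_part G U d \<longleftrightarrow>
    (\<forall>a\<in>primal_idx G U. kernel_app (hk G) (all_idx G U) (zf G U z) a = zf G U d a)"
proof -
  let ?Q = "Qmat G U *\<^sub>v x_part G U z" and ?A = "transpose_mat (Amat G U) *\<^sub>v l_part G U z"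
  have car: "?Q \<in> carrier_vec (block_dim (rdim G) U)" "?A \<in> carrier_vec (block_dim (rdim G) U)"
    using mat_carriers by auto
  have split: "kernel_app (hk G) (all_idx G U) y a =
      kernel_app (hk G) (primal_idx G U) y a + kernel_app (hk G) (dual_idx G U) y a" for y a
    unfolding kernel_app_def all_idx_split using finite_X finite_M disj by (rule sum.union_disjoint)
  have "bfun (rdim G) U (?Q + ?A) a = kernel_app (hk G) (all_idx G U) (zf G U z) a \<and>
     bfun (rdim G) U (x_part G U d) a = zf G U d a" if a: "a \<in> primal_idx G U" for a
  proof -
    obtain i s where is_eq: "a = (i, s)" by fastforce
    have i: "i \<in> U" "s < rdim G i" using a by (auto simp: is_eq primal_idx_def)
    have mem: "(i, s) \<in> idx (rdim G) U" using i by simp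
    have "bfun (rdim G) U ?A (i, s) = kernel_app (hk G) (dual_idx G U) (zf G U z) (i, s)"
      unfolding kernel_primal_dual[OF i] Amat_def
        bfun_transpose_block_mat_mult[OF U_finite U_finite mem l_part_carrier]
      by (rule kernel_app_cong) (auto simp: bfun_l_part[OF U_finite])
    moreover have "bfun (rdim G) U ?Q (i, s) = kernel_app (hk G) (primal_idx G U) (zf G U z) (i, s)"
      using Qmat_mult[OF i x_part_carrier] kernel_x by simp
    ultimately show ?thesis
      unfolding is_eq bfun_add[OF U_finite mem car] split using bfun_x_part[OF U_finite i] by simp
  qed
  moreover have "?Q + ?A = x_part G U d \<longleftrightarrow>
      (\<forall>a\<in>primal_idx G U. bfun (rdim G) U (?Q + ?A) a = bfun (rdim G) U (x_part G U d) a)"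
    unfolding primal_idx_def using car by (intro bfun_eq_iff[OF U_finite]) auto
  ultimately show ?thesis by auto
qed

definition eq_idx :: "(int \<times> nat) set" where
  "eq_idx = (SIGMA i:U. {rdim G i..<rdim G i + mEdim G i})"

lemma eq_idx_eq: "eq_idx = dual_idx G U - ineq_idx G U"
  by (auto simp: eq_idx_def dual_idx_def ineq_idx_def ndim_def mdim_def)

lemma ball_eq_idx: "(\<forall>a\<in>eq_idx. P a) \<longleftrightarrow> (\<forall>(i, s)\<in>idx (mEdim G) U. P (i, rdim G i + s))"
proof (intro iffI ballI)
  fix a assume "\<forall>(i, s)\<in>idx (mEdim G) U. P (i, rdim G i + s)" "a \<in> eq_idx"
  moreover obtain i s where "a = (i, s)" by fastforce
  ultimately show "P a" by (auto simp: eq_idx_def dest!: bspec[of _ _ "(i, s - rdim G i)"])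
qed (auto simp: eq_idx_def)

lemma ball_ineq_idx: "(\<forall>a\<in>ineq_idx G U. P a) \<longleftrightarrow> (\<forall>(i, s)\<in>idx (mIdim G) U. P (i, rdim G i + mEdim G i + s))"
proof (intro iffI ballI)
  fix a assume "\<forall>(i, s)\<in>idx (mIdim G) U. P (i, rdim G i + mEdim G i + s)" "a \<in> ineq_idx G U"
  moreover obtain i s where "a = (i, s)" by fastforce
  ultimately show "P a"
    by (auto simp: ineq_idx_def ndim_def mdim_def dest!: bspec[of _ _ "(i, s - (rdim G i + mEdim G i))"])
qed (auto simp: ineq_idx_def ndim_def mdim_def)

lemma ineq_dual: "a \<in> ineq_idx G U \<Longrightarrow> a \<in> dual_idx G U"
  using J_sub by auto

lemma equality_iff:
  "AEmat G U *\<^sub>v x_part G U z = lE_part G U d \<longleftrightarrow>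
    (\<forall>a\<in>eq_idx. kernel_app (hk G) (primal_idx G U) (zf G U z) a = zf G U d a)"
proof -
  have "AEmat G U *\<^sub>v x_part G U z = lE_part G U d \<longleftrightarrow>
    (\<forall>b\<in>idx (mEdim G) U. bfun (mEdim G) U (AEmat G U *\<^sub>v x_part G U z) b = bfun (mEdim G) U (lE_part G U d) b)"
    using mat_carriers(3) by (intro bfun_eq_iff[OF U_finite]) auto
  also have "\<dots> \<longleftrightarrow> (\<forall>(i, s)\<in>idx (mEdim G) U.
      kernel_app (hk G) (primal_idx G U) (zf G U z) (i, rdim G i + s) = zf G U d (i, rdim G i + s))"
    using AEmat_mult[OF _ _ x_part_carrier] kernel_x bfun_lE_part[OF U_finite] by (intro ball_cong) auto
  finally show ?thesis unfolding ball_eq_idx .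
qed

lemma inequality_iff:
  "lI_part G U d \<le> AImat G U *\<^sub>v x_part G U z \<longleftrightarrow>
    (\<forall>a\<in>ineq_idx G U. zf G U d a \<le> kernel_app (hk G) (primal_idx G U) (zf G U z) a)"
proof -
  have "lI_part G U d \<le> AImat G U *\<^sub>v x_part G U z \<longleftrightarrow>
    (\<forall>b\<in>idx (mIdim G) U. bfun (mIdim G) U (lI_part G U d) b \<le> bfun (mIdim G) U (AImat G U *\<^sub>v x_part G U z) b)"
    using mat_carriers(4) by (intro bfun_le_iff[OF U_finite]) auto
  also have "\<dots> \<longleftrightarrow> (\<forall>(i, s)\<in>idx (mIdim G) U. zf G U d (i, rdim G i + mEdim G i + s) \<le>
      kernel_app (hk G) (primal_idx G U) (zf G U z) (i, rdim G i + mEdim G i + s))"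
    using AImat_x_part bfun_lI_part[OF U_finite] by (intro ball_cong) auto
  finally show ?thesis unfolding ball_ineq_idx .
qed

lemma multiplier_sign_iff:
  "lI_part G U z \<le> 0\<^sub>v (block_dim (mIdim G) U) \<longleftrightarrow> (\<forall>a\<in>ineq_idx G U. zf G U z a \<le> 0)"
proof -
  have "lI_part G U z \<le> 0\<^sub>v (block_dim (mIdim G) U) \<longleftrightarrow>
    (\<forall>b\<in>idx (mIdim G) U. bfun (mIdim G) U (lI_part G U z) b \<le> bfun (mIdim G) U (0\<^sub>v (block_dim (mIdim G) U)) b)"
    by (intro bfun_le_iff[OF U_finite]) auto
  also have "\<dots> \<longleftrightarrow> (\<forall>(i, s)\<in>idx (mIdim G) U. zf G U z (i, rdim G i + mEdim G i + s) \<le> 0)"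
    using bfun_lI_part[OF U_finite] bfun_zero[OF U_finite] by (intro ball_cong) auto
  finally show ?thesis unfolding ball_ineq_idx .
qed

lemma complementarity_iff:
  "mat_diag (block_dim (mIdim G) U) (\<lambda>a. lI_part G U z $ a) *\<^sub>v
       (AImat G U *\<^sub>v x_part G U z - lI_part G U d) = 0\<^sub>v (block_dim (mIdim G) U) \<longleftrightarrow>
    (\<forall>a\<in>ineq_idx G U. zf G U z a * (kernel_app (hk G) (primal_idx G U) (zf G U z) a - zf G U d a) = 0)"
proof -
  let ?n = "block_dim (mIdim G) U" and ?p = "mIdim G"
  let ?y = "AImat G U *\<^sub>v x_part G U z - lI_part G U d"
  have c: "AImat G U *\<^sub>v x_part G U z \<in> carrier_vec ?n" using mat_carriers(4) by auto
  hence y: "?y \<in> carrier_vec ?n" by simp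
  have diag: "(mat_diag ?n f *\<^sub>v v) $ a = f a * v $ a" if "a < ?n" "v \<in> carrier_vec ?n" for f and v :: "real vec" and a
  proof -
    have "(mat_diag ?n f *\<^sub>v v) $ a = (\<Sum>k = 0..<?n. (if a = k then f k else 0) * v $ k)"
      using that by (simp add: mat_diag_def scalar_prod_def)
    also have "\<dots> = (\<Sum>k = 0..<?n. if a = k then f k * v $ k else 0)" by (intro sum.cong) auto
    finally show ?thesis using that by simp
  qed
  have "mat_diag ?n (\<lambda>a. lI_part G U z $ a) *\<^sub>v ?y = 0\<^sub>v ?n \<longleftrightarrow>
      (\<forall>a<?n. bfun ?p U (lI_part G U z) (block_index ?p U ! a) * ?y $ a = 0)"
    unfolding vec_eq_iff using diag[OF _ y] bfun_block_index[OF U_finite] by (auto simp: mat_diag_def)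
  also have "\<dots> \<longleftrightarrow> (\<forall>b\<in>idx ?p U. bfun ?p U (lI_part G U z) b * bfun ?p U ?y b = 0)"
    by (rule bfun_all_iff[OF U_finite, of ?p "\<lambda>b v. bfun ?p U (lI_part G U z) b * v = 0"])
  also have "\<dots> \<longleftrightarrow> (\<forall>(i, s)\<in>idx ?p U. zf G U z (i, rdim G i + mEdim G i + s) *
      (kernel_app (hk G) (primal_idx G U) (zf G U z) (i, rdim G i + mEdim G i + s) - zf G U d (i, rdim G i + mEdim G i + s)) = 0)"
    using AImat_x_part bfun_lI_part[OF U_finite] bfun_diff[OF U_finite _ c lI_part_carrier]
    by (intro ball_cong) auto
  finally show ?thesis unfolding ball_ineq_idx .
qed

text \<open>Each of the KKT conditions becomes one clause. Constraint rows may be summed over all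
  indices or over the primal ones alone, since the multiplier block contributes nothing.\<close>

lemma pd_solution_iff:
  "pd_solution G U d z \<longleftrightarrow> z \<in> carrier_vec (nU G U) \<and>
    mcp_solution (hk G) (all_idx G U) (ineq_idx G U) (zf G U d) (zf G U z)"
proof -
  have "all_idx G U - ineq_idx G U = primal_idx G U \<union> eq_idx"
    unfolding all_idx_split eq_idx_eq using disj J_sub by auto
  hence "(\<forall>a\<in>all_idx G U - ineq_idx G U. kernel_app (hk G) (all_idx G U) (zf G U z) a = zf G U d a) \<longleftrightarrow>
      (\<forall>a\<in>primal_idx G U. kernel_app (hk G) (all_idx G U) (zf G U z) a = zf G U d a) \<and>
      (\<forall>a\<in>eq_idx. kernel_app (hk G) (primal_idx G U) (zf G U z) a = zf G U d a)"
    using kernel_dual[of _ "zf G U z"] by (simp add: ball_Un eq_idx_eq)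
  moreover have "(\<forall>a\<in>ineq_idx G U. zf G U d a \<le> kernel_app (hk G) (all_idx G U) (zf G U z) a \<and>
      zf G U z a \<le> 0 \<and> zf G U z a * (kernel_app (hk G) (all_idx G U) (zf G U z) a - zf G U d a) = 0) \<longleftrightarrow>
      (\<forall>a\<in>ineq_idx G U. zf G U d a \<le> kernel_app (hk G) (primal_idx G U) (zf G U z) a \<and>
      zf G U z a \<le> 0 \<and> zf G U z a * (kernel_app (hk G) (primal_idx G U) (zf G U z) a - zf G U d a) = 0)"
    using kernel_dual[of _ "zf G U z"] ineq_dual by (intro ball_cong refl) simp
  ultimately show ?thesis
    unfolding pd_solution_def stationarity_iff equality_iff inequality_iff multiplier_sign_iff
      complementarity_iff mcp_solution_def by blast
qed

section \<open>Curvature, SOSC and LICQ in kernel form\<close>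

lemma quad_eq:
  assumes "v \<in> carrier_vec (block_dim (rdim G) U)"
  shows "v \<bullet> (Qmat G U *\<^sub>v v) = quad (bfun (rdim G) U v)"
proof -
  have "Qmat G U *\<^sub>v v \<in> carrier_vec (block_dim (rdim G) U)" using mat_carriers(1) assms by (rule mult_mat_vec_carrier)
  hence "v \<bullet> (Qmat G U *\<^sub>v v) = (\<Sum>b\<in>idx (rdim G) U. bfun (rdim G) U v b * bfun (rdim G) U (Qmat G U *\<^sub>v v) b)"
    by (rule scalar_prod_bfun[OF U_finite assms])
  also have "\<dots> = quad (bfun (rdim G) U v)"
    unfolding quad_def using Qmat_mult[OF _ _ assms]
    by (intro sum.cong) (auto simp: primal_idx_def)
  finally show ?thesis .
qed

lemma quad_cong: "(\<And>a. a \<in> primal_idx G U \<Longrightarrow> u a = v a) \<Longrightarrow> quad u = quad v"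
  unfolding quad_def using kernel_app_cong[of "primal_idx G U" u v] by (intro sum.cong) auto

text \<open>A right inverse of \<open>bfun\<close> on primal indices: conditions quantified over
  vectors become available for arbitrary functions \<open>w\<close>.\<close>

definition prim_vec :: "(int \<times> nat \<Rightarrow> real) \<Rightarrow> real vec" where
  "prim_vec w = vec (block_dim (rdim G) U) (\<lambda>a. w (block_index (rdim G) U ! a))"

lemma prim_vec_carrier [simp]: "prim_vec w \<in> carrier_vec (block_dim (rdim G) U)"
  by (simp add: prim_vec_def)

lemma bfun_prim_vec: "a \<in> primal_idx G U \<Longrightarrow> bfun (rdim G) U (prim_vec w) a = w a"
  unfolding prim_vec_def primal_idx_def by (rule bfun_vec[OF U_finite])

lemma kernel_prim_vec: "kernel_app (hk G) (primal_idx G U) (bfun (rdim G) U (prim_vec w)) a = kernel_app (hk G) (primal_idx G U) w a"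
  by (rule kernel_app_cong) (rule bfun_prim_vec)

lemma quad_nonneg:
  assumes "pos_semidef (Qmat G U)"
  shows "quad w \<ge> 0"
proof -
  have "quad w = quad (bfun (rdim G) U (prim_vec w))" by (rule quad_cong) (simp add: bfun_prim_vec)
  also have "\<dots> = prim_vec w \<bullet> (Qmat G U *\<^sub>v prim_vec w)" by (simp add: quad_eq)
  also have "\<dots> \<ge> 0" using assms mat_carriers(1) by (auto simp: pos_semidef_def)
  finally show ?thesis .
qed

text \<open>A function satisfying the kernel form of the cone conditions is turned into a vector of
  \<open>critical_cone\<close>, with the same quadratic form.\<close>

lemma sosc_of_SOSC:
  assumes S: "SOSC G U d z"
  shows "sosc (zf G U d) (zf G U z)"
  unfolding sosc_def
proof (intro allI impI)
  fix w
  assume e: "\<forall>a\<in>dual_idx G U - ineq_idx G U. kernel_app (hk G) (primal_idx G U) w a = 0"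
    and J: "\<forall>a\<in>ineq_idx G U. kernel_app (hk G) (primal_idx G U) (zf G U z) a = zf G U d a \<longrightarrow>
      (if zf G U z a < 0 then kernel_app (hk G) (primal_idx G U) w a = 0
       else 0 \<le> kernel_app (hk G) (primal_idx G U) w a)"
    and nz: "\<exists>a\<in>primal_idx G U. w a \<noteq> 0"
  let ?w = "prim_vec w" and ?p = "mIdim G"
  have AE: "AEmat G U *\<^sub>v ?w = 0\<^sub>v (block_dim (mEdim G) U)"
  proof (rule bfun_eqI[OF U_finite])
    fix b assume b: "b \<in> idx (mEdim G) U"
    obtain i s where bi: "b = (i, s)" by fastforce
    have "(i, rdim G i + s) \<in> eq_idx" using b by (simp add: bi eq_idx_def)
    hence "bfun (mEdim G) U (AEmat G U *\<^sub>v ?w) b = 0"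
      using b e AEmat_mult[OF _ _ prim_vec_carrier, of i s w] by (simp add: bi eq_idx_eq kernel_prim_vec)
    thus "bfun (mEdim G) U (AEmat G U *\<^sub>v ?w) b = bfun (mEdim G) U (0\<^sub>v (block_dim (mEdim G) U)) b"
      by (simp only: bfun_zero[OF U_finite b])
  qed (use mat_carriers(3) in auto)
  have AI: "if lI_part G U z $ a < 0 then (AImat G U *\<^sub>v ?w) $ a = 0 else (AImat G U *\<^sub>v ?w) $ a \<ge> 0"
    if a: "a < block_dim ?p U" and act: "(AImat G U *\<^sub>v x_part G U z) $ a = lI_part G U d $ a" for a
  proof -
    obtain i s where bi: "block_index ?p U ! a = (i, s)" by fastforce
    have "(i, s) \<in> idx ?p U" using bij_betw_apply[OF bij_betw_block_index[OF U_finite, of ?p], of a] a bi by simp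
    hence i: "i \<in> U" "s < ?p i" by auto
    have v: "v $ a = bfun ?p U v (i, s)" for v
      using bfun_block_index[OF U_finite a] bi by simp
    have "(i, rdim G i + mEdim G i + s) \<in> ineq_idx G U" using i by (simp add: ineq_idx_def ndim_def mdim_def)
    thus ?thesis using J act unfolding v
      using AImat_x_part[OF i] AImat_mult[OF i prim_vec_carrier] kernel_prim_vec bfun_lI_part[OF U_finite i] by simp
  qed
  have "?w \<in> critical_cone G U d z" unfolding critical_cone_def using AE AI by simp
  moreover have "?w \<noteq> 0\<^sub>v (block_dim (rdim G) U)"
  proof
    assume w0: "?w = 0\<^sub>v (block_dim (rdim G) U)"
    obtain a where a: "a \<in> primal_idx G U" "w a \<noteq> 0" using nz by auto
    thus False using bfun_prim_vec[OF a(1), of w] bfun_zero[OF U_finite, of a "rdim G"] unfolding w0 primal_idx_def by simp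
  qed
  ultimately have "0 < ?w \<bullet> (Qmat G U *\<^sub>v ?w)" using S by (auto simp: SOSC_def)
  also have "\<dots> = quad (bfun (rdim G) U ?w)" by (simp add: quad_eq)
  also have "\<dots> = quad w" by (rule quad_cong) (simp add: bfun_prim_vec)
  finally show "quad w > 0" .
qed


text \<open>Rows of \<open>A_U\<close> are numbered over constraints only, active indices over all
  components of a node; the shift by \<open>rdim G i\<close> translates the one into the
  other.\<close>

lemma active_rows_image:
  "(\<lambda>a. case block_index (mdim G) U ! a of (i, s) \<Rightarrow> (i, rdim G i + s)) ` active_rows G U d z
    = active (zf G U d) (zf G U z)" (is "?\<phi> ` ?R = ?A")
proof -
  have at: "a \<in> ?R \<longleftrightarrow> ?\<phi> a \<in> ?A" if a: "a < block_dim (mdim G) U" for a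
  proof -
    obtain i s where bi: "block_index (mdim G) U ! a = (i, s)" by fastforce
    have "(i, s) \<in> idx (mdim G) U"
      using bij_betw_apply[OF bij_betw_block_index[OF U_finite, of "mdim G"], of a] a bi by simp
    hence i: "i \<in> U" "s < mdim G i" by auto
    have v: "v $ a = bfun (mdim G) U v (i, s)" for v
      using bfun_block_index[OF U_finite a] bi by simp
    have "(i, rdim G i + s) \<in> dual_idx G U" "(i, rdim G i + s) \<in> ineq_idx G U \<longleftrightarrow> mEdim G i \<le> s"
      using i by (auto simp: dual_idx_def ineq_idx_def ndim_def)
    thus ?thesis
      using a Amat_mult[OF i x_part_carrier] kernel_x bfun_l_part[OF U_finite i]
      unfolding active_rows_def active_def by (auto simp: bi v)
  qed
  show ?thesis
  proof (intro equalityI subsetI)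
    fix b assume "b \<in> ?\<phi> ` ?R"
    then obtain a where "a \<in> ?R" "b = ?\<phi> a" by blast
    thus "b \<in> ?A" using at[of a] by (auto simp: active_rows_def)
  next
    fix b assume b: "b \<in> ?A"
    hence "b \<in> dual_idx G U" using active_sub by auto
    then obtain c where c: "c \<in> idx (mdim G) U" "b = (case c of (i, s) \<Rightarrow> (i, rdim G i + s))"
      unfolding bij_betw_imp_surj_on[OF dual_idx_shift, symmetric] by blast
    obtain a where a: "a < block_dim (mdim G) U" "block_index (mdim G) U ! a = c"
      using bfun_index[OF U_finite c(1)] by blast
    have "b = ?\<phi> a" using a c by simp
    thus "b \<in> ?\<phi> ` ?R" using at[OF a(1)] b by blast
  qed
qed

lemma licq_of_LICQ:
  assumes L: "LICQ G U d z"
  shows "licq (zf G U d) (zf G U z)"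
  unfolding licq_def
proof (intro allI impI)
  fix \<mu>
  assume \<mu>: "\<forall>b\<in>primal_idx G U. (\<Sum>a\<in>active (zf G U d) (zf G U z). \<mu> a * hk G a b) = 0"
  define R where "R = active_rows G U d z"
  define \<phi> where "\<phi> a = (case block_index (mdim G) U ! a of (i, s) \<Rightarrow> (i, rdim G i + s))" for a
  let ?n = "block_dim (rdim G) U" and ?A = "submatrix (Amat G U) R UNIV"
  let ?act = "active (zf G U d) (zf G U z)"
  have R: "R \<subseteq> {..<block_dim (mdim G) U}" by (auto simp: R_def active_rows_def)
  have finR: "finite R" using R finite_subset by auto
  have Req: "{a. a < dim_row (Amat G U) \<and> a \<in> R} = R" using R mat_carriers(2) by auto
  have A: "?A \<in> carrier_mat (card R) ?n"
    using mat_carriers(2) Req by (intro carrier_matI) (auto simp: dim_submatrix)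
  have img: "\<phi> ` R = ?act" using active_rows_image[of d z] by (simp add: \<phi>_def R_def)
  have inj: "inj_on \<phi> {..<block_dim (mdim G) U}"
  proof (rule inj_onI)
    fix a b assume ab: "a \<in> {..<block_dim (mdim G) U}" "b \<in> {..<block_dim (mdim G) U}" "\<phi> a = \<phi> b"
    hence "block_index (mdim G) U ! a = block_index (mdim G) U ! b"
      by (auto simp: \<phi>_def split: prod.splits)
    thus "a = b"
      using inj_onD[OF bij_betw_imp_inj_on[OF bij_betw_block_index[OF U_finite, of "mdim G"]]] ab by blast
  qed
  have bij: "bij_betw \<phi> R ?act" unfolding bij_betw_def using img inj_on_subset[OF inj R] by simp
  have pick: "bij_betw (pick R) {..<card R} R" by (rule bij_betw_pick[OF finR])
  have bij2: "bij_betw (\<lambda>k. \<phi> (pick R k)) {..<card R} ?act"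
    using bij_betw_trans[OF pick bij] by (simp add: comp_def)
  define v where "v = vec (card R) (\<lambda>k. \<mu> (\<phi> (pick R k)))"
  have v: "v \<in> carrier_vec (card R)" by (simp add: v_def)
  have zero: "transpose_mat ?A *\<^sub>v v = 0\<^sub>v ?n"
  proof (rule eq_vecI)
    fix c assume "c < dim_vec (0\<^sub>v ?n)"
    hence c: "c < ?n" by simp
    let ?b = "block_index (rdim G) U ! c"
    have b: "?b \<in> primal_idx G U"
      unfolding primal_idx_def using bij_betw_apply[OF bij_betw_block_index[OF U_finite, of "rdim G"], of c] c by simp
    have ent: "?A $$ (k, c) = hk G (\<phi> (pick R k)) ?b" if k: "k < card R" for k
    proof -
      have pk: "pick R k < block_dim (mdim G) U" using bij_betw_apply[OF pick, of k] k R by auto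
      have "?A $$ (k, c) = Amat G U $$ (pick R k, pick UNIV c)"
        using k c mat_carriers(2) Req by (intro submatrix_index) auto
      also have "\<dots> = entry (Ablk G) (block_index (mdim G) U ! pick R k) ?b"
        unfolding pick_UNIV Amat_def by (rule block_mat_index[OF pk c])
      also have "\<dots> = hk G (\<phi> (pick R k)) ?b"
      proof -
        obtain i s j t where ij: "block_index (mdim G) U ! pick R k = (i, s)" "?b = (j, t)" by fastforce
        have "(i, s) \<in> idx (mdim G) U"
          using bij_betw_apply[OF bij_betw_block_index[OF U_finite, of "mdim G"], of "pick R k"] pk ij by simp
        moreover have "(j, t) \<in> idx (rdim G) U" using b ij by (simp add: primal_idx_def)
        ultimately show ?thesis using hk_cases[OF valid node node, of i j "rdim G i + s" t]
          by (simp add: \<phi>_def ij entry_def ndim_def)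
      qed
      finally show ?thesis .
    qed
    have "(transpose_mat ?A *\<^sub>v v) $ c = (\<Sum>k<card R. ?A $$ (k, c) * v $ k)"
      using A c v by (simp add: scalar_prod_def lessThan_atLeast0)
    also have "\<dots> = (\<Sum>k<card R. \<mu> (\<phi> (pick R k)) * hk G (\<phi> (pick R k)) ?b)"
      using ent by (intro sum.cong) (auto simp: v_def)
    also have "\<dots> = (\<Sum>a\<in>?act. \<mu> a * hk G a ?b)" by (rule sum.reindex_bij_betw[OF bij2])
    also have "\<dots> = 0" using \<mu> b by blast
    finally show "(transpose_mat ?A *\<^sub>v v) $ c = 0\<^sub>v ?n $ c" using c by simp
  qed (use A in auto)
  \<comment> \<open>Independence is stated for a set of rows, in which repeated rows would collapse;
    distinctness excludes that. Together they force \<open>v\<close>, the list of the coefficients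
    \<open>\<mu>\<close> on active rows, to vanish.\<close>
  have "distinct (cols (transpose_mat ?A))"
    "\<not> module.lin_dep class_ring (module_vec TYPE(real) ?n) (set (cols (transpose_mat ?A)))"
    using L by (auto simp: LICQ_def Let_def R_def)
  hence "v = 0\<^sub>v (card R)"
    using vec_space.lin_depI[of "transpose_mat ?A" ?n "card R" v] A v zero by (metis transpose_carrier_mat)
  hence "\<mu> (\<phi> (pick R k)) = 0" if "k < card R" for k
    using that by (metis index_vec index_zero_vec(1) v_def)
  thus "\<forall>a\<in>?act. \<mu> a = 0"
    unfolding bij_betw_imp_surj_on[OF bij2, symmetric] by auto
qed

end


section \<open>Invertible kernel matrices\<close>

lemma kernel_mat_invertible_inj:
  assumes e: "bij_betw e {..<n} S" and inv: "invertible_mat (kernel_mat n e h)"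
    and w: "\<And>a. a \<in> S \<Longrightarrow> kernel_app h S w a = 0" and a: "a \<in> S"
  shows "w a = 0"
proof -
  let ?M = "kernel_mat n e h" and ?v = "vec n (\<lambda>k. w (e k))"
  have M: "?M \<in> carrier_mat n n" by (simp add: kernel_mat_def)
  obtain N where N: "N * ?M = 1\<^sub>m (dim_row N)" "?M * N = 1\<^sub>m n"
    using inv M by (auto simp: invertible_mat_def inverts_mat_def)
  have dims: "dim_col N = n" "dim_row N = n"
    using arg_cong[OF N(2), of dim_col] arg_cong[OF N(1), of dim_col] M by auto
  hence Nc: "N \<in> carrier_mat n n" by auto
  have "kernel_app h S w (e k) = 0" if "k < n" for k
    using w bij_betw_apply[OF e, of k] that by simp
  hence "?M *\<^sub>v ?v = 0\<^sub>v n" unfolding kernel_mat_mult_vec[OF e] by (intro eq_vecI) auto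
  moreover have "N *\<^sub>v (?M *\<^sub>v ?v) = ?v"
    using assoc_mult_mat_vec[OF Nc M, of ?v] N(1) dims by simp
  moreover have "N *\<^sub>v 0\<^sub>v n = 0\<^sub>v n" using Nc by (intro eq_vecI) auto
  ultimately have "?v = 0\<^sub>v n" by simp
  obtain k where k: "k < n" "e k = a" using e a unfolding bij_betw_def by blast
  thus ?thesis using arg_cong[OF \<open>?v = 0\<^sub>v n\<close>, of "\<lambda>v. v $ k"] by simp
qed

lemma kernel_mat_invertible_surj:
  assumes e: "bij_betw e {..<n} S" and inv: "invertible_mat (kernel_mat n e h)"
  shows "\<exists>w. \<forall>a\<in>S. kernel_app h S w a = g a"
proof -
  let ?M = "kernel_mat n e h" and ?g = "vec n (\<lambda>k. g (e k))"
  have M: "?M \<in> carrier_mat n n" by (simp add: kernel_mat_def)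
  obtain N where N: "N * ?M = 1\<^sub>m (dim_row N)" "?M * N = 1\<^sub>m n"
    using inv M by (auto simp: invertible_mat_def inverts_mat_def)
  have dims: "dim_col N = n" "dim_row N = n"
    using arg_cong[OF N(2), of dim_col] arg_cong[OF N(1), of dim_col] M by auto
  hence Nc: "N \<in> carrier_mat n n" by auto
  define w where "w a = (N *\<^sub>v ?g) $ inv_into {..<n} e a" for a
  have "w (e k) = (N *\<^sub>v ?g) $ k" if "k < n" for k
    using that inv_into_f_f[OF bij_betw_imp_inj_on[OF e]] by (simp add: w_def)
  hence "vec n (\<lambda>k. w (e k)) = N *\<^sub>v ?g" using Nc by (intro eq_vecI) auto
  hence "vec n (\<lambda>k. kernel_app h S w (e k)) = ?M *\<^sub>v (N *\<^sub>v ?g)"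
    using kernel_mat_mult_vec[OF e, of h w] by simp
  also have "\<dots> = ?g" using assoc_mult_mat_vec[OF M Nc, of ?g] N(2) by simp
  finally have eq: "vec n (\<lambda>k. kernel_app h S w (e k)) = ?g" .
  have "kernel_app h S w a = g a" if "a \<in> S" for a
  proof -
    obtain k where k: "k < n" "e k = a" using e \<open>a \<in> S\<close> unfolding bij_betw_def by blast
    thus ?thesis using arg_cong[OF eq, of "\<lambda>v. v $ k"] by simp
  qed
  thus ?thesis by blast
qed

text \<open>A zero determinant would give a nonzero null vector, whose transport along
  \<open>e\<close> contradicts injectivity on \<open>S\<close>.\<close>

lemma kernel_mat_invertibleI:
  assumes e: "bij_betw e {..<n} S"
    and inj: "\<And>w. (\<And>a. a \<in> S \<Longrightarrow> kernel_app h S w a = 0) \<Longrightarrow> \<forall>a\<in>S. w a = 0"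
  shows "invertible_mat (kernel_mat n e h)"
proof -
  let ?M = "kernel_mat n e h"
  have M: "?M \<in> carrier_mat n n" by (simp add: kernel_mat_def)
  have "det ?M \<noteq> 0"
  proof
    assume "det ?M = 0"
    then obtain v where v: "v \<in> carrier_vec n" "v \<noteq> 0\<^sub>v n" "?M *\<^sub>v v = 0\<^sub>v n"
      using det_0_iff_vec_prod_zero_field[OF M] by auto
    define w where "w a = v $ inv_into {..<n} e a" for a
    have we: "w (e k) = v $ k" if "k < n" for k
      using that inv_into_f_f[OF bij_betw_imp_inj_on[OF e]] by (simp add: w_def)
    hence "vec n (\<lambda>k. w (e k)) = v" using v by (intro eq_vecI) auto
    hence eq: "vec n (\<lambda>k. kernel_app h S w (e k)) = 0\<^sub>v n"
      using kernel_mat_mult_vec[OF e, of h w] v(3) by simp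
    have "kernel_app h S w a = 0" if "a \<in> S" for a
    proof -
      obtain k where k: "k < n" "e k = a" using e \<open>a \<in> S\<close> unfolding bij_betw_def by blast
      thus ?thesis using arg_cong[OF eq, of "\<lambda>v. v $ k"] by simp
    qed
    hence "\<forall>a\<in>S. w a = 0" by (rule inj)
    hence "v $ k = 0" if "k < n" for k using we[OF that] bij_betw_apply[OF e, of k] that by simp
    hence "v = 0\<^sub>v n" using v(1) by (intro eq_vecI) auto
    thus False using v(2) by simp
  qed
  from det_non_zero_imp_unit[OF M this, of "()"] obtain N where "N \<in> carrier_mat n n" "N * ?M = 1\<^sub>m n" "?M * N = 1\<^sub>m n"
    by (auto simp: Units_def ring_mat_def)
  thus ?thesis using M by (auto simp: invertible_mat_def inverts_mat_def)
qed

section \<open>Bases and basic solutions\<close>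

context qp_nodes
begin

definition basis_enum :: "nat set \<Rightarrow> nat \<Rightarrow> int \<times> nat" where
  "basis_enum B k = block_index (ndim G) U ! pick B k"

definition basis_idx :: "nat set \<Rightarrow> (int \<times> nat) set" where
  "basis_idx B = (\<lambda>a. block_index (ndim G) U ! a) ` B"

lemma bij_betw_basis_enum:
  assumes "B \<subseteq> {0..<nU G U}"
  shows "bij_betw (basis_enum B) {..<card B} (basis_idx B)"
proof -
  have "finite B" using assms finite_subset by blast
  from bij_betw_pick[OF this] have 1: "bij_betw (pick B) {..<card B} B" .
  have "inj_on (\<lambda>a. block_index (ndim G) U ! a) B"
    using inj_on_subset[OF bij_betw_imp_inj_on[OF bij_betw_block_index[OF U_finite, of "ndim G"]], of B] assms
    by (simp add: nU_def lessThan_atLeast0)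
  hence "bij_betw (\<lambda>a. block_index (ndim G) U ! a) B (basis_idx B)" by (simp add: bij_betw_def basis_idx_def)
  from bij_betw_trans[OF 1 this] show ?thesis by (simp add: basis_enum_def[abs_def] comp_def)
qed

lemma basis_idx_subset: "B \<subseteq> {0..<nU G U} \<Longrightarrow> basis_idx B \<subseteq> all_idx G U"
  unfolding basis_idx_def nU_def using bij_betw_apply[OF bij_betw_block_index[OF U_finite, of "ndim G"]]
  by (intro image_subsetI) (simp add: subset_iff)

lemma submatrix_Hmat:
  assumes B: "B \<subseteq> {0..<nU G U}"
  shows "submatrix (Hmat G U) B B = kernel_mat (card B) (basis_enum B) (hk G)"
proof -
  have eq: "{i. i < nU G U \<and> i \<in> B} = B" using B by auto
  have dims: "dim_row (Hmat G U) = nU G U" "dim_col (Hmat G U) = nU G U" using mat_carriers(5) by auto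
  have pick: "pick B k < block_dim (ndim G) U" if "k < card B" for k
    using pick_in_set[of k B] that B by (auto simp: nU_def)
  show ?thesis
  proof (rule eq_matI)
    fix i j assume "i < dim_row (kernel_mat (card B) (basis_enum B) (hk G))" "j < dim_col (kernel_mat (card B) (basis_enum B) (hk G))"
    hence ij: "i < card B" "j < card B" by (auto simp: kernel_mat_def)
    have "submatrix (Hmat G U) B B $$ (i, j) = Hmat G U $$ (pick B i, pick B j)"
      using ij by (intro submatrix_index) (simp_all add: dims eq)
    also have "\<dots> = hk G (basis_enum B i) (basis_enum B j)"
      unfolding Hmat_def hk_def basis_enum_def by (rule block_mat_index[OF pick[OF ij(1)] pick[OF ij(2)]])
    finally show "submatrix (Hmat G U) B B $$ (i, j) = kernel_mat (card B) (basis_enum B) (hk G) $$ (i, j)"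
      using ij by (simp add: kernel_mat_def)
  qed (simp_all add: dim_submatrix dims eq kernel_mat_def)
qed

lemma subvec_basis_enum:
  assumes B: "B \<subseteq> {0..<nU G U}" and v: "v \<in> carrier_vec (nU G U)"
  shows "subvec v B = vec (card B) (\<lambda>k. zf G U v (basis_enum B k))"
proof -
  have eq: "{i. i < nU G U \<and> i \<in> B} = B" using B by auto
  have "zf G U v (basis_enum B k) = v $ pick B k" if "k < card B" for k
    unfolding basis_enum_def using pick_in_set[of k B] that B
    by (intro bfun_block_index[OF U_finite]) (auto simp: nU_def)
  thus ?thesis using v by (intro eq_vecI) (auto simp: subvec_def eq)
qed

lemma basic_system_iff:
  assumes B: "B \<subseteq> {0..<nU G U}" and d: "d \<in> carrier_vec (nU G U)" and z: "z \<in> carrier_vec (nU G U)"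
  shows "submatrix (Hmat G U) B B *\<^sub>v subvec z B = subvec d B \<longleftrightarrow>
    (\<forall>a\<in>basis_idx B. kernel_app (hk G) (basis_idx B) (zf G U z) a = zf G U d a)"
proof -
  note e = bij_betw_basis_enum[OF B]
  have "submatrix (Hmat G U) B B *\<^sub>v subvec z B = subvec d B \<longleftrightarrow>
      (\<forall>k<card B. kernel_app (hk G) (basis_idx B) (zf G U z) (basis_enum B k) = zf G U d (basis_enum B k))"
    unfolding submatrix_Hmat[OF B] subvec_basis_enum[OF B z] subvec_basis_enum[OF B d] kernel_mat_mult_vec[OF e]
    by (auto simp: vec_eq_iff)
  moreover have "(\<forall>a\<in>basis_idx B. P a) \<longleftrightarrow> (\<forall>k<card B. P (basis_enum B k))" for P
    unfolding bij_betw_imp_surj_on[OF e, symmetric] by auto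
  ultimately show ?thesis by simp
qed

lemma zero_outside_iff:
  assumes B: "B \<subseteq> {0..<nU G U}"
  shows "(\<forall>a<nU G U. a \<notin> B \<longrightarrow> z $ a = 0) \<longleftrightarrow> (\<forall>a\<in>all_idx G U - basis_idx B. zf G U z a = 0)"
proof -
  note bij = bij_betw_block_index[OF U_finite, of "ndim G"]
  have "block_index (ndim G) U ! a \<in> basis_idx B \<longleftrightarrow> a \<in> B" if "a < block_dim (ndim G) U" for a
    using that B inj_onD[OF bij_betw_imp_inj_on[OF bij], of a] unfolding basis_idx_def by (auto simp: nU_def subset_iff)
  hence "(\<forall>a<nU G U. a \<notin> B \<longrightarrow> z $ a = 0) \<longleftrightarrow>
      (\<forall>a<block_dim (ndim G) U. block_index (ndim G) U ! a \<notin> basis_idx B \<longrightarrow> z $ a = 0)"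
    by (auto simp: nU_def)
  also have "\<dots> \<longleftrightarrow> (\<forall>b\<in>all_idx G U. b \<notin> basis_idx B \<longrightarrow> zf G U z b = 0)"
    by (rule bfun_all_iff[OF U_finite, of "ndim G" "\<lambda>b v. b \<notin> basis_idx B \<longrightarrow> v = 0"])
  finally show ?thesis by auto
qed

text \<open>The property that \<open>basic_solution\<close> selects by \<open>THE\<close>, restated
  on index pairs. For a basis it has exactly one solution, which legitimates the
  description.\<close>

definition basic :: "real vec \<Rightarrow> nat set \<Rightarrow> real vec \<Rightarrow> bool" where
  "basic d B z \<longleftrightarrow> z \<in> carrier_vec (nU G U) \<and>
     (\<forall>a\<in>basis_idx B. kernel_app (hk G) (basis_idx B) (zf G U z) a = zf G U d a) \<and>
     (\<forall>a\<in>all_idx G U - basis_idx B. zf G U z a = 0)"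

lemma is_basis_kernel_mat:
  assumes "is_basis G U B"
  shows "B \<subseteq> {0..<nU G U}" "invertible_mat (kernel_mat (card B) (basis_enum B) (hk G))"
  using assms submatrix_Hmat[of B] by (auto simp: is_basis_def)

lemma basis_inj:
  assumes B: "is_basis G U B" and w: "\<And>a. a \<in> basis_idx B \<Longrightarrow> kernel_app (hk G) (basis_idx B) w a = 0"
  shows "\<forall>a\<in>basis_idx B. w a = 0"
  using kernel_mat_invertible_inj[OF bij_betw_basis_enum is_basis_kernel_mat(2)[OF B] w]
    is_basis_kernel_mat(1)[OF B] by blast

lemma basis_surj:
  assumes B: "is_basis G U B"
  shows "\<exists>w. \<forall>a\<in>basis_idx B. kernel_app (hk G) (basis_idx B) w a = g a"
  by (rule kernel_mat_invertible_surj[OF bij_betw_basis_enum is_basis_kernel_mat(2)[OF B]])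
    (rule is_basis_kernel_mat(1)[OF B])

lemma basic_unique:
  assumes B: "is_basis G U B" and z: "basic d B z" "basic d B z'"
  shows "z = z'"
proof (rule bfun_eqI[OF U_finite])
  show "z \<in> carrier_vec (block_dim (ndim G) U)" "z' \<in> carrier_vec (block_dim (ndim G) U)"
    using z by (auto simp: basic_def nU_def)
  have "\<forall>a\<in>basis_idx B. zf G U z a - zf G U z' a = 0"
    using z by (intro basis_inj[OF B]) (simp add: kernel_app_diff basic_def)
  thus "zf G U z b = zf G U z' b" if "b \<in> all_idx G U" for b
    using z that by (cases "b \<in> basis_idx B") (auto simp: basic_def)
qed

lemma basic_exists:
  assumes B: "is_basis G U B"
  shows "\<exists>z. basic d B z"
proof -
  obtain w where w: "\<forall>a\<in>basis_idx B. kernel_app (hk G) (basis_idx B) w a = zf G U d a"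
    using basis_surj[OF B, of "zf G U d"] by blast
  let ?w = "\<lambda>a. if a \<in> basis_idx B then w a else 0"
  let ?z = "vec (block_dim (ndim G) U) (\<lambda>a. ?w (block_index (ndim G) U ! a))"
  have sub: "basis_idx B \<subseteq> all_idx G U" using B basis_idx_subset by (simp add: is_basis_def)
  have zw: "zf G U ?z a = ?w a" if "a \<in> all_idx G U" for a by (rule bfun_vec[OF U_finite that])
  have "kernel_app (hk G) (basis_idx B) (zf G U ?z) a = kernel_app (hk G) (basis_idx B) w a" for a
    using zw sub by (intro kernel_app_cong) auto
  hence "basic d B ?z" using w zw by (simp add: basic_def nU_def)
  thus ?thesis by blast
qed

lemma basic_solution_basic:
  assumes B: "is_basis G U B" and d: "d \<in> carrier_vec (nU G U)"
  shows "basic d B (basic_solution G U d B)" and "basic d B z \<Longrightarrow> basic_solution G U d B = z"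
proof -
  have BU: "B \<subseteq> {0..<nU G U}" using B by (simp add: is_basis_def)
  have "(z \<in> carrier_vec (nU G U) \<and> submatrix (Hmat G U) B B *\<^sub>v subvec z B = subvec d B \<and>
      (\<forall>a<nU G U. a \<notin> B \<longrightarrow> z $ a = 0)) = basic d B z" for z
    unfolding basic_def zero_outside_iff[OF BU] using basic_system_iff[OF BU d] by blast
  hence "basic_solution G U d B = (THE z. basic d B z)" by (simp only: basic_solution_def)
  moreover have "\<exists>!z. basic d B z" using basic_exists[OF B] basic_unique[OF B] by blast
  ultimately show "basic d B (basic_solution G U d B)" "basic d B z \<Longrightarrow> basic_solution G U d B = z"
    by (simp only: theI', simp only: the1_equality)
qed

text \<open>Weakly active rows enter the basis as well, with a zero multiplier: LICQ covers them,
  and SOSC is applied only to directions annihilated by all active rows.\<close>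

lemma regular_optimal_basis:
  assumes U: "U \<noteq> {}" and d: "d \<in> carrier_vec (nU G U)"
    and pd: "pd_solution G U d z" and sosc: "SOSC G U d z" and licq: "LICQ G U d z"
  shows "\<exists>B. optimal_basis G U d B"
proof -
  let ?A = "active (zf G U d) (zf G U z)"
  let ?\<beta> = "\<lambda>a. block_index (ndim G) U ! a"
  define B where "B = {a. a < nU G U \<and> ?\<beta> a \<in> primal_idx G U \<union> ?A}"
  have BU: "B \<subseteq> {0..<nU G U}" by (auto simp: B_def)
  have sub: "primal_idx G U \<union> ?A \<subseteq> all_idx G U" using active_sub all_idx_split by auto
  have bi: "basis_idx B = primal_idx G U \<union> ?A"
  proof -
    have "?\<beta> ` {..<nU G U} = all_idx G U"
      using bij_betw_imp_surj_on[OF bij_betw_block_index[OF U_finite, of "ndim G"]] by (simp add: nU_def)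
    moreover have "f ` {a. a < n \<and> f a \<in> T} = f ` {..<n} \<inter> T" for f :: "nat \<Rightarrow> int \<times> nat" and n T by auto
    ultimately have "basis_idx B = all_idx G U \<inter> (primal_idx G U \<union> ?A)" unfolding basis_idx_def B_def by (simp only:)
    thus ?thesis using sub by blast
  qed
  note sol = mcp_solution_active_basis
  have mcp: "mcp_solution (hk G) (all_idx G U) (ineq_idx G U) (zf G U d) (zf G U z)" and zc: "z \<in> carrier_vec (nU G U)"
    using pd unfolding pd_solution_iff by auto
  have z0: "\<forall>a\<in>all_idx G U - basis_idx B. zf G U z a = 0"
    and zd: "\<forall>a\<in>basis_idx B. kernel_app (hk G) (all_idx G U) (zf G U z) a = zf G U d a"
    using sol[OF mcp[unfolded all_idx_split]] unfolding bi all_idx_split by auto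
  have "kernel_app (hk G) (all_idx G U) (zf G U z) a = kernel_app (hk G) (basis_idx B) (zf G U z) a" for a
    using z0 sub bi U_finite by (intro kernel_app_support) auto
  hence basic: "basic d B z" using zc z0 zd by (simp add: basic_def)
  have "invertible_mat (submatrix (Hmat G U) B B)"
    unfolding submatrix_Hmat[OF BU]
  proof (rule kernel_mat_invertibleI[OF bij_betw_basis_enum[OF BU]])
    fix w assume w: "\<And>a. a \<in> basis_idx B \<Longrightarrow> kernel_app (hk G) (basis_idx B) w a = 0"
    show "\<forall>a\<in>basis_idx B. w a = 0"
      using active_basis_injective[OF sosc_of_SOSC[OF sosc] licq_of_LICQ[OF licq], of w] w unfolding bi by blast
  qed
  \<comment> \<open>A basis has to be nonempty; every node carries at least one primal
    variable.\<close>
  moreover have "B \<noteq> {}"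
  proof -
    obtain i where i: "i \<in> U" using U by auto
    hence "(i, 0) \<in> primal_idx G U"
      using valid_graph_qpD(5)[OF valid node node, of i i] by (simp add: primal_idx_def)
    thus ?thesis using bi by (auto simp: basis_idx_def)
  qed
  ultimately have isb: "is_basis G U B" using BU by (simp add: is_basis_def)
  thus ?thesis using basic_solution_basic(2)[OF isb d basic] pd by (auto simp: optimal_basis_def)
qed

lemma bases_is_basis: "B \<in> bases G D U \<Longrightarrow> is_basis G U B"
  by (auto simp: bases_def optimal_basis_def)

text \<open>Finiteness serves twice: for the extrema in \<open>sigma_low\<close> and
  \<open>sigma_high\<close>, and for the finite cover of a data segment.\<close>

lemma finite_bases: "finite (bases G D U)"
proof (rule finite_subset)
  show "bases G D U \<subseteq> Pow {0..<nU G U}" using bases_is_basis unfolding is_basis_def by blast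
qed simp

lemma is_basis_card:
  assumes "is_basis G U B"
  shows "B \<subseteq> {0..<nU G U}" "card B > 0"
proof -
  show "B \<subseteq> {0..<nU G U}" using assms by (simp add: is_basis_def)
  hence "finite B" using finite_subset by blast
  thus "card B > 0" using assms by (simp add: is_basis_def card_gt_0_iff)
qed

text \<open>Zero is a common lower bound of the values in \<open>sigma_inf\<close>, without which a
  real infimum would say nothing about its members.\<close>

lemma sigma_low_nonneg:
  assumes "bases G D U \<noteq> {}"
  shows "0 \<le> sigma_low G D U"
proof -
  have "0 \<le> sigma_min (submatrix (Hmat G U) B B)" if "B \<in> bases G D U" for B
  proof -
    note c = is_basis_card[OF bases_is_basis[OF that]]
    show ?thesis unfolding submatrix_Hmat[OF c(1)]
      by (rule sigma_min_nonneg[of _ "card B"]) (use c(2) in \<open>auto simp: kernel_mat_def\<close>)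
  qed
  thus ?thesis unfolding sigma_low_def using finite_bases assms by (intro Min.boundedI) auto
qed

end

lemma sigma_bounds:
  assumes g: "valid_graph_qp G" and U: "U \<in> based_sets G D" and B: "B \<in> bases G D U"
    and bdd: "bdd_above (sigma_high G D ` based_sets G D)"
  shows "sigma_inf G D \<le> sigma_min (submatrix (Hmat G U) B B)"
    and "sigma_max (submatrix (Hmat G U) B B) \<le> sigma_sup G D"
proof -
  interpret qp_nodes G U using g U by unfold_locales (auto simp: based_sets_def)
  have "bdd_below (sigma_low G D ` based_sets G D)"
  proof (rule bdd_belowI2)
    fix U' assume "U' \<in> based_sets G D"
    thus "0 \<le> sigma_low G D U'"
      using g by (intro qp_nodes.sigma_low_nonneg qp_nodes.intro) (auto simp: based_sets_def)
  qed
  hence "sigma_inf G D \<le> sigma_low G D U" unfolding sigma_inf_def using U by (intro cINF_lower)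
  also have "\<dots> \<le> sigma_min (submatrix (Hmat G U) B B)"
    unfolding sigma_low_def using finite_bases B by (intro Min_le) auto
  finally show "sigma_inf G D \<le> sigma_min (submatrix (Hmat G U) B B)" .
  have "sigma_max (submatrix (Hmat G U) B B) \<le> sigma_high G D U"
    unfolding sigma_high_def using finite_bases B by (intro Max_ge) auto
  also have "\<dots> \<le> sigma_sup G D" unfolding sigma_sup_def using U bdd by (intro cSUP_upper)
  finally show "sigma_max (submatrix (Hmat G U) B B) \<le> sigma_sup G D" .
qed

lemma sigma_inf_le_sup:
  assumes g: "valid_graph_qp G" and U: "U \<in> based_sets G D"
    and bdd: "bdd_above (sigma_high G D ` based_sets G D)"
  shows "sigma_inf G D \<le> sigma_sup G D"
proof -
  interpret qp_nodes G U using g U by unfold_locales (auto simp: based_sets_def)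
  obtain B where B: "B \<in> bases G D U" using U by (auto simp: based_sets_def)
  note c = is_basis_card[OF bases_is_basis[OF B]]
  have "sigma_min (submatrix (Hmat G U) B B) \<le> sigma_max (submatrix (Hmat G U) B B)"
    unfolding submatrix_Hmat[OF c(1)]
    by (rule sigma_min_le_max[of _ "card B"]) (use c(2) in \<open>auto simp: kernel_mat_def\<close>)
  thus ?thesis using sigma_bounds[OF g U B bdd] by linarith
qed

text \<open>\<open>\<rho> < 1\<close> is strict because \<open>sigma_inf G D\<close> is positive;
  the strictness is used in the limit that gives meaning to an infinite power of \<rho>.\<close>

lemma rate_constants:
  assumes "0 < sigma_inf G D" "sigma_inf G D \<le> sigma_sup G D"
  shows "0 \<le> rho_const G D" "rho_const G D < 1" "0 \<le> Gamma_const G D"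
proof -
  have "(sigma_inf G D)\<^sup>2 \<le> (sigma_sup G D)\<^sup>2" "0 < (sigma_inf G D)\<^sup>2" using assms by (auto intro: power_mono)
  moreover from this have "0 < (sigma_sup G D)\<^sup>2 + (sigma_inf G D)\<^sup>2" by linarith
  ultimately show "0 \<le> rho_const G D" "rho_const G D < 1"
    by (simp_all add: rho_const_def divide_less_eq_1_pos)
  show "0 \<le> Gamma_const G D" using assms by (simp add: Gamma_const_def)
qed

section \<open>Sensitivity of solutions to the data\<close>

context qp_nodes
begin

text \<open>The second claim is uniqueness among functions rather than vectors, because it is later
  applied to the restriction of a solution on a larger node set.\<close>

lemma zstar_eq:
  assumes psd: "pos_semidef (Qmat G U)"
    and pd: "pd_solution G U d y" and sosc: "SOSC G U d y" and licq: "LICQ G U d y"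
  shows "zstar G U d = y"
    and "mcp_solution (hk G) (all_idx G U) (ineq_idx G U) (zf G U d) w \<Longrightarrow> a \<in> all_idx G U \<Longrightarrow> w a = zf G U y a"
proof -
  have mcp: "mcp_solution (hk G) (all_idx G U) (ineq_idx G U) (zf G U d) (zf G U y)"
    using pd unfolding pd_solution_iff by auto
  have uniq: "w a = zf G U y a"
    if "mcp_solution (hk G) (all_idx G U) (ineq_idx G U) (zf G U d) w" "a \<in> all_idx G U" for w a
    using mcp_solution_unique[OF quad_nonneg[OF psd] _ sosc_of_SOSC[OF sosc] licq_of_LICQ[OF licq], of w a] mcp that
    unfolding all_idx_split by blast
  thus "mcp_solution (hk G) (all_idx G U) (ineq_idx G U) (zf G U d) w \<Longrightarrow> a \<in> all_idx G U \<Longrightarrow> w a = zf G U y a" .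
  show "zstar G U d = y" unfolding zstar_def
  proof (rule the_equality[of "pd_solution G U d", OF pd])
    fix z assume z: "pd_solution G U d z"
    show "z = y"
      using z pd uniq unfolding pd_solution_iff nU_def by (intro bfun_eqI[OF U_finite]) auto
  qed
qed

text \<open>Places \<open>U\<close> among the sets over which the infimum and the supremum are
  taken, so that the uniform constants apply to its bases.\<close>

lemma regular_based:
  assumes "U \<noteq> {}" "D U \<subseteq> carrier_vec (nU G U)" "d \<in> D U"
    and "pd_solution G U d y" "SOSC G U d y" "LICQ G U d y"
  shows "U \<in> based_sets G D"
proof -
  obtain B where "optimal_basis G U d B" using regular_optimal_basis[OF assms(1) _ assms(4-6)] assms(2,3) by blast
  thus ?thesis using assms U_nodes U_finite unfolding based_sets_def bases_def by blast
qed

text \<open>Convexity keeps the segment from \<open>d0\<close> to \<open>d1\<close> in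
  \<open>D U\<close>, where every point has a regular solution and hence an optimal basis. The slope
  of each branch solves a basis system whose right-hand side \<open>e\<close> is the change of the
  data, and its decay away from \<open>L 0\<close> bounds the total change on
  \<open>I\<close>.\<close>

lemma sensitivity:
  fixes L :: "nat \<Rightarrow> (int \<times> nat) set"
  assumes U: "U \<noteq> {}" and D: "D U \<subseteq> carrier_vec (nU G U)" and convex: "convex_vecs (D U)"
    and psd: "pos_semidef (Qmat G U)"
    and regular: "\<And>d. d \<in> D U \<Longrightarrow> \<exists>y. pd_solution G U d y \<and> SOSC G U d y \<and> LICQ G U d y"
    and sigma: "sigma_inf G D > 0" "bdd_above (sigma_high G D ` based_sets G D)"
    and d: "d0 \<in> D U" "d1 \<in> D U"
    and supp: "\<And>a. a \<in> all_idx G U \<Longrightarrow> a \<notin> L 0 \<Longrightarrow> zf G U d1 a = zf G U d0 a"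
    and mono: "\<And>m. L m \<subseteq> L (Suc m)"
    and reach: "\<And>m a b. a \<in> all_idx G U \<Longrightarrow> b \<in> all_idx G U \<Longrightarrow> b \<in> L m \<Longrightarrow> hk G a b \<noteq> 0 \<Longrightarrow> a \<in> L (Suc m)"
    and I: "I \<subseteq> all_idx G U" "\<And>k a. k < N \<Longrightarrow> a \<in> I \<Longrightarrow> a \<notin> L (2 * k + 1)"
  shows "L2_set (\<lambda>a. zf G U (zstar G U d1) a - zf G U (zstar G U d0) a) I
    \<le> Gamma_const G D * rho_const G D ^ N * L2_set (\<lambda>a. zf G U d1 a - zf G U d0 a) (all_idx G U)"
proof -
  define e where "e a = zf G U d1 a - zf G U d0 a" for a
  define dd where "dd t = (1 - t) \<cdot>\<^sub>v d0 + t \<cdot>\<^sub>v d1" for t :: real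
  define z where "z t = zf G U (zstar G U (dd t))" for t
  let ?C = "Gamma_const G D * rho_const G D ^ N * L2_set e (all_idx G U)"
  have fin: "finite (all_idx G U)" using U_finite by simp
  have dc: "d0 \<in> carrier_vec (nU G U)" "d1 \<in> carrier_vec (nU G U)" using d D by auto
  have ddD: "dd t \<in> D U" if "0 \<le> t" "t \<le> 1" for t
    using convex d that unfolding convex_vecs_def dd_def by blast
  have ddf: "zf G U (dd t) a = zf G U d0 a + t * e a" if a: "a \<in> all_idx G U" for t a
  proof -
    obtain k where "k < block_dim (ndim G) U" "\<And>v. zf G U v a = v $ k" using bfun_index[OF U_finite a] by blast
    thus ?thesis using dc by (simp add: dd_def e_def nU_def algebra_simps)
  qed
  have mcpdd: "mcp_solution (hk G) (all_idx G U) (ineq_idx G U) (zf G U (dd t)) w \<longleftrightarrow>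
      mcp_solution (hk G) (all_idx G U) (ineq_idx G U) (\<lambda>a. zf G U d0 a + t * e a) w" for t w
    using ddf J_sub all_idx_split by (intro mcp_solution_cong) auto
  have based: "U \<in> based_sets G D"
    using regular[OF d(1)] regular_based[of D d0, OF U D d(1)] by blast
  have "L2_set (\<lambda>a. z 1 a - z 0 a) I \<le> ?C"
  proof (rule mcp_path_lipschitz[where \<B> = "basis_idx ` bases G D U" and J = "ineq_idx G U" and S = "all_idx G U"
        and h = "hk G" and d = "zf G U d0" and e = e])
    show "ineq_idx G U \<subseteq> all_idx G U" using J_sub all_idx_split by auto
    show "finite (basis_idx ` bases G D U)" using finite_bases by simp
  next
    fix t :: real and y assume t: "0 \<le> t" "t \<le> 1"
      and y: "mcp_solution (hk G) (all_idx G U) (ineq_idx G U) (\<lambda>a. zf G U d0 a + t * e a) y"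
    obtain s where s: "pd_solution G U (dd t) s" "SOSC G U (dd t) s" "LICQ G U (dd t) s"
      using regular[OF ddD[OF t]] by blast
    show "\<forall>a\<in>all_idx G U. y a = z t a"
      using zstar_eq[OF psd s] y unfolding z_def mcpdd[symmetric] by simp
  next
    fix t :: real assume t: "0 \<le> t" "t \<le> 1"
    obtain s where s: "pd_solution G U (dd t) s" "SOSC G U (dd t) s" "LICQ G U (dd t) s"
      using regular[OF ddD[OF t]] by blast
    have ddc: "dd t \<in> carrier_vec (nU G U)" using ddD[OF t] D by auto
    obtain B where B: "optimal_basis G U (dd t) B" using regular_optimal_basis[OF U ddc s] by blast
    have isb: "is_basis G U B" and pd: "pd_solution G U (dd t) (basic_solution G U (dd t) B)"
      using B by (auto simp: optimal_basis_def)
    let ?z = "basic_solution G U (dd t) B"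
    have bas: "basic (dd t) B ?z" by (rule basic_solution_basic(1)[OF isb ddc])
    have zs: "zstar G U (dd t) = s" by (rule zstar_eq(1)[OF psd s])
    \<comment> \<open>Whichever optimal basis was obtained, uniqueness identifies its basic solution
      with the regular one.\<close>
    have "?z = s"
      using pd s(1) zstar_eq(2)[OF psd s] unfolding pd_solution_iff nU_def by (intro bfun_eqI[OF U_finite]) auto
    hence zt: "z t = zf G U ?z" by (simp add: z_def zs)
    have sub: "basis_idx B \<subseteq> all_idx G U" using basis_idx_subset is_basis_card(1)[OF isb] by blast
    have "B \<in> bases G D U" using B ddD[OF t] by (auto simp: bases_def)
    moreover have "\<forall>a\<in>basis_idx B. kernel_app (hk G) (basis_idx B) (z t) a = zf G U d0 a + t * e a"
      using bas ddf sub by (auto simp: basic_def zt subset_iff)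
    moreover have "mcp_solution (hk G) (all_idx G U) (ineq_idx G U) (\<lambda>a. zf G U d0 a + t * e a) (z t)"
      using pd unfolding pd_solution_iff mcpdd[symmetric] zt by blast
    moreover have "\<forall>a\<in>all_idx G U - basis_idx B. z t a = 0" using bas by (simp add: basic_def zt)
    ultimately show "\<exists>B\<in>basis_idx ` bases G D U. (\<forall>a\<in>all_idx G U - B. z t a = 0) \<and>
        (\<forall>a\<in>B. kernel_app (hk G) B (z t) a = zf G U d0 a + t * e a) \<and>
        mcp_solution (hk G) (all_idx G U) (ineq_idx G U) (\<lambda>a. zf G U d0 a + t * e a) (z t)" by blast
  next
    fix B' w assume "B' \<in> basis_idx ` bases G D U" and w: "\<And>a. a \<in> B' \<Longrightarrow> kernel_app (hk G) B' w a = e a"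
    then obtain B where B: "B \<in> bases G D U" "B' = basis_idx B" by blast
    note c = is_basis_card[OF bases_is_basis[OF B(1)]]
    have sub: "B' \<subseteq> all_idx G U" using basis_idx_subset[OF c(1)] B by simp
    have finB: "finite B'" using sub fin finite_subset by blast
    have sym': "hk G a b = hk G b a" if "a \<in> B'" "b \<in> B'" for a b
      using hk_sym[OF valid U_nodes] that sub by blast
    have s: "sigma_inf G D \<le> sigma_min (kernel_mat (card B) (basis_enum B) (hk G))"
      "sigma_max (kernel_mat (card B) (basis_enum B) (hk G)) \<le> sigma_sup G D"
      using sigma_bounds[OF valid based B(1) sigma(2)] unfolding submatrix_Hmat[OF c(1)] by auto
    have e': "bij_betw (basis_enum B) {..<card B} B'" using bij_betw_basis_enum[OF c(1)] B by simp
    note spec = kernel_spectral_bounds[OF e' c(2) sym' sigma(1) s]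
    have lohi: "sigma_inf G D \<le> sigma_sup G D" using spec(3) .
    note rate = rate_constants[OF sigma(1) lohi]
    have "L2_set w (I \<inter> B') \<le> sigma_sup G D / (sigma_inf G D)\<^sup>2 *
        (((sigma_sup G D)\<^sup>2 - (sigma_inf G D)\<^sup>2) / ((sigma_sup G D)\<^sup>2 + (sigma_inf G D)\<^sup>2)) ^ N * L2_set e B'"
    proof (rule kernel_solution_decay[where L = L, OF finB sigma(1) lohi spec(1,2) w])
      show "e a = 0" if "a \<in> B'" "a \<notin> L 0" for a using supp[OF subsetD[OF sub that(1)] that(2)] by (simp add: e_def)
      show "a \<in> L (Suc m)" if "a \<in> B'" "b \<in> B'" "b \<in> L m" "hk G a b \<noteq> 0" for m a b
        using that sub by (intro reach[of a b m]) auto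
    qed (use mono I in auto)
    also have "\<dots> = Gamma_const G D * rho_const G D ^ N * L2_set e B'"
      by (simp add: Gamma_const_def rho_const_def)
    \<comment> \<open>Enlarging \<open>B'\<close> to all indices makes the bound independent of the
      basis.\<close>
    also have "\<dots> \<le> ?C"
      using rate fin sub unfolding L2_set_def
      by (intro mult_left_mono real_sqrt_le_mono sum_mono2) auto
    finally show "L2_set w (I \<inter> B') \<le> ?C" .
  next
    show "finite (all_idx G U)" by (rule fin)
    show "I \<subseteq> all_idx G U" by (rule I)
    fix B' assume "B' \<in> basis_idx ` bases G D U"
    then obtain B where B: "is_basis G U B" "B' = basis_idx B" using bases_is_basis by blast
    show "B' \<subseteq> all_idx G U" using basis_idx_subset[OF is_basis_card(1)[OF B(1)]] B by simp
    show "\<exists>w. \<forall>a\<in>B'. kernel_app (hk G) B' w a = g a" for g using basis_surj[OF B(1), of g] B by simp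
    show "\<forall>a\<in>B'. w a = 0" if "\<And>a. a \<in> B' \<Longrightarrow> kernel_app (hk G) B' w a = 0" for w
      using basis_inj[OF B(1), of w] that B by simp
  qed
  moreover have "dd 0 = d0" "dd 1 = d1" using dc by (auto simp: dd_def)
  ultimately show ?thesis by (simp add: z_def e_def[abs_def])
qed

end


section \<open>Contraction of the Schwarz iteration\<close>

text \<open>A crude bound that makes the supremum in \<open>mnorm\<close> finite; it also covers
  vectors of norm zero, which cannot be normalised.\<close>

lemma vnorm_mult_le_rows:
  assumes "v \<in> carrier_vec (dim_col M)"
  shows "vnorm (M *\<^sub>v v) \<le> (\<Sum>i<dim_row M. vnorm (row M i)) * vnorm v"
proof -
  have "vnorm (M *\<^sub>v v) \<le> (\<Sum>i<dim_row M. \<bar>(M *\<^sub>v v) $ i\<bar>)"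
    unfolding vnorm_eq_L2_set dim_mult_mat_vec by (rule L2_set_le_sum_abs)
  also have "\<dots> \<le> (\<Sum>i<dim_row M. vnorm (row M i) * vnorm v)"
  proof (rule sum_mono)
    fix i assume "i \<in> {..<dim_row M}"
    hence "(M *\<^sub>v v) $ i = row M i \<bullet> v" by simp
    moreover have "row M i \<bullet> v \<le> vnorm (row M i) * vnorm v"
      using assms by (intro scalar_prod_le_vnorm) simp
    moreover have "row M i \<bullet> (- 1 \<cdot>\<^sub>v v) \<le> vnorm (row M i) * vnorm (- 1 \<cdot>\<^sub>v v)"
      using assms by (intro scalar_prod_le_vnorm) simp
    moreover have "row M i \<bullet> (- 1 \<cdot>\<^sub>v v) = - (row M i \<bullet> v)"
      using assms by (subst scalar_prod_smult_distrib[of _ "dim_col M"]) auto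
    ultimately show "\<bar>(M *\<^sub>v v) $ i\<bar> \<le> vnorm (row M i) * vnorm v"
      by (simp add: vnorm_smult abs_le_iff)
  qed
  finally show ?thesis by (simp add: sum_distrib_right)
qed

lemma mnorm_bdd: "bdd_above ((\<lambda>v. vnorm (M *\<^sub>v v)) ` {v \<in> carrier_vec (dim_col M). vnorm v \<le> 1})"
proof (rule bdd_aboveI2)
  fix v assume v: "v \<in> {v \<in> carrier_vec (dim_col M). vnorm v \<le> 1}"
  have "vnorm (M *\<^sub>v v) \<le> (\<Sum>i<dim_row M. vnorm (row M i)) * vnorm v"
    using v by (intro vnorm_mult_le_rows) auto
  also have "\<dots> \<le> (\<Sum>i<dim_row M. vnorm (row M i)) * 1"
    using v by (intro mult_left_mono sum_nonneg) auto
  finally show "vnorm (M *\<^sub>v v) \<le> (\<Sum>i<dim_row M. vnorm (row M i)) * 1" .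
qed

lemma mnorm_nonneg: "0 \<le> mnorm M"
proof -
  have "0\<^sub>v (dim_col M) \<in> {v \<in> carrier_vec (dim_col M). vnorm v \<le> 1}"
    by (simp add: vnorm_def)
  from cSUP_upper[OF this mnorm_bdd[of M]] vnorm_nonneg[of "M *\<^sub>v 0\<^sub>v (dim_col M)"]
  show ?thesis unfolding mnorm_def by linarith
qed

lemma vnorm_mult_le:
  assumes v: "v \<in> carrier_vec (dim_col M)"
  shows "vnorm (M *\<^sub>v v) \<le> mnorm M * vnorm v"
proof (cases "vnorm v = 0")
  case True
  thus ?thesis using vnorm_mult_le_rows[OF v] by simp
next
  case False
  hence pos: "vnorm v > 0" using vnorm_nonneg[of v] by linarith
  let ?u = "(1 / vnorm v) \<cdot>\<^sub>v v"
  have "?u \<in> {v \<in> carrier_vec (dim_col M). vnorm v \<le> 1}" using v pos by (simp add: vnorm_smult)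
  from cSUP_upper[OF this mnorm_bdd] have "vnorm (M *\<^sub>v ?u) \<le> mnorm M" by (simp add: mnorm_def)
  moreover have "M *\<^sub>v ?u = (1 / vnorm v) \<cdot>\<^sub>v (M *\<^sub>v v)"
    using v by (intro mult_mat_vec[of M "dim_row M" "dim_col M"]) auto
  ultimately have "vnorm (M *\<^sub>v v) / vnorm v \<le> mnorm M" using pos by (simp add: vnorm_smult)
  thus ?thesis using pos by (simp add: pos_divide_le_eq)
qed

lemma L2_set_sum_le:
  "L2_set (\<lambda>a. \<Sum>j\<in>N. f j a) I \<le> (\<Sum>j\<in>N. L2_set (f j) I)"
proof (induction N rule: infinite_finite_induct)
  case (insert j N)
  have "L2_set (\<lambda>a. \<Sum>j\<in>insert j N. f j a) I = L2_set (\<lambda>a. f j a + (\<Sum>j\<in>N. f j a)) I"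
    using insert by simp
  also have "\<dots> \<le> L2_set (f j) I + L2_set (\<lambda>a. \<Sum>j\<in>N. f j a) I" by (rule L2_set_triangle_ineq)
  finally show ?case using insert by simp
qed (simp_all add: L2_set_def)

text \<open>Squares add up over disjoint blocks, and \<open>a^2 + b^2 \<le> (a + b)^2\<close> for
  nonnegative numbers. This passage from a Euclidean norm to a sum over nodes produces the outer sum
  in \<open>Hcompl_norm1\<close>.\<close>

lemma L2_set_UN_le:
  assumes "finite U"
  shows "L2_set e (SIGMA i:U. A i) \<le> (\<Sum>i\<in>U. L2_set e ({i} \<times> A i))"
  using assms
proof (induction U rule: finite_induct)
  case (insert i U)
  show ?case
  proof (cases "finite (SIGMA i:insert i U. A i)")
    case True
    have split: "(SIGMA i:insert i U. A i) = {i} \<times> A i \<union> (SIGMA i:U. A i)" by auto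
    have fin: "finite ({i} \<times> A i)" "finite (SIGMA i:U. A i)" using True unfolding split by auto
    have "(L2_set e (SIGMA i:insert i U. A i))\<^sup>2 = (L2_set e ({i} \<times> A i))\<^sup>2 + (L2_set e (SIGMA i:U. A i))\<^sup>2"
      unfolding L2_set_def split using fin insert.hyps
      by (subst sum.union_disjoint) (auto simp: sum_nonneg)
    also have "\<dots> \<le> (L2_set e ({i} \<times> A i) + L2_set e (SIGMA i:U. A i))\<^sup>2"
      by (simp add: power2_sum)
    finally have "L2_set e (SIGMA i:insert i U. A i) \<le> L2_set e ({i} \<times> A i) + L2_set e (SIGMA i:U. A i)"
      by (rule power2_le_imp_le) simp
    thus ?thesis using insert by simp
  next
    \<comment> \<open>\<open>L2_set\<close> over an infinite set is 0 by convention.\<close>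
    case False
    thus ?thesis by (simp add: sum_nonneg)
  qed
qed simp

section \<open>Extended exponents and graph distances\<close>

lemma ceil_half_le:
  assumes "e \<le> enat (2 * k)"
  shows "ceil_half e \<le> enat k"
proof -
  obtain m where m: "e = enat m" "m \<le> 2 * k" using assms by (cases e) auto
  have "\<lceil>real m / 2\<rceil> \<le> int k" using m by (simp add: ceiling_le_iff)
  thus ?thesis using m by (simp add: ceil_half_def)
qed

lemma enat_minus_one_minus_one_le:
  assumes "e \<le> enat (2 * k + 2)"
  shows "e - 1 - 1 \<le> enat (2 * k)"
  using assms by (cases e) (auto simp: one_enat_def)

lemma gdist_le: "(u, v) \<in> adj G V ^^ k \<Longrightarrow> gdist G V u v \<le> enat k"
  unfolding gdist_def by (rule INF_lower) simp

text \<open>For an infinite exponent the finite bounds hold for every \<open>n\<close>, and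
  \<open>\<rho> < 1\<close> sends them to 0, the value fixed by \<open>enat_power\<close>.\<close>

lemma le_enat_power_limit:
  assumes \<rho>: "0 \<le> \<rho>" "\<rho> < 1" and le: "\<And>n. enat n \<le> e \<Longrightarrow> x \<le> C * \<rho> ^ n"
  shows "x \<le> C * enat_power \<rho> e"
proof (cases e)
  case (enat n)
  thus ?thesis using le[of n] by (simp add: enat_power_def)
next
  case infinity
  hence "x \<le> C * \<rho> ^ n" for n using le by simp
  moreover have "(\<lambda>n. C * \<rho> ^ n) \<longlonglongrightarrow> C * 0"
    using \<rho> by (intro tendsto_mult tendsto_const LIMSEQ_power_zero) auto
  ultimately have "x \<le> C * 0" by (intro LIMSEQ_le_const[of _ "C * 0" x]) auto
  thus ?thesis using infinity by (simp add: enat_power_def)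
qed

section \<open>Coupling of a subdomain to its neighbourhood\<close>

locale schwarz_subdomain = V: qp_nodes G V + W: qp_nodes G W for G V W +
  assumes sub: "W \<subseteq> V"
begin

abbreviation "N \<equiv> nbh G V W"

lemma N: "N \<subseteq> V" "N \<inter> W = {}" "finite N"
  using V.U_finite by (auto simp: nbh_def)

definition data :: "real vec \<Rightarrow> real vec \<Rightarrow> real vec" where
  "data dV y = block_extract G W V dV - Hcompl G V W *\<^sub>v block_extract G N V y"

lemma data_in_data_set: "data dV y \<in> data_set G V dV W"
  unfolding data_set_def data_def mem_Collect_eq
  by (intro exI[of _ "block_extract G N V y"] conjI refl block_extract_carrier)

lemma zf_data:
  assumes a: "a \<in> all_idx G W"
  shows "zf G W (data dV y) a = zf G V dV a - kernel_app (hk G) (all_idx G N) (zf G V y) a"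
proof -
  obtain i s where is_eq: "a = (i, s)" by fastforce
  have i: "i \<in> W" "s < ndim G i" using a by (auto simp: is_eq)
  have c: "block_extract G W V dV \<in> carrier_vec (block_dim (ndim G) W)"
    "block_extract G N V y \<in> carrier_vec (block_dim (ndim G) N)"
    using block_extract_carrier unfolding nU_def by blast+
  hence c3: "Hcompl G V W *\<^sub>v block_extract G N V y \<in> carrier_vec (block_dim (ndim G) W)"
    unfolding Hcompl_def by (intro mult_mat_vec_carrier[OF block_mat_carrier])
  have "zf G W (Hcompl G V W *\<^sub>v block_extract G N V y) a =
      kernel_app (hk G) (all_idx G N) (zf G N (block_extract G N V y)) a"
    unfolding Hcompl_def hk_def by (rule bfun_block_mat_mult[OF W.U_finite N(3) a c(2)])
  also have "\<dots> = kernel_app (hk G) (all_idx G N) (zf G V y) a"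
    by (rule kernel_app_cong) (auto simp: bfun_block_extract N(3))
  finally show ?thesis
    unfolding data_def bfun_diff[OF W.U_finite a c(1) c3] using bfun_block_extract[OF W.U_finite i] is_eq by simp
qed

text \<open>Nodes of \<open>V\<close> outside \<open>W\<close> and \<open>N\<close> share no edge
  with \<open>W\<close>, so by sparsity they do not enter rows of \<open>W\<close>. The neighbour
  term is the one that \<open>data\<close> moves to the right-hand side.\<close>

lemma kernel_split:
  assumes a: "a \<in> all_idx G W"
  shows "kernel_app (hk G) (all_idx G V) w a = kernel_app (hk G) (all_idx G W) w a + kernel_app (hk G) (all_idx G N) w a"
proof -
  have "kernel_app (hk G) (all_idx G V) w a = (\<Sum>b\<in>all_idx G W \<union> all_idx G N. hk G a b * w b)"
    unfolding kernel_app_def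
  proof (rule sum.mono_neutral_right)
    show "finite (all_idx G V)" using V.U_finite by simp
    show "all_idx G W \<union> all_idx G N \<subseteq> all_idx G V" using sub N(1) by auto
    show "\<forall>b\<in>all_idx G V - (all_idx G W \<union> all_idx G N). hk G a b * w b = 0"
    proof
      fix b assume b: "b \<in> all_idx G V - (all_idx G W \<union> all_idx G N)"
      obtain i s j t where ab: "a = (i, s)" "b = (j, t)" by fastforce
      have "i \<in> W" "s < ndim G i" "j \<in> V" "j \<notin> W" "j \<notin> N" "t < ndim G j" using a b by (auto simp: ab)
      hence "hk G a b = 0"
        using hk_neighbours[OF V.valid, of i j s t] V.node W.node sub by (auto simp: ab nbh_def)
      thus "hk G a b * w b = 0" by simp
    qed
  qed
  also have "\<dots> = kernel_app (hk G) (all_idx G W) w a + kernel_app (hk G) (all_idx G N) w a"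
    unfolding kernel_app_def using W.U_finite N by (intro sum.union_disjoint) auto
  finally show ?thesis .
qed

text \<open>Row by row, the residual over \<open>V\<close> with data \<open>dV\<close> equals the
  residual over \<open>W\<close> with the coupled data. All conditions are about residuals and
  signs, so they carry over.\<close>

lemma restricted_solution:
  assumes "mcp_solution (hk G) (all_idx G V) (ineq_idx G V) (zf G V dV) (zf G V y)"
  shows "mcp_solution (hk G) (all_idx G W) (ineq_idx G W) (zf G W (data dV y)) (zf G V y)"
proof -
  have J: "ineq_idx G W \<subseteq> ineq_idx G V" "all_idx G W - ineq_idx G W \<subseteq> all_idx G V - ineq_idx G V"
    "ineq_idx G W \<subseteq> all_idx G W"
    using sub by (auto simp: ineq_idx_def)
  have eq: "kernel_app (hk G) (all_idx G V) (zf G V y) a - zf G V dV a =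
      kernel_app (hk G) (all_idx G W) (zf G V y) a - zf G W (data dV y) a" if "a \<in> all_idx G W" for a
    using kernel_split[OF that] zf_data[OF that] by simp
  show ?thesis unfolding mcp_solution_def
  proof (intro conjI ballI)
    fix a assume a: "a \<in> all_idx G W - ineq_idx G W"
    hence "kernel_app (hk G) (all_idx G V) (zf G V y) a = zf G V dV a"
      using assms J(2) unfolding mcp_solution_def by blast
    thus "kernel_app (hk G) (all_idx G W) (zf G V y) a = zf G W (data dV y) a" using eq[of a] a by simp
  next
    fix a assume a: "a \<in> ineq_idx G W"
    hence m: "a \<in> ineq_idx G V" "a \<in> all_idx G W" using J by auto
    have "kernel_app (hk G) (all_idx G V) (zf G V y) a \<ge> zf G V dV a" "zf G V y a \<le> 0"
      "zf G V y a * (kernel_app (hk G) (all_idx G V) (zf G V y) a - zf G V dV a) = 0"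
      using assms m(1) unfolding mcp_solution_def by blast+
    thus "zf G W (data dV y) a \<le> kernel_app (hk G) (all_idx G W) (zf G V y) a" "zf G V y a \<le> 0"
      "zf G V y a * (kernel_app (hk G) (all_idx G W) (zf G V y) a - zf G W (data dV y) a) = 0"
      using eq[OF m(2)] by (auto simp del: mult_eq_0_iff)
  qed
qed

text \<open>The bound is \<open>Suc m\<close> rather than \<open>m\<close> because changing
  \<open>z\<close> on \<open>N\<close> alters the data at nodes adjacent to \<open>N\<close>: level
  0 already lies one step away.\<close>

definition reach :: "nat \<Rightarrow> (int \<times> nat) set" where
  "reach m = {(i, s). \<exists>u\<in>N. \<exists>k\<le>Suc m. (i, u) \<in> adj G V ^^ k}"

lemma reach_Suc: "reach m \<subseteq> reach (Suc m)"
  unfolding reach_def by (auto intro: le_SucI)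

lemma reach_step:
  assumes ab: "a \<in> all_idx G W" "b \<in> all_idx G W" "b \<in> reach m" "hk G a b \<noteq> 0"
  shows "a \<in> reach (Suc m)"
proof -
  obtain i s j t where eq: "a = (i, s)" "b = (j, t)" by fastforce
  have ij: "i \<in> V" "j \<in> V" "s < ndim G i" "t < ndim G j" using ab sub by (auto simp: eq)
  obtain u k where u: "u \<in> N" "k \<le> Suc m" "(j, u) \<in> adj G V ^^ k" using ab(3) by (auto simp: reach_def eq)
  have "i = j \<or> {i, j} \<in> edges G"
    using hk_neighbours[OF V.valid V.node V.node, of i j s t] ij ab(4) eq by blast
  thus ?thesis
  proof
    assume "i = j"
    thus ?thesis using u unfolding reach_def eq by (auto intro: le_SucI)
  next
    assume "{i, j} \<in> edges G"
    hence "(i, j) \<in> adj G V" using ij by (simp add: adj_def)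
    hence "(i, u) \<in> adj G V ^^ Suc k" using u(3) by (rule relpow_Suc_I2)
    moreover have "Suc k \<le> Suc (Suc m)" using u(2) by simp
    ultimately show ?thesis using u(1) unfolding reach_def eq by blast
  qed
qed

lemma reach_support:
  assumes a: "a \<in> all_idx G W" "a \<notin> reach 0"
  shows "kernel_app (hk G) (all_idx G N) w a = 0"
  unfolding kernel_app_def
proof (rule sum.neutral, rule ballI)
  fix b assume b: "b \<in> all_idx G N"
  obtain i s j t where eq: "a = (i, s)" "b = (j, t)" by fastforce
  have ij: "i \<in> W" "i \<in> V" "j \<in> V" "j \<in> N" "s < ndim G i" "t < ndim G j" using a b sub N by (auto simp: eq)
  have "{i, j} \<notin> edges G"
  proof
    assume "{i, j} \<in> edges G"
    hence "(i, j) \<in> adj G V ^^ 1" using ij by (simp add: adj_def)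
    hence "a \<in> reach 0" unfolding reach_def eq using ij(4) by (auto intro!: bexI[of _ j] exI[of _ 1])
    thus False using a(2) by simp
  qed
  moreover have "i \<noteq> j" using ij N(2) by auto
  ultimately have "hk G a b = 0" using hk_neighbours[OF V.valid V.node V.node, of i j s t] ij eq by blast
  thus "hk G a b * w b = 0" by simp
qed

lemma reach_distance:
  assumes "(i, s) \<in> reach m" "i \<in> X"
  shows "gdist_set G V X N \<le> enat (Suc m)"
proof -
  obtain u k where u: "u \<in> N" "k \<le> Suc m" "(i, u) \<in> adj G V ^^ k" using assms(1) by (auto simp: reach_def)
  have "gdist_set G V X N \<le> (INF u'\<in>N. gdist G V i u')" unfolding gdist_set_def using assms(2) by (rule INF_lower)
  also have "\<dots> \<le> gdist G V i u" using u(1) by (rule INF_lower)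
  also have "\<dots> \<le> enat k" using u(3) by (rule gdist_le)
  also have "\<dots> \<le> enat (Suc m)" using u(2) by simp
  finally show ?thesis .
qed

text \<open>Each pair of nodes is estimated by one induced norm, and the common bound
  \<open>r\<close> on all blocks factors out of the double sum.\<close>

lemma coupling_bound:
  assumes y: "y \<in> carrier_vec (nU G V)" and r: "\<And>j. j \<in> V \<Longrightarrow> vnorm (block (ndim G) V y j) \<le> r"
  shows "L2_set (kernel_app (hk G) (all_idx G N) (zf G V y)) (all_idx G W) \<le> Hcompl_norm1 G V W * r"
proof -
  let ?n = "ndim G"
  have entry_bound: "L2_set (\<lambda>(i', s). \<Sum>t<?n j. hk G (i', s) (j, t) * zf G V y (j, t)) ({i} \<times> {..<?n i}) \<le> mnorm (Hblk G i j) * r"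
    if i: "i \<in> W" and j: "j \<in> N" for i j
  proof -
    have H: "Hblk G i j \<in> carrier_mat (?n i) (?n j)"
      using Hblk_carrier[OF V.valid V.node V.node, of i j] i j sub N by auto
    have b: "block ?n V y j \<in> carrier_vec (?n j)" by (simp add: block_def)
    have "(\<Sum>s<?n i. ((Hblk G i j *\<^sub>v block ?n V y j) $ s)\<^sup>2) =
        (\<Sum>(i', s)\<in>{i} \<times> {..<?n i}. (\<Sum>t<?n j. hk G (i', s) (j, t) * zf G V y (j, t))\<^sup>2)"
    proof (rule sum.reindex_bij_witness[of _ snd "Pair i"])
      fix s assume "s \<in> {..<?n i}"
      thus "(case (i, s) of (i', s) \<Rightarrow> (\<Sum>t<?n j. hk G (i', s) (j, t) * zf G V y (j, t))\<^sup>2) = ((Hblk G i j *\<^sub>v block ?n V y j) $ s)\<^sup>2"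
        using H b by (simp add: scalar_prod_def lessThan_atLeast0 hk_def entry_def bfun_def)
    qed auto
    hence "L2_set (\<lambda>(i', s). \<Sum>t<?n j. hk G (i', s) (j, t) * zf G V y (j, t)) ({i} \<times> {..<?n i}) =
        vnorm (Hblk G i j *\<^sub>v block ?n V y j)"
      using H by (simp add: vnorm_eq_L2_set L2_set_def case_prod_unfold)
    also have "\<dots> \<le> mnorm (Hblk G i j) * vnorm (block ?n V y j)" using H b by (intro vnorm_mult_le) auto
    also have "\<dots> \<le> mnorm (Hblk G i j) * r" using r[of j] j N by (intro mult_left_mono mnorm_nonneg) auto
    finally show ?thesis .
  qed
  have "L2_set (kernel_app (hk G) (all_idx G N) (zf G V y)) (all_idx G W)
      \<le> (\<Sum>i\<in>W. L2_set (kernel_app (hk G) (all_idx G N) (zf G V y)) ({i} \<times> {..<?n i}))"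
    unfolding idx_def by (rule L2_set_UN_le[OF W.U_finite])
  also have "\<dots> \<le> (\<Sum>i\<in>W. \<Sum>j\<in>N. mnorm (Hblk G i j) * r)"
  proof (rule sum_mono)
    fix i assume i: "i \<in> W"
    have "kernel_app (hk G) (all_idx G N) (zf G V y) a =
        (\<Sum>j\<in>N. case a of (i', s) \<Rightarrow> \<Sum>t<?n j. hk G (i', s) (j, t) * zf G V y (j, t))" for a
      unfolding kernel_app_def idx_def using N(3) by (simp add: sum.Sigma case_prod_unfold)
    hence "L2_set (kernel_app (hk G) (all_idx G N) (zf G V y)) ({i} \<times> {..<?n i}) =
        L2_set (\<lambda>a. \<Sum>j\<in>N. case a of (i', s) \<Rightarrow> \<Sum>t<?n j. hk G (i', s) (j, t) * zf G V y (j, t)) ({i} \<times> {..<?n i})"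
      by (intro L2_set_cong refl)
    also have "\<dots> \<le> (\<Sum>j\<in>N. L2_set (\<lambda>(i', s). \<Sum>t<?n j. hk G (i', s) (j, t) * zf G V y (j, t)) ({i} \<times> {..<?n i}))"
      by (rule L2_set_sum_le)
    also have "\<dots> \<le> (\<Sum>j\<in>N. mnorm (Hblk G i j) * r)" using entry_bound[OF i] by (intro sum_mono)
    finally show "L2_set (kernel_app (hk G) (all_idx G N) (zf G V y)) ({i} \<times> {..<?n i})
        \<le> (\<Sum>j\<in>N. mnorm (Hblk G i j) * r)" .
  qed
  finally show ?thesis by (simp add: Hcompl_norm1_def sum_distrib_right)
qed

end

text \<open>The neighbourhood of \<open>V\<close> within \<open>V\<close> is empty, so the coupling
  term vanishes. This brings the full problem with data \<open>dV\<close> under the regularity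
  assumption.\<close>

lemma data_set_self:
  assumes "qp_nodes G V" and d: "dV \<in> carrier_vec (nU G V)"
  shows "dV \<in> data_set G V dV V"
proof -
  interpret V: qp_nodes G V by fact
  interpret schwarz_subdomain G V V by unfold_locales simp
  have N0: "nbh G V V = {}" by (auto simp: nbh_def)
  have "zf G V (data dV dV) a = zf G V dV a" if "a \<in> all_idx G V" for a
    unfolding zf_data[OF that] by (simp add: N0 kernel_app_def idx_def)
  moreover have "data dV dV \<in> carrier_vec (nU G V)"
    unfolding data_def using block_extract_carrier
    by (simp add: Hcompl_def nU_def mult_mat_vec_carrier[OF block_mat_carrier])
  ultimately have "data dV dV = dV" using d unfolding nU_def by (intro bfun_eqI[OF V.U_finite]) auto
  thus ?thesis using data_in_data_set[of dV dV] by simp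
qed

text \<open>Each node lies in exactly one \<open>P k\<close>, and its block is updated from
  \<open>W k\<close> alone; the maximum norm over nodes therefore allows one block to be estimated
  at a time, with constants common to all subdomains.\<close>

theorem theorem2:
  fixes G :: graph_qp
    and D :: "int set \<Rightarrow> real vec set"
    and V :: "int set"
    and dV :: "real vec"
    and K :: nat
    and P W :: "nat \<Rightarrow> int set"
    and z :: "nat \<Rightarrow> real vec"
  assumes graph: "valid_graph_qp G"
    and V: "V \<subseteq> nodes G" "finite V" "V \<noteq> {}"
    and dV: "dV \<in> carrier_vec (nU G V)"
    and partition: "\<And>k. k \<in> {1..K} \<Longrightarrow> P k \<noteq> {}"
      "disjoint_family_on P {1..K}" "(\<Union>k\<in>{1..K}. P k) = V"
    and W: "\<And>k. k \<in> {1..K} \<Longrightarrow> P k \<subseteq> W k \<and> W k \<subseteq> V"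
    and D_convex: "\<And>U. U \<subseteq> nodes G \<Longrightarrow> finite U \<Longrightarrow> U \<noteq> {} \<Longrightarrow>
      D U \<subseteq> carrier_vec (nU G U) \<and> convex_vecs (D U)"
    and D_def: "\<And>U. U \<subseteq> V \<Longrightarrow> U \<noteq> {} \<Longrightarrow> D U = data_set G V dV U"
    and regular: "\<And>U. U \<subseteq> V \<Longrightarrow> U \<noteq> {} \<Longrightarrow> pos_semidef (Qmat G U) \<and>
      (\<forall>d\<in>D U. \<exists>y. pd_solution G U d y \<and> SOSC G U d y \<and> LICQ G U d y)"
    and omega: "overlap G V K P W \<ge> 1"
    and sigma: "sigma_inf G D > 0" "bdd_above (sigma_high G D ` based_sets G D)"
    and z: "\<And>l. z l \<in> carrier_vec (nU G V)"
    and schwarz: "\<And>k l. k \<in> {1..K} \<Longrightarrow>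
      block_extract G (P k) V (z (Suc l)) =
        block_extract G (P k) (W k) (zstar G (W k)
          (block_extract G (W k) V dV
             - Hcompl G V (W k) *\<^sub>v block_extract G (nbh G V (W k)) V (z l)))"
  shows "norm_inf G V (z l - zstar G V dV)
    \<le> alpha G D V (overlap G V K P W) ^ l * norm_inf G V (z 0 - zstar G V dV)"
proof -
  interpret V: qp_nodes G V using graph V by unfold_locales
  define s where "s = zstar G V dV"
  define r where "r l = norm_inf G V (z l - s)" for l
  define \<omega> where "\<omega> = overlap G V K P W"
  define H where "H = ceil_half (\<omega> - 1)"
  have DV: "dV \<in> D V" using data_set_self[OF V.qp_nodes_axioms dV] D_def[of V] V by simp
  obtain y where y: "pd_solution G V dV y" "SOSC G V dV y" "LICQ G V dV y"
    using regular[of V] V DV by blast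
  have psdV: "pos_semidef (Qmat G V)" using regular[of V] V by blast
  have "s = y" unfolding s_def by (rule V.zstar_eq(1)[OF psdV y])
  hence s: "s \<in> carrier_vec (nU G V)"
    and mcp: "mcp_solution (hk G) (all_idx G V) (ineq_idx G V) (zf G V dV) (zf G V s)"
    using y(1) unfolding V.pd_solution_iff by auto
  \<comment> \<open>The infimum and supremum thus range over a nonempty family, from which
    \<open>sigma_inf G D \<le> sigma_sup G D\<close> is obtained.\<close>
  have based: "V \<in> based_sets G D"
    using V.regular_based[of D dV y, OF V(3) _ DV y] D_convex[OF V] by blast
  note rate = rate_constants[OF sigma(1) sigma_inf_le_sup[OF graph based sigma(2)]]
  have finV: "finite ((\<lambda>i. vnorm (block (ndim G) V w i)) ` V)" for w using V by simp
  have block_le: "vnorm (block (ndim G) V (z l - s) i) \<le> r l" if "i \<in> V" for i l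
    unfolding r_def norm_inf_def using finV that by (intro Max_ge) auto
  have zdiff: "zf G V (z l - s) a = zf G V (z l) a - zf G V s a" if "a \<in> all_idx G V" for l a
    using bfun_diff[OF V(2) that] z s by (simp add: nU_def)
  have R: "Hcompl_norm1 G V U \<le> R_const G V" if "U \<subseteq> V" for U
    unfolding R_const_def using V(2) that by (intro Max_ge) auto
  have "0 \<le> Hcompl_norm1 G V V" unfolding Hcompl_norm1_def by (intro sum_nonneg mnorm_nonneg)
  hence R0: "0 \<le> R_const G V" using R[of V] by simp
  have r0: "0 \<le> r l" for l
  proof -
    obtain i where "i \<in> V" using V(3) by blast
    from block_le[OF this, of l] vnorm_nonneg show ?thesis by (rule order_trans[rotated])
  qed
  \<comment> \<open>Stated for every finite exponent up to \<open>H\<close>, because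
    \<open>H\<close> itself may be infinite.\<close>
  have contraction: "vnorm (block (ndim G) V (z (Suc l) - s) i) \<le> R_const G V * Gamma_const G D * r l * rho_const G D ^ n"
    if i: "i \<in> V" and n: "enat n \<le> H" for i l n
  proof -
    obtain k where k: "k \<in> {1..K}" "i \<in> P k" using i partition(3) by blast
    have Wk: "P k \<subseteq> W k" "W k \<subseteq> V" "W k \<noteq> {}" using W[OF k(1)] k(2) by auto
    have finW: "finite (W k)" using Wk V finite_subset by blast
    have Wn: "W k \<subseteq> nodes G" using Wk V by blast
    interpret schwarz_subdomain G V "W k"
      using graph Wn finW Wk by unfold_locales
    have reg: "\<exists>y. pd_solution G (W k) d y \<and> SOSC G (W k) d y \<and> LICQ G (W k) d y" if "d \<in> D (W k)" for d
      using regular[OF Wk(2,3)] that by blast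
    have psd: "pos_semidef (Qmat G (W k))" using regular[OF Wk(2,3)] by blast
    have dD: "data dV w \<in> D (W k)" for w using D_def[OF Wk(2,3)] data_in_data_set by simp
    let ?I = "{i} \<times> {..<ndim G i}"
    have I: "?I \<subseteq> all_idx G (W k)" using k(2) Wk by auto
    have fixed: "zf G V s a = zf G (W k) (zstar G (W k) (data dV s)) a" if a: "a \<in> all_idx G (W k)" for a
    proof -
      obtain y' where y': "pd_solution G (W k) (data dV s) y'" "SOSC G (W k) (data dV s) y'" "LICQ G (W k) (data dV s) y'"
        using reg[OF dD] by blast
      show ?thesis
        unfolding W.zstar_eq(1)[OF psd y'] by (rule W.zstar_eq(2)[OF psd y' restricted_solution[OF mcp] a])
    qed
    have update: "zf G V (z (Suc l)) a = zf G (W k) (zstar G (W k) (data dV (z l))) a" if a: "a \<in> ?I" for a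
    proof -
      obtain t where t: "a = (i, t)" "t < ndim G i" using a by auto
      have finP: "finite (P k)" using Wk finW finite_subset by blast
      show ?thesis
        using arg_cong[OF schwarz[OF k(1), of l], of "\<lambda>v. zf G (P k) v a"]
          bfun_block_extract[OF finP k(2) t(2)] unfolding t(1) data_def by simp
    qed
    \<comment> \<open>Level \<open>2 * m + 1\<close> means distance at most
      \<open>2 * m + 2\<close>, so \<open>\<omega> - 1\<close> is at most \<open>2 * m\<close> and
      \<open>H\<close> at most \<open>m\<close>, contradicting \<open>m < n\<close>.\<close>
    have away: "a \<notin> reach (2 * m + 1)" if mn: "m < n" and aI: "a \<in> ?I" for m a
    proof
      assume "a \<in> reach (2 * m + 1)"
      moreover obtain t where "a = (i, t)" using aI by auto
      ultimately have "gdist_set G V (P k) N \<le> enat (2 * m + 2)" using reach_distance[of i t "2 * m + 1" "P k"] k(2) by simp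
      moreover have "(MIN k\<in>{1..K}. gdist_set G V (P k) (nbh G V (W k))) \<le> gdist_set G V (P k) N"
        using k(1) by (intro Min_le) auto
      ultimately have "(MIN k\<in>{1..K}. gdist_set G V (P k) (nbh G V (W k))) \<le> enat (2 * m + 2)" by (rule order_trans[rotated])
      hence "H \<le> enat m" unfolding H_def \<omega>_def overlap_def by (intro ceil_half_le enat_minus_one_minus_one_le)
      hence "enat n \<le> enat m" using n by (rule order_trans[rotated])
      thus False using mn by simp
    qed
    \<comment> \<open>The fixed data \<open>dV\<close> cancel and only the error on the
      neighbourhood remains; its sign disappears in the norm.\<close>
    have ddiff: "zf G (W k) (data dV (z l)) a - zf G (W k) (data dV s) a =
        - kernel_app (hk G) (all_idx G N) (zf G V (z l - s)) a" if a: "a \<in> all_idx G (W k)" for a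
    proof -
      have "kernel_app (hk G) (all_idx G N) (zf G V (z l - s)) a =
          kernel_app (hk G) (all_idx G N) (\<lambda>b. zf G V (z l) b - zf G V s b) a"
        using N(1) zdiff by (intro kernel_app_cong) auto
      thus ?thesis unfolding zf_data[OF a] by (simp add: kernel_app_diff)
    qed
    have supp: "zf G (W k) (data dV (z l)) a = zf G (W k) (data dV s) a" if "a \<in> all_idx G (W k)" "a \<notin> reach 0" for a
      using ddiff[OF that(1)] reach_support[OF that] by simp
    have "vnorm (block (ndim G) V (z (Suc l) - s) i) = L2_set (zf G V (z (Suc l) - s)) ?I" by (rule vnorm_block)
    also have "\<dots> = L2_set (\<lambda>a. zf G (W k) (zstar G (W k) (data dV (z l))) a - zf G (W k) (zstar G (W k) (data dV s)) a) ?I"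
    proof (intro L2_set_cong refl)
      fix a assume a: "a \<in> ?I"
      hence aW: "a \<in> all_idx G (W k)" using I by blast
      hence aV: "a \<in> all_idx G V" using Wk(2) by (cases a) auto
      show "zf G V (z (Suc l) - s) a =
          zf G (W k) (zstar G (W k) (data dV (z l))) a - zf G (W k) (zstar G (W k) (data dV s)) a"
        unfolding zdiff[OF aV] update[OF a] fixed[OF aW] ..
    qed
    also have "\<dots> \<le> Gamma_const G D * rho_const G D ^ n *
        L2_set (\<lambda>a. zf G (W k) (data dV (z l)) a - zf G (W k) (data dV s) a) (all_idx G (W k))"
    proof (rule W.sensitivity[of D "data dV s" "data dV (z l)" reach ?I n, OF Wk(3)])
      show "D (W k) \<subseteq> carrier_vec (nU G (W k))" "convex_vecs (D (W k))"
        using D_convex[OF Wn finW Wk(3)] by auto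
      show "pos_semidef (Qmat G (W k))" by (rule psd)
      show "\<exists>y. pd_solution G (W k) d y \<and> SOSC G (W k) d y \<and> LICQ G (W k) d y" if "d \<in> D (W k)" for d
        by (rule reg[OF that])
      show "data dV s \<in> D (W k)" "data dV (z l) \<in> D (W k)" by (rule dD)+
      show "0 < sigma_inf G D" "bdd_above (sigma_high G D ` based_sets G D)" by (rule sigma)+
    next
      fix m show "reach m \<subseteq> reach (Suc m)" by (rule reach_Suc)
    next
      show "?I \<subseteq> all_idx G (W k)" by (rule I)
    qed (rule supp reach_step away, assumption+)+
    finally have sens: "vnorm (block (ndim G) V (z (Suc l) - s) i) \<le> Gamma_const G D * rho_const G D ^ n *
        L2_set (\<lambda>a. zf G (W k) (data dV (z l)) a - zf G (W k) (data dV s) a) (all_idx G (W k))" .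
    have "L2_set (\<lambda>a. zf G (W k) (data dV (z l)) a - zf G (W k) (data dV s) a) (all_idx G (W k)) =
        L2_set (kernel_app (hk G) (all_idx G N) (zf G V (z l - s))) (all_idx G (W k))"
      unfolding L2_set_def using ddiff by (intro arg_cong[where f = sqrt] sum.cong refl) simp
    also have "\<dots> \<le> Hcompl_norm1 G V (W k) * r l"
      using z s block_le by (intro coupling_bound) auto
    also have "\<dots> \<le> R_const G V * r l" using R[OF Wk(2)] r0 by (intro mult_right_mono)
    finally have "Gamma_const G D * rho_const G D ^ n *
        L2_set (\<lambda>a. zf G (W k) (data dV (z l)) a - zf G (W k) (data dV s) a) (all_idx G (W k))
        \<le> Gamma_const G D * rho_const G D ^ n * (R_const G V * r l)"
      using rate by (intro mult_left_mono) auto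
    with sens show ?thesis by (simp add: mult_ac)
  qed
  have step: "r (Suc l) \<le> alpha G D V \<omega> * r l" for l
  proof -
    have "vnorm (block (ndim G) V (z (Suc l) - s) i) \<le> R_const G V * Gamma_const G D * r l * enat_power (rho_const G D) H"
      if "i \<in> V" for i
      by (rule le_enat_power_limit[OF rate(1,2) contraction[OF that]])
    hence "r (Suc l) \<le> R_const G V * Gamma_const G D * r l * enat_power (rho_const G D) H"
      unfolding r_def[of "Suc l"] norm_inf_def using V finV by (intro Max.boundedI) auto
    thus ?thesis by (simp add: alpha_def H_def mult_ac)
  qed
  \<comment> \<open>Nonnegativity permits multiplying the induction hypothesis by the rate, which
    may exceed 1.\<close>
  have alpha0: "0 \<le> alpha G D V \<omega>"
    unfolding alpha_def enat_power_def using R0 rate by (auto split: enat.split)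
  have "r l \<le> alpha G D V \<omega> ^ l * r 0"
  proof (induction l)
    case (Suc l)
    have "r (Suc l) \<le> alpha G D V \<omega> * r l" by (rule step)
    also have "\<dots> \<le> alpha G D V \<omega> * (alpha G D V \<omega> ^ l * r 0)" using Suc alpha0 by (intro mult_left_mono)
    finally show ?case by (simp add: mult_ac)
  qed simp
  thus ?thesis by (simp add: r_def \<omega>_def s_def)
qed

end
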